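(* For every $\varepsilon>0$ there is a constant $c_\varepsilon>0$ such that every convex set $A\subset\mathbb{R}$ satisfies $S(A)\geq c_\varepsilon |A|^{\frac12+\frac1{75}-\varepsilon}$.
   Context: A convex set is a finite set $A=\{a_1<\cdots<a_n\}\subset\mathbb{R}$ whose consecutive differences $a_{i+1}-a_i$ form a strictly increasing sequence. A set $B$ is Sidon if the only solutions of $a+b=c+d$ with $a,b,c,d\in B$ have $\{a,b\}=\{c,d\}$. $S(A)=\max\{|B|: B\subseteq A,\ B\text{ Sidon}\}$. *)

theory Defs
  imports Complex_Main
begin

(* Unrelated to the library's "convex": this is the additive-combinatorics notion of a finite
   set of reals. The strictly increasing enumeration a of A on {1..n} is unique, and n = card A. *)
definition convex_set :: "real set \<Rightarrow> bool" where
  "convex_set A \<longleftrightarrow> (\<exists>(n::nat) (a::nat \<Rightarrow> real).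
     A = a ` {1..n} \<and> strict_mono_on {1..n} a \<and>
     strict_mono_on {1..<n} (\<lambda>i. a (i + 1) - a i))"

definition sidon :: "real set \<Rightarrow> bool" where
  "sidon B \<longleftrightarrow> (\<forall>a\<in>B. \<forall>b\<in>B. \<forall>c\<in>B. \<forall>d\<in>B. a + b = c + d \<longrightarrow> {a, b} = {c, d})"

(* For finite A the maximum is over a finite set, nonempty because the empty set is Sidon. *)
definition max_sidon :: "real set \<Rightarrow> nat" where
  "max_sidon A = Max {card B | B. B \<subseteq> A \<and> sidon B}"

end

theory Submission
  imports Defs "HOL-Analysis.Analysis" "HOL-Computational_Algebra.Primes" "HOL-Number_Theory.Cong"
    "HOL-Real_Asymp.Real_Asymp"
begin

text \<open>
  Let \<open>n\<close> be the size of the convex set \<open>A\<close> and let \<open>r\<close> count representations as a difference of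
  two elements of \<open>A\<close>. Convexity gives an \<open>L\<^sup>3\<close> control: for every finite \<open>B\<close>, at most
  \<open>O(n |B|\<^sup>2 / k\<^sup>3)\<close> reals have \<open>k\<close> representations in \<open>A - B\<close>. Hence few pairs of \<open>A\<close> have a
  popular difference. Indeed, join two elements of \<open>A\<close> when their difference has at least \<open>s\<close>
  representations, and weight a path \<open>a - b - c\<close> by \<open>r (a - c)\<close>. Since \<open>r\<close> is positive definite the
  total weight is large, while Cauchy--Schwarz and the control, applied with \<open>B\<close> the set of popular
  differences, bound it from above. The number \<open>N(s)\<close> of joined pairs thus satisfies
  \<open>N(s)^51 s^37 \<le> n^(118 + o(1))\<close>.

  To find a Sidon subset, map \<open>A\<close> to \<open>(\<int>/p)\<^sup>2\<close> by two random dilations of the circle, followed by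
  rounding, and keep the elements that land on a random parabola, which is a Sidon set. In a surviving
  additive quadruple the elements share cells in pairs. If the common difference of these pairs has at
  least \<open>p\<close> representations, then the first pair is destroyed, and otherwise the quadruple is. This
  costs less than half of the kept elements as soon as \<open>p \<ge> n^(67/139 + o(1))\<close>, and leaves a Sidon set
  of size about \<open>n/p\<close>. Since \<open>72/139 > 1/2 + 1/75\<close> there is room for a crude choice of the prime.
\<close>

section \<open>Control of convex sets\<close>

text \<open>The obstacle is the exponent 1/2. The control alone gives additive energy n^(5/2) up to
  logarithms. A quadruple survives with probability about p^(-4) while n/p elements are kept, so
  charging all quadruples needs n^(5/2) / p^3 <= n, that is p >= n^(1/2). Charging pairs instead of
  quadruples at popular differences beats this, and p itself is the balanced cutoff: with N(s) about
  G s^(-37/51), G = n^(118/51), the pairs cost N(p) / p^2 and the other quadruples (N(1) + ... +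
  N(p)) / p^3, and both are about G p^(-139/51). Equating this with n gives p = n^(67/139). The
  exponents of N(s) come from s N^3 <= n^3 Z, Z^2 <= n^3 Y, s^8 Y^10 <= n^28 m^9 and s m <= N, up to
  constants and logarithms. Here Z is the total weight of the paths, m the number of popular
  differences, and Y the sum of r(x - y)^2 over pairs of them.\<close>

definition rep :: "real set \<Rightarrow> real set \<Rightarrow> real \<Rightarrow> nat" where
  "rep A B x = card {b\<in>B. x + b \<in> A}"

text \<open>A weak-type \<open>L^3\<close> bound of the kind that Szemeredi-Trotter gives for convex
  sets. The freedom in \<open>B\<close> matters: it is used for \<open>A\<close> itself, for sets of
  popular differences and for dilates of \<open>A\<close>.\<close>

definition controlled :: "real \<Rightarrow> real set \<Rightarrow> bool" where
  "controlled C A \<longleftrightarrow> (\<forall>B k. finite B \<longrightarrow> 0 < k \<longrightarrow>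
     real (card {x. k \<le> rep A B x}) * real k ^ 3 \<le> C * real (card A) * real (card B) ^ 2)"

lemma rep_le_left: "finite A \<Longrightarrow> rep A B x \<le> card A"
  unfolding rep_def by (rule card_inj_on_le[of "\<lambda>b. x + b"]) (auto simp: inj_on_def)

lemma rep_le_right: "finite B \<Longrightarrow> rep A B x \<le> card B"
  unfolding rep_def by (rule card_mono) auto

lemma rep_support: "{x. 0 < rep A B x} \<subseteq> (\<lambda>(a,b). a - b) ` (A \<times> B)"
proof
  fix x assume "x \<in> {x. 0 < rep A B x}"
  then obtain b where "b \<in> B" "x + b \<in> A" unfolding rep_def by (auto simp: card_gt_0_iff)
  then show "x \<in> (\<lambda>(a,b). a - b) ` (A \<times> B)" by (force intro: image_eqI[of _ _ "(x+b,b)"])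
qed

lemma finite_rep_ge: "finite A \<Longrightarrow> finite B \<Longrightarrow> 0 < k \<Longrightarrow> finite {x. k \<le> rep A B x}"
  by (rule finite_subset[of _ "(\<lambda>(a,b). a - b) ` (A \<times> B)"])
    (use rep_support[of A B] in \<open>force+\<close>)

lemma card_rep_ge_trivial:
  assumes "finite A" "finite B" "0 < k"
  shows "card {x. k \<le> rep A B x} * k \<le> card A * card B"
proof -
  let ?X = "{x. k \<le> rep A B x}"
  have fX: "finite ?X" using finite_rep_ge assms by blast
  have "card ?X * k = (\<Sum>x\<in>?X. k)" by simp
  also have "\<dots> \<le> (\<Sum>x\<in>?X. card {b\<in>B. x + b \<in> A})" by (rule sum_mono) (auto simp: rep_def)
  also have "\<dots> = card (SIGMA x:?X. {b\<in>B. x + b \<in> A})" using fX assms by simp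
  also have "\<dots> \<le> card (A \<times> B)"
    by (rule card_inj_on_le[of "\<lambda>(x,b). (x+b,b)"]) (use assms in \<open>auto simp: inj_on_def\<close>)
  finally show ?thesis by (simp add: card_cartesian_product)
qed

text \<open>A gap of length \<open>g\<close> telescopes into \<open>g\<close> consecutive
  differences, and each of them grows with its position. Hence the length and the size of a gap
  determine where it sits.\<close>

lemma convex_gap_less:
  fixes a :: "nat \<Rightarrow> real"
  assumes "strict_mono_on {1..<n} (\<lambda>i. a (i + 1) - a i)"
    and "1 \<le> i" "i < j" "0 < g" "j + g \<le> n"
  shows "a (i + g) - a i < a (j + g) - a j"
  using assms(4,5)
proof (induction g)
  case 0 then show ?case by simp
next
  case (Suc g)
  have s: "a (i + g + 1) - a (i + g) < a (j + g + 1) - a (j + g)"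
    using strict_mono_onD[OF assms(1), of "i + g" "j + g"] assms(2,3) Suc.prems by simp
  show ?case
  proof (cases "g = 0")
    case True then show ?thesis using s by simp
  next
    case False
    then have "a (i + g) - a i < a (j + g) - a j" using Suc by simp
    with s show ?thesis by simp
  qed
qed

text \<open>Both quotients are monotone, so their sum stays constant only if neither moves. This
  allows a box on an increasing chain to be labelled by the sum of its two coordinates.\<close>

lemma div_eq_of_sum_eq:
  fixes i j u v L M :: nat
  assumes "i \<le> j" "u \<le> v" "i div L + u div M = j div L + v div M"
  shows "i div L = j div L" "u div M = v div M"
  using div_le_mono[OF assms(1), of L] div_le_mono[OF assms(2), of M] assms(3) by linarith+

lemma diff_less_of_div_eq:
  fixes i j L :: nat
  assumes "i div L = j div L" "0 < L"
  shows "j - i < L"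
proof -
  have "j < j div L * L + L" using assms(2) by (metis div_mult_mod_eq mod_less_divisor nat_add_left_cancel_less)
  moreover have "j div L * L \<le> i" using assms(1) by (metis div_times_less_eq_dividend)
  ultimately show ?thesis using assms(2) by linarith
qed

text \<open>An elementary substitute for Szemeredi-Trotter. An increasing chain meets few boxes of
  index length \<open>L\<close> and rank length \<open>M\<close>, and every point that is not the
  last of its box has a later neighbour in that box. Such neighbouring pairs, over all
  \<open>x\<close>, inject into \<open>L * card B * M\<close> triples. The truncated subtraction
  makes the claim trivial when \<open>k\<close> does not exceed the number of boxes.\<close>

lemma convex_set_boxes:
  fixes B :: "real set"
  assumes A: "convex_set A" and B: "finite B" and k: "0 < k" and L: "0 < L" "0 < M"
  shows "card {x. k \<le> rep A B x} * (k - (card A div L + card B div M + 1)) \<le> L * card B * M"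
proof -
  obtain n :: nat and a :: "nat \<Rightarrow> real" where A_eq: "A = a ` {1..n}" and sm: "strict_mono_on {1..n} a"
    and cv: "strict_mono_on {1..<n} (\<lambda>i. a (i + 1) - a i)"
    using A unfolding convex_set_def by blast
  have inj: "inj_on a {1..n}" using sm by (rule strict_mono_on_imp_inj_on)
  have cA: "card A = n" unfolding A_eq card_image[OF inj] by simp
  have fA: "finite A" by (simp add: A_eq)
  define idx where "idx = inv_into {1..n} a"
  have idx: "idx y \<in> {1..n}" "a (idx y) = y" if "y \<in> A" for y
    using that unfolding A_eq idx_def by (rule inv_into_into, rule f_inv_into_f)
  have idx_less: "idx y < idx y'" if "y \<in> A" "y' \<in> A" "y < y'" for y y'
  proof (rule ccontr)
    assume "\<not> idx y < idx y'"
    then have "a (idx y') \<le> a (idx y)"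
      using strict_mono_on_leD[OF sm idx(1)[OF that(2)] idx(1)[OF that(1)]] by simp
    then show False using idx that by simp
  qed
  define rk where "rk b = card {b'\<in>B. b' < b}" for b
  have rk_less: "rk b < rk b'" if "b \<in> B" "b' \<in> B" "b < b'" for b b'
    unfolding rk_def by (rule psubset_card_mono) (use that B in auto)
  have rk_le: "rk b \<le> card B" for b unfolding rk_def by (rule card_mono) (use B in auto)
  define X where "X = {x. k \<le> rep A B x}"
  have fX: "finite X" unfolding X_def using finite_rep_ge fA B k by blast
  define S where "S x = {b\<in>B. x + b \<in> A}" for x
  have fS: "finite (S x)" for x unfolding S_def using B by simp
  \<comment> \<open>Along the chain of the \<open>b\<close> with \<open>x + b \<in> A\<close> both coordinates increase, so \<open>\<kappa>\<close> is the number of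
    the box of \<open>(idx (x + b), rk b)\<close>. Two chain points \<open>b < b'\<close> of one box are recovered from \<open>b\<close> and the
    two coordinate gaps: the rank gap gives \<open>b'\<close>, and by convexity the index gap and \<open>b' - b\<close> give \<open>x\<close>.\<close>
  define \<kappa> where "\<kappa> x b = idx (x + b) div L + rk b div M" for x b
  define T where "T x = {b\<in>S x. \<exists>b'\<in>S x. b < b' \<and> \<kappa> x b' = \<kappa> x b}" for x
  define m where "m = card A div L + card B div M"
  have T_card: "k - (m + 1) \<le> card (T x)" if "x \<in> X" for x
  proof -
    have "card (S x - T x) \<le> card {0..m}"
    proof (rule card_inj_on_le[of "\<kappa> x"])
      show "inj_on (\<kappa> x) (S x - T x)"
        by (rule linorder_inj_onI) (auto simp: T_def)
      show "\<kappa> x ` (S x - T x) \<subseteq> {0..m}"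
      proof (rule image_subsetI)
        fix b assume "b \<in> S x - T x"
        then have b: "b \<in> S x" by simp
        have "idx (x + b) \<le> card A" using idx(1)[of "x+b"] b by (auto simp: S_def cA)
        then have "\<kappa> x b \<le> m" unfolding \<kappa>_def m_def by (intro add_mono div_le_mono rk_le)
        then show "\<kappa> x b \<in> {0..m}" by simp
      qed
    qed simp
    moreover have "k \<le> card (S x)" using that unfolding X_def S_def rep_def by simp
    moreover have "card (S x - T x) = card (S x) - card (T x)"
      by (rule card_Diff_subset) (auto simp: T_def fS)
    ultimately show ?thesis by simp
  qed
  define nx where "nx x b = (SOME b'. b' \<in> S x \<and> b < b' \<and> \<kappa> x b' = \<kappa> x b)" for x b
  have nx: "nx x b \<in> S x" "b < nx x b" "\<kappa> x (nx x b) = \<kappa> x b" if "b \<in> T x" for x b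
    using someI_ex[of "\<lambda>b'. b' \<in> S x \<and> b < b' \<and> \<kappa> x b' = \<kappa> x b"] that unfolding T_def nx_def by blast+
  define \<Phi> where "\<Phi> = (\<lambda>(x,b). (idx (x + nx x b) - idx (x + b), b, rk (nx x b) - rk b))"
  have TS: "b \<in> B" "x + b \<in> A" "x + nx x b \<in> A" "nx x b \<in> B" if "b \<in> T x" for x b
    using that nx(1)[OF that] by (auto simp: T_def S_def)
  have less: "idx (x + b) < idx (x + nx x b)" "rk b < rk (nx x b)" if "b \<in> T x" for x b
    using idx_less[OF TS(2,3)[OF that]] rk_less[OF TS(1,4)[OF that]] nx(2)[OF that] by auto
  have gaps: "idx (x + nx x b) - idx (x + b) < L" "rk (nx x b) - rk b < M" if "b \<in> T x" for x b
  proof -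
    have "idx (x + b) div L = idx (x + nx x b) div L" "rk b div M = rk (nx x b) div M"
      using div_eq_of_sum_eq[of "idx (x + b)" "idx (x + nx x b)" "rk b" "rk (nx x b)" L M]
        less[OF that] nx(3)[OF that] unfolding \<kappa>_def by auto
    then show "idx (x + nx x b) - idx (x + b) < L" "rk (nx x b) - rk b < M"
      using diff_less_of_div_eq L by auto
  qed
  have inj\<Phi>: "inj_on \<Phi> (Sigma X T)"
  proof (rule inj_onI, clarify)
    fix x b x' b' assume b: "b \<in> T x" and b': "b' \<in> T x'" and eq: "\<Phi> (x, b) = \<Phi> (x', b')"
    have bb: "b = b'" using eq by (simp add: \<Phi>_def)
    have rkeq: "rk (nx x b) = rk (nx x' b')"
      using eq less(2)[OF b] less(2)[OF b'] unfolding \<Phi>_def bb by auto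
    have nxeq: "nx x b = nx x' b'"
    proof (rule ccontr)
      assume "nx x b \<noteq> nx x' b'"
      then consider "nx x b < nx x' b'" | "nx x' b' < nx x b" by linarith
      then show False using rk_less TS(4)[OF b] TS(4)[OF b'] rkeq by cases fastforce+
    qed
    define i j g where "i = idx (x + b)" and "j = idx (x' + b')" and "g = idx (x + nx x b) - idx (x + b)"
    have g1: "idx (x + nx x b) = i + g" using less[OF b] by (simp add: i_def g_def)
    have "idx (x + nx x b) - idx (x + b) = idx (x' + nx x' b') - idx (x' + b')"
      using eq unfolding \<Phi>_def prod.case prod.inject by (rule conjunct1)
    then have g2: "idx (x' + nx x' b') = j + g" using less(1)[OF b'] unfolding j_def g_def by linarith
    have g0: "0 < g" using less[OF b] by (simp add: g_def)
    have ai: "a i = x + b" "a j = x' + b'" "a (i + g) = x + nx x b" "a (j + g) = x' + nx x' b'"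
      using idx(2)[OF TS(2)[OF b]] idx(2)[OF TS(2)[OF b']] idx(2)[OF TS(3)[OF b]] idx(2)[OF TS(3)[OF b']]
      unfolding g1 g2 i_def[symmetric] j_def[symmetric] by auto
    have rng: "1 \<le> i" "1 \<le> j" "i + g \<le> n" "j + g \<le> n"
      using idx(1)[OF TS(2)[OF b]] idx(1)[OF TS(2)[OF b']] idx(1)[OF TS(3)[OF b]] idx(1)[OF TS(3)[OF b']]
      unfolding g1 g2 i_def[symmetric] j_def[symmetric] by auto
    have "a (i + g) - a i = a (j + g) - a j" using ai nxeq bb by simp
    moreover have "a (i + g) - a i < a (j + g) - a j" if "i < j"
      using convex_gap_less[OF cv rng(1) that g0 rng(4)] .
    moreover have "a (j + g) - a j < a (i + g) - a i" if "j < i"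
      using convex_gap_less[OF cv rng(2) that g0 rng(3)] .
    ultimately have "i = j" by (metis less_irrefl nat_neq_iff)
    then show "x = x' \<and> b = b'" using ai bb by simp
  qed
  have "card X * (k - (m + 1)) = (\<Sum>x\<in>X. k - (m + 1))" by simp
  also have "\<dots> \<le> (\<Sum>x\<in>X. card (T x))" by (rule sum_mono) (use T_card in auto)
  also have "\<dots> = card (Sigma X T)" using fX fS by (subst card_SigmaI) (auto simp: T_def)
  also have "\<dots> \<le> card ({..<L} \<times> B \<times> {..<M})"
    by (rule card_inj_on_le[OF inj\<Phi>]) (use gaps TS B in \<open>auto simp: \<Phi>_def\<close>)
  finally show ?thesis by (simp add: X_def m_def card_cartesian_product)
qed

lemma convex_set_controlled:
  assumes "convex_set A"
  shows "controlled 512 A"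
  unfolding controlled_def
proof (intro allI impI)
  fix B :: "real set" and k :: nat
  assume B: "finite B" and k: "0 < k"
  have fA: "finite A" using assms unfolding convex_set_def by auto
  let ?X = "{x. k \<le> rep A B x}" and ?n = "card A" and ?b = "card B"
  show "real (card ?X) * real k ^ 3 \<le> 512 * real ?n * real ?b ^ 2"
  proof (cases "?X = {}")
    case True then show ?thesis by (simp only: True) simp
  next
    case False
    then obtain x where "k \<le> rep A B x" by auto
    then have kn: "k \<le> ?n" and kb: "k \<le> ?b" using rep_le_left[OF fA, of B x] rep_le_right[OF B, of A x] by auto
    show ?thesis
    proof (cases "k \<le> 8")
      \<comment> \<open>For small \<open>k\<close> the additive 1 in the number of boxes would
        matter; the trivial count is good enough, at the cost of a factor
        \<open>k^2 <= 64\<close>.\<close>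
      case True
      have "real (card ?X) * real k \<le> real ?n * real ?b"
        using card_rep_ge_trivial[OF fA B k] by (metis of_nat_le_iff of_nat_mult)
      moreover have "real k ^ 2 \<le> 64" using power_mono[of "real k" 8 2] True by simp
      ultimately have "(real (card ?X) * real k) * real k ^ 2 \<le> (real ?n * real ?b) * 64"
        by (rule mult_mono) auto
      also have "\<dots> \<le> 512 * real ?n * real ?b ^ 2"
      proof -
        have "1 \<le> ?b" using kb k by linarith
        then have "real ?b * 1 \<le> real ?b * real ?b" by (intro mult_left_mono) auto
        then have "real ?n * (real ?b * 1) \<le> real ?n * (real ?b * real ?b)" by (rule mult_left_mono) auto
        moreover have "0 \<le> real ?n * (real ?b * real ?b)" by simp
        ultimately have "64 * (real ?n * (real ?b * 1)) \<le> 512 * (real ?n * (real ?b * real ?b))" by linarith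
        then show ?thesis by (simp add: power2_eq_square algebra_simps)
      qed
      finally show ?thesis by (simp add: power3_eq_cube power2_eq_square algebra_simps)
    next
      case False
      \<comment> \<open>With these side lengths each coordinate contributes at most
        \<open>k/8\<close> to the number of boxes, so at most \<open>k/4 + 1\<close> points of a
        chain are lost, which is less than half of them as \<open>k > 8\<close>.\<close>
      define L M where "L = 8 * ?n div k + 1" and "M = 8 * ?b div k + 1"
      have up: "real (8 * y div k + 1) \<le> 9 * real y / real k" if "k \<le> y" for y
      proof -
        have "real (8 * y div k) \<le> real (8 * y) / real k" by (rule of_nat_div_le_of_nat)
        moreover have "1 \<le> real y / real k" using that k by simp
        moreover have "9 * real y / real k = real (8 * y) / real k + real y / real k"
          using k by (simp add: field_simps)
        ultimately show ?thesis by simp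
      qed
      have lo: "8 * (y div (8 * y div k + 1)) \<le> k" for y
      proof -
        have "8 * y < (8 * y div k + 1) * k" using k by (simp add: dividend_less_div_times add.commute)
        define q where "q = y div (8 * y div k + 1)"
        have "q * (8 * y div k + 1) \<le> y" unfolding q_def by (rule div_times_less_eq_dividend)
        then have "8 * q * (8 * y div k + 1) \<le> 8 * y" by simp
        also have "\<dots> < k * (8 * y div k + 1)" using \<open>8 * y < _\<close> by (simp add: mult.commute)
        finally have "8 * q < k" by (metis mult_less_cancel2)
        then show ?thesis by (simp add: q_def)
      qed
      have "card ?X * (k - (?n div L + ?b div M + 1)) \<le> L * ?b * M"
        by (rule convex_set_boxes[OF assms B k]) (auto simp: L_def M_def)
      moreover
      have "k \<le> 2 * (k - (?n div L + ?b div M + 1))"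
        using lo[of ?n] lo[of ?b] False unfolding L_def M_def by linarith
      then have "card ?X * k \<le> card ?X * (2 * (k - (?n div L + ?b div M + 1)))" by (rule mult_le_mono2)
      ultimately have "card ?X * k \<le> 2 * (L * ?b * M)" by (simp only: mult.left_commute)
      then have "real (card ?X) * real k \<le> 2 * (real L * real ?b * real M)"
        by (metis of_nat_le_iff of_nat_mult of_nat_numeral)
      also have "\<dots> \<le> 2 * ((9 * real ?n / real k) * real ?b * (9 * real ?b / real k))"
        by (intro mult_left_mono mult_mono) (use up[OF kn] up[OF kb] in \<open>auto simp: L_def M_def simp del: of_nat_add\<close>)
      finally have "(real (card ?X) * real k) * real k ^ 2
          \<le> (2 * ((9 * real ?n / real k) * real ?b * (9 * real ?b / real k))) * real k ^ 2"
        by (rule mult_right_mono) simp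
      also have "\<dots> = 162 * (real ?n * real ?b ^ 2)"
        using k by (simp add: power2_eq_square)
      finally have "real (card ?X) * real k ^ 3 \<le> 162 * real ?n * real ?b ^ 2"
        by (simp add: power3_eq_cube power2_eq_square mult_ac)
      also have "\<dots> \<le> 512 * real ?n * real ?b ^ 2" by (intro mult_right_mono) auto
      finally show ?thesis .
    qed
  qed
qed

section \<open>Moments of the representation function\<close>

definition dif :: "real set \<Rightarrow> real set \<Rightarrow> real set" where
  "dif A B = (\<lambda>(a,b). a - b) ` (A \<times> B)"

lemma finite_dif [simp]: "finite A \<Longrightarrow> finite B \<Longrightarrow> finite (dif A B)"
  by (simp add: dif_def)

lemma dif_memI: "u + b \<in> A \<Longrightarrow> b \<in> B \<Longrightarrow> u \<in> dif A B"
  unfolding dif_def by (force intro: image_eqI[of _ _ "(u+b,b)"])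

lemma rep_pos_in_dif: "0 < rep A B x \<Longrightarrow> x \<in> dif A B"
  using rep_support[of A B] by (auto simp: dif_def)

lemma rep_uminus: "rep A A (- x) = rep A A x"
  unfolding rep_def
  by (rule bij_betw_same_card[of "\<lambda>b. b - x"], rule bij_betw_byWitness[where f' = "\<lambda>b. b + x"])
     (auto simp: algebra_simps)

lemma rep_eq_sum: "finite B \<Longrightarrow> real (rep A B u) = (\<Sum>x\<in>B. of_bool (u + x \<in> A))"
  unfolding rep_def by (simp add: of_bool_def sum.If_cases Int_def)

text \<open>Writes \<open>x - y\<close> as \<open>(u + x) - (u + y)\<close>: the value of
  \<open>rep A A\<close> is the inner product of the indicators of two translates of
  \<open>A\<close>. This is the source of positive definiteness.\<close>

lemma rep_shift:
  assumes "finite U" "{u. u + x \<in> A \<and> u + y \<in> A} \<subseteq> U"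
  shows "real (rep A A (x - y)) = (\<Sum>u\<in>U. of_bool (u + x \<in> A) * of_bool (u + y \<in> A))"
proof -
  have "rep A A (x - y) = card {u\<in>U. u + x \<in> A \<and> u + y \<in> A}"
    unfolding rep_def
    by (rule bij_betw_same_card[of "\<lambda>b. b - y"], rule bij_betw_byWitness[where f' = "\<lambda>u. u + y"])
       (use assms in \<open>auto simp: algebra_simps\<close>)
  moreover have "(\<Sum>u\<in>U. of_bool (u + x \<in> A) * of_bool (u + y \<in> A) :: real)
      = (\<Sum>u\<in>U. of_bool (u + x \<in> A \<and> u + y \<in> A))" by (simp add: of_bool_conj)
  ultimately show ?thesis using assms(1) by (simp add: of_bool_def sum.If_cases Int_def)
qed

text \<open>Both sides count the triples \<open>(x, y, u)\<close> with \<open>u + x\<close> and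
  \<open>u + y\<close> in \<open>A\<close>. It trades \<open>rep A A\<close> on differences of
  \<open>X\<close> and \<open>Y\<close> for representation functions of \<open>A\<close> against
  \<open>X\<close> and \<open>Y\<close>, whose energies the control bounds.\<close>

lemma sum_rep_rep:
  assumes "finite A" "finite X" "finite Y"
  shows "(\<Sum>x\<in>X. \<Sum>y\<in>Y. real (rep A A (x - y))) = (\<Sum>u\<in>dif A X. real (rep A X u) * real (rep A Y u))"
proof -
  have "(\<Sum>x\<in>X. \<Sum>y\<in>Y. real (rep A A (x - y)))
      = (\<Sum>x\<in>X. \<Sum>y\<in>Y. \<Sum>u\<in>dif A X. of_bool (u + x \<in> A) * of_bool (u + y \<in> A))"
    by (intro sum.cong refl rep_shift) (use assms dif_memI in auto)
  also have "\<dots> = (\<Sum>x\<in>X. \<Sum>u\<in>dif A X. \<Sum>y\<in>Y. of_bool (u + x \<in> A) * of_bool (u + y \<in> A))"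
    by (intro sum.cong refl sum.swap)
  also have "\<dots> = (\<Sum>u\<in>dif A X. \<Sum>x\<in>X. \<Sum>y\<in>Y. of_bool (u + x \<in> A) * of_bool (u + y \<in> A))"
    by (rule sum.swap)
  also have "\<dots> = (\<Sum>u\<in>dif A X. real (rep A X u) * real (rep A Y u))"
    using assms by (simp only: rep_eq_sum sum_product)
  finally show ?thesis .
qed

lemma sum_group_dif:
  fixes g :: "real \<Rightarrow> real"
  assumes "finite A"
  shows "(\<Sum>a\<in>A. \<Sum>b\<in>A. g (a - b)) = (\<Sum>w\<in>dif A A. real (rep A A w) * g w)"
proof -
  have "(\<Sum>a\<in>A. \<Sum>b\<in>A. g (a - b)) = (\<Sum>a\<in>A. \<Sum>b\<in>A. \<Sum>w\<in>dif A A. of_bool (w + b = a) * g w)"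
  proof (intro sum.cong refl)
    fix a b assume "a \<in> A" "b \<in> A"
    then have "a - b \<in> dif A A" by (intro dif_memI[of _ b]) auto
    have "(\<Sum>w\<in>dif A A. of_bool (w + b = a) * g w) = (\<Sum>w\<in>dif A A. if w = a - b then g w else 0)"
      by (intro sum.cong) auto
    also have "\<dots> = g (a - b)" using assms \<open>a - b \<in> dif A A\<close> by simp
    finally show "g (a - b) = (\<Sum>w\<in>dif A A. of_bool (w + b = a) * g w)" by simp
  qed
  also have "\<dots> = (\<Sum>b\<in>A. \<Sum>a\<in>A. \<Sum>w\<in>dif A A. of_bool (w + b = a) * g w)" by (rule sum.swap)
  also have "\<dots> = (\<Sum>b\<in>A. \<Sum>w\<in>dif A A. \<Sum>a\<in>A. of_bool (w + b = a) * g w)"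
    by (intro sum.cong refl sum.swap)
  also have "\<dots> = (\<Sum>b\<in>A. \<Sum>w\<in>dif A A. of_bool (w + b \<in> A) * g w)"
    using assms by (intro sum.cong refl) (simp add: of_bool_def flip: sum_distrib_right)
  also have "\<dots> = (\<Sum>w\<in>dif A A. \<Sum>b\<in>A. of_bool (w + b \<in> A) * g w)" by (rule sum.swap)
  also have "\<dots> = (\<Sum>w\<in>dif A A. real (rep A A w) * g w)"
    using assms by (simp only: rep_eq_sum sum_distrib_right)
  finally show ?thesis .
qed

section \<open>Moments from layer sizes\<close>

lemma layer_sum:
  fixes g :: "nat \<Rightarrow> real" and r :: "'a \<Rightarrow> nat"
  assumes "finite X" "\<And>x. x \<in> X \<Longrightarrow> r x \<le> M"
  shows "(\<Sum>x\<in>X. \<Sum>k=1..r x. g k) = (\<Sum>k=1..M. g k * real (card {x\<in>X. k \<le> r x}))"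
proof -
  have "(\<Sum>x\<in>X. \<Sum>k=1..r x. g k) = (\<Sum>x\<in>X. \<Sum>k=1..M. if k \<le> r x then g k else 0)"
  proof (rule sum.cong[OF refl])
    fix x assume "x \<in> X"
    then have "{1..M} \<inter> {k. k \<le> r x} = {1..r x}" using assms(2) by force
    then show "(\<Sum>k=1..r x. g k) = (\<Sum>k=1..M. if k \<le> r x then g k else 0)"
      by (simp add: sum.If_cases)
  qed
  also have "\<dots> = (\<Sum>k=1..M. \<Sum>x\<in>X. if k \<le> r x then g k else 0)" by (rule sum.swap)
  also have "\<dots> = (\<Sum>k=1..M. g k * real (card {x\<in>X. k \<le> r x}))"
    using assms(1) by (intro sum.cong refl) (simp add: sum.If_cases Int_def mult.commute)
  finally show ?thesis .
qed

lemma square_le_layers: "real m ^ 2 \<le> (\<Sum>k=1..m. 2 * real k)"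
  by (induction m) (auto simp: power2_eq_square algebra_simps)

lemma cube_le_layers: "real m ^ 3 \<le> (\<Sum>k=1..m. 3 * real k ^ 2)"
  by (induction m) (auto simp: power3_eq_cube power2_eq_square algebra_simps)

text \<open>If the weighted layers decay like \<open>c / k\<close>, summing over the levels costs
  only a logarithm. All harmonic factors of the moment bounds arise here.\<close>

lemma layers_le_harm:
  fixes r :: "'a \<Rightarrow> nat"
  assumes "finite X" "\<And>x. x \<in> X \<Longrightarrow> r x \<le> M"
    and "\<And>k. 0 < k \<Longrightarrow> g k * real (card {x\<in>X. k \<le> r x}) \<le> c / real k"
  shows "(\<Sum>x\<in>X. \<Sum>k=1..r x. g k) \<le> c * harm M"
proof -
  have "(\<Sum>x\<in>X. \<Sum>k=1..r x. g k) = (\<Sum>k=1..M. g k * real (card {x\<in>X. k \<le> r x}))"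
    by (rule layer_sum[OF assms(1,2)])
  also have "\<dots> \<le> (\<Sum>k=1..M. c / real k)" by (rule sum_mono) (use assms(3) in auto)
  also have "\<dots> = c * harm M" by (simp add: harm_def sum_distrib_left divide_inverse)
  finally show ?thesis .
qed

lemma controlledD:
  assumes "controlled C A" "finite A" "finite B" "0 < k" "X \<subseteq> {x. k \<le> rep A B x}"
  shows "real (card X) * real k ^ 3 \<le> C * real (card A) * real (card B) ^ 2"
    "real (card X) * real k \<le> real (card A) * real (card B)"
proof -
  have c: "card X \<le> card {x. k \<le> rep A B x}" by (rule card_mono[OF finite_rep_ge]) (use assms in auto)
  then have "real (card X) * real k ^ 3 \<le> real (card {x. k \<le> rep A B x}) * real k ^ 3"
    by (intro mult_right_mono) auto
  also have "\<dots> \<le> C * real (card A) * real (card B) ^ 2" using assms unfolding controlled_def by blast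
  finally show "real (card X) * real k ^ 3 \<le> C * real (card A) * real (card B) ^ 2" .
  have "card X * k \<le> card A * card B"
    using card_rep_ge_trivial[OF assms(2,3,4)] c by (meson dual_order.trans mult_le_mono1)
  then show "real (card X) * real k \<le> real (card A) * real (card B)" by (metis of_nat_le_iff of_nat_mult)
qed

text \<open>The geometric mean of the cubic bound and the trivial bound for a layer decays like
  \<open>k^(-2)\<close>, exactly the rate at which a second moment costs only a logarithm.\<close>

lemma energy_le:
  assumes "controlled C A" "0 \<le> C" "finite A" "finite B" "finite U"
  shows "(\<Sum>u\<in>U. real (rep A B u) ^ 2)
    \<le> 2 * sqrt (C * real (card A) ^ 2 * real (card B) ^ 3) * harm (card A)"
proof -
  have "(\<Sum>u\<in>U. real (rep A B u) ^ 2) \<le> (\<Sum>u\<in>U. \<Sum>k=1..rep A B u. 2 * real k)"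
    by (intro sum_mono square_le_layers)
  also have "\<dots> \<le> 2 * sqrt (C * real (card A) ^ 2 * real (card B) ^ 3) * harm (card A)"
  proof (rule layers_le_harm)
    fix k :: nat assume k: "0 < k"
    define c where "c = real (card {u \<in> U. k \<le> rep A B u})"
    have c: "c * real k ^ 3 \<le> C * real (card A) * real (card B) ^ 2" "c * real k \<le> real (card A) * real (card B)"
      unfolding c_def by (rule controlledD[OF assms(1,3,4) k], force)+
    have "0 \<le> c" by (simp add: c_def)
    have "(c * real k ^ 3) * (c * real k) \<le> (C * real (card A) * real (card B) ^ 2) * (real (card A) * real (card B))"
      by (rule mult_mono) (use c assms(2) \<open>0 \<le> c\<close> in auto)
    then have "(c * real k ^ 2) ^ 2 \<le> C * real (card A) ^ 2 * real (card B) ^ 3"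
      by (simp add: power2_eq_square power3_eq_cube algebra_simps)
    then have "c * real k ^ 2 \<le> sqrt (C * real (card A) ^ 2 * real (card B) ^ 3)"
      by (rule real_le_rsqrt)
    then show "2 * real k * c \<le> 2 * sqrt (C * real (card A) ^ 2 * real (card B) ^ 3) / real k"
      using k by (simp add: field_simps power2_eq_square)
  qed (use assms rep_le_left in auto)
  finally show ?thesis .
qed

lemma third_moment_le:
  assumes "controlled C A" "finite A"
  shows "(\<Sum>u\<in>dif A A. real (rep A A u) ^ 3) \<le> 3 * C * real (card A) ^ 3 * harm (card A)"
proof -
  have "(\<Sum>u\<in>dif A A. real (rep A A u) ^ 3) \<le> (\<Sum>u\<in>dif A A. \<Sum>k=1..rep A A u. 3 * real k ^ 2)"
    by (intro sum_mono cube_le_layers)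
  also have "\<dots> \<le> (3 * C * real (card A) ^ 3) * harm (card A)"
  proof (rule layers_le_harm)
    fix k :: nat assume k: "0 < k"
    have "real (card {u \<in> dif A A. k \<le> rep A A u}) * real k ^ 3 \<le> C * real (card A) * real (card A) ^ 2"
      by (rule controlledD[OF assms(1,2,2) k]) force
    then show "3 * real k ^ 2 * real (card {x \<in> dif A A. k \<le> rep A A x}) \<le> 3 * C * real (card A) ^ 3 / real k"
      using k by (simp add: field_simps power2_eq_square power3_eq_cube)
  qed (use assms rep_le_left in auto)
  finally show ?thesis .
qed

text \<open>A layer of size \<open>c\<close> satisfies both the cubic bound and
  \<open>c <= card X\<close>; one factor of the first and two of the second give a bound for
  \<open>(c k)^3\<close>, the rate suited to a first moment.\<close>

lemma sum_rep_on_le: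
  assumes "controlled C A" "0 \<le> C" "finite A" "finite B" "finite X"
  shows "(\<Sum>x\<in>X. real (rep A B x)) \<le> root 3 (C * real (card A) * real (card B) ^ 2 * real (card X) ^ 2) * harm (card A)"
proof -
  have "(\<Sum>x\<in>X. real (rep A B x)) = (\<Sum>x\<in>X. \<Sum>k=1..rep A B x. 1)" by simp
  also have "\<dots> \<le> root 3 (C * real (card A) * real (card B) ^ 2 * real (card X) ^ 2) * harm (card A)"
  proof (rule layers_le_harm)
    fix k :: nat assume k: "0 < k"
    define c where "c = real (card {x \<in> X. k \<le> rep A B x})"
    have c: "c * real k ^ 3 \<le> C * real (card A) * real (card B) ^ 2"
      unfolding c_def by (rule controlledD[OF assms(1,3,4) k]) force
    have cX: "0 \<le> c" "c \<le> real (card X)" unfolding c_def using assms(5) by (auto intro: card_mono)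
    have "(c * real k ^ 3) * c ^ 2 \<le> (C * real (card A) * real (card B) ^ 2) * real (card X) ^ 2"
      by (rule mult_mono) (use c cX assms(2) in \<open>auto intro: power_mono\<close>)
    then have "(c * real k) ^ 3 \<le> C * real (card A) * real (card B) ^ 2 * real (card X) ^ 2"
      by (simp add: power2_eq_square power3_eq_cube algebra_simps)
    then have "root 3 ((c * real k) ^ 3) \<le> root 3 (C * real (card A) * real (card B) ^ 2 * real (card X) ^ 2)"
      by simp
    then have "c * real k \<le> root 3 (C * real (card A) * real (card B) ^ 2 * real (card X) ^ 2)"
      using cX by (simp add: real_root_power_cancel)
    then show "1 * c \<le> root 3 (C * real (card A) * real (card B) ^ 2 * real (card X) ^ 2) / real k"
      using k by (simp add: field_simps)
  qed (use assms rep_le_left in auto)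
  finally show ?thesis .
qed

section \<open>Popular differences\<close>

definition popular :: "nat \<Rightarrow> real set \<Rightarrow> real set" where
  "popular s A = {z. s \<le> rep A A z}"

definition popular_pairs :: "nat \<Rightarrow> real set \<Rightarrow> nat" where
  "popular_pairs s A = card {(a,b). a \<in> A \<and> b \<in> A \<and> a - b \<in> popular s A}"

definition cherries :: "nat \<Rightarrow> real set \<Rightarrow> real" where
  "cherries s A = (\<Sum>b\<in>A. \<Sum>a\<in>A. \<Sum>c\<in>A.
     of_bool (a - b \<in> popular s A) * of_bool (c - b \<in> popular s A) * real (rep A A (a - c)))"

lemma popular_uminus: "- z \<in> popular s A \<longleftrightarrow> z \<in> popular s A"
  by (simp add: popular_def rep_uminus)

lemma popular_minus_commute: "a - b \<in> popular s A \<longleftrightarrow> b - a \<in> popular s A"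
  using popular_uminus[of "a - b" s A] by simp

lemma finite_popular: "finite A \<Longrightarrow> 0 < s \<Longrightarrow> finite (popular s A)"
  unfolding popular_def by (rule finite_rep_ge)

lemma popular_subset_dif: "0 < s \<Longrightarrow> popular s A \<subseteq> dif A A"
  using rep_pos_in_dif by (force simp: popular_def)

lemma popular_pairs_eq_sum:
  assumes "finite A"
  shows "real (popular_pairs s A) = (\<Sum>a\<in>A. \<Sum>b\<in>A. of_bool (a - b \<in> popular s A))"
proof -
  have "{(a,b). a \<in> A \<and> b \<in> A \<and> a - b \<in> popular s A} = (SIGMA a:A. {b\<in>A. a - b \<in> popular s A})" by auto
  then have "popular_pairs s A = (\<Sum>a\<in>A. card {b\<in>A. a - b \<in> popular s A})"
    unfolding popular_pairs_def using assms by simp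
  then show ?thesis using assms by (simp add: of_bool_def sum.If_cases Int_def)
qed

lemma popular_pairs_eq_sum_rep:
  assumes "finite A" "0 < s"
  shows "real (popular_pairs s A) = (\<Sum>z\<in>popular s A. real (rep A A z))"
proof -
  have "real (popular_pairs s A) = (\<Sum>w\<in>dif A A. real (rep A A w) * of_bool (w \<in> popular s A))"
    using popular_pairs_eq_sum[OF assms(1)] sum_group_dif[OF assms(1), of "\<lambda>w. of_bool (w \<in> popular s A)"] by simp
  also have "\<dots> = (\<Sum>w\<in>popular s A. real (rep A A w) * of_bool (w \<in> popular s A))"
    by (rule sum.mono_neutral_right) (use assms popular_subset_dif in auto)
  finally show ?thesis by simp
qed

lemma card_popular_le:
  assumes "finite A" "0 < s"
  shows "real s * real (card (popular s A)) \<le> real (popular_pairs s A)"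
proof -
  have "real s * real (card (popular s A)) = (\<Sum>z\<in>popular s A. real s)" by simp
  also have "\<dots> \<le> (\<Sum>z\<in>popular s A. real (rep A A z))" by (rule sum_mono) (simp add: popular_def)
  finally show ?thesis using popular_pairs_eq_sum_rep[OF assms] by simp
qed

text \<open>For each midpoint the weight of the paths is a sum of squares, because
  \<open>rep A A\<close> is positive definite. Cauchy-Schwarz over the midpoints therefore bounds
  \<open>card A * cherries s A\<close> below by the quadratic form of \<open>rep A A\<close> at the
  degree vector. On joined pairs this form has coefficients at least \<open>s\<close>, and enough
  joined pairs have both degrees comparable to the average.\<close>

lemma cherries_ge:
  assumes "finite A" and s: "0 < s"
  shows "real s * real (popular_pairs s A) ^ 3 \<le> 32 * real (card A) ^ 3 * cherries s A"
proof -
  define n where "n = real (card A)"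
  define N where "N = real (popular_pairs s A)"
  define E where "E a b = (of_bool (a - b \<in> popular s A) :: real)" for a b
  define dg where "dg a = (\<Sum>b\<in>A. E a b)" for a
  define h where "h b u = (\<Sum>a\<in>A. E a b * of_bool (u + a \<in> A))" for b u
  define U where "U = dif A A"
  have E_comm: "E a b = E b a" for a b by (simp add: E_def popular_minus_commute)
  have E01: "0 \<le> E a b" "E a b \<le> 1" for a b by (auto simp: E_def)
  have N_eq: "N = (\<Sum>a\<in>A. dg a)"
    unfolding N_def popular_pairs_eq_sum[OF assms(1)] dg_def E_def ..
  have dg0: "0 \<le> dg a" for a unfolding dg_def by (intro sum_nonneg E01)
  have fU: "finite U" by (simp add: U_def assms)
  have shift: "real (rep A A (x - y)) = (\<Sum>u\<in>U. of_bool (u + x \<in> A) * of_bool (u + y \<in> A))" if "y \<in> A" for x y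
    by (rule rep_shift[OF fU]) (use that dif_memI in \<open>auto simp: U_def\<close>)
  \<comment> \<open>positive definiteness of \<open>rep A A\<close>\<close>
  have quad: "(\<Sum>a\<in>A. \<Sum>c\<in>A. g a * g c * real (rep A A (a - c))) = (\<Sum>u\<in>U. (\<Sum>a\<in>A. g a * of_bool (u + a \<in> A)) ^ 2)"
    for g :: "real \<Rightarrow> real"
  proof -
    have "(\<Sum>a\<in>A. \<Sum>c\<in>A. g a * g c * real (rep A A (a - c)))
      = (\<Sum>a\<in>A. \<Sum>c\<in>A. \<Sum>u\<in>U. (g a * of_bool (u + a \<in> A)) * (g c * of_bool (u + c \<in> A)))"
      by (intro sum.cong refl) (simp add: shift sum_distrib_left mult_ac)
    also have "\<dots> = (\<Sum>a\<in>A. \<Sum>u\<in>U. \<Sum>c\<in>A. (g a * of_bool (u + a \<in> A)) * (g c * of_bool (u + c \<in> A)))"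
      by (intro sum.cong refl sum.swap)
    also have "\<dots> = (\<Sum>u\<in>U. \<Sum>a\<in>A. \<Sum>c\<in>A. (g a * of_bool (u + a \<in> A)) * (g c * of_bool (u + c \<in> A)))"
      by (rule sum.swap)
    also have "\<dots> = (\<Sum>u\<in>U. (\<Sum>a\<in>A. g a * of_bool (u + a \<in> A)) ^ 2)"
      by (simp add: power2_eq_square sum_product)
    finally show ?thesis .
  qed
  have cherries_eq: "cherries s A = (\<Sum>b\<in>A. \<Sum>u\<in>U. (h b u) ^ 2)"
    unfolding cherries_def h_def
  proof (rule sum.cong[OF refl])
    fix b
    show "(\<Sum>a\<in>A. \<Sum>c\<in>A. of_bool (a - b \<in> popular s A) * of_bool (c - b \<in> popular s A) * real (rep A A (a - c)))
        = (\<Sum>u\<in>U. (\<Sum>a\<in>A. E a b * of_bool (u + a \<in> A))\<^sup>2)"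
      using quad[of "\<lambda>a. E a b"] unfolding E_def .
  qed
  have "(\<Sum>a\<in>A. \<Sum>c\<in>A. dg a * dg c * real (rep A A (a - c))) = (\<Sum>u\<in>U. (\<Sum>b\<in>A. h b u) ^ 2)"
  proof -
    have "(\<Sum>a\<in>A. dg a * of_bool (u + a \<in> A)) = (\<Sum>b\<in>A. h b u)" for u
      unfolding dg_def h_def sum_distrib_right by (rule sum.swap)
    then show ?thesis using quad[of dg] by simp
  qed
  also have "\<dots> \<le> (\<Sum>u\<in>U. n * (\<Sum>b\<in>A. (h b u) ^ 2))"
    unfolding n_def using sum_squared_le_sum_of_squares[of "\<lambda>b. h b _" A] by (intro sum_mono) (simp add: mult.commute)
  also have "\<dots> = n * cherries s A"
    unfolding cherries_eq sum_distrib_left by (rule sum.swap)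
  finally have up: "(\<Sum>a\<in>A. \<Sum>c\<in>A. dg a * dg c * real (rep A A (a - c))) \<le> n * cherries s A" .
  define t where "t = N / (4 * n)"
  have low: "s * (t ^ 2 * (N / 2)) \<le> (\<Sum>a\<in>A. \<Sum>c\<in>A. dg a * dg c * real (rep A A (a - c)))"
  proof -
    \<comment> \<open>Vertices of degree below a quarter of the average carry at most half of the edges.\<close>
    define v where "v a = (of_bool (dg a < t) :: real)" for a
    have t0: "0 \<le> t" by (simp add: t_def N_def n_def)
    have vd: "v a * dg a \<le> t" for a using dg0 t0 by (simp add: v_def)
    have "(\<Sum>a\<in>A. v a * dg a) \<le> N / 4"
    proof (cases "n = 0")
      case True then show ?thesis using assms by (simp add: n_def N_eq)
    next
      case False
      have "(\<Sum>a\<in>A. v a * dg a) \<le> (\<Sum>a\<in>A. t)" by (intro sum_mono vd)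
      also have "\<dots> = N / 4" using False by (simp add: t_def n_def)
      finally show ?thesis .
    qed
    moreover have "(\<Sum>a\<in>A. \<Sum>c\<in>A. E a c * v a) = (\<Sum>a\<in>A. v a * dg a)"
      unfolding dg_def by (simp add: sum_distrib_left mult_ac)
    moreover have "(\<Sum>a\<in>A. \<Sum>c\<in>A. E a c * v c) = (\<Sum>a\<in>A. v a * dg a)"
      unfolding dg_def by (subst sum.swap) (simp add: sum_distrib_left mult_ac E_comm)
    moreover have "(\<Sum>a\<in>A. \<Sum>c\<in>A. E a c) = N" by (simp add: N_eq dg_def)
    moreover have "(\<Sum>a\<in>A. \<Sum>c\<in>A. E a c * (1 - v a - v c))
        = (\<Sum>a\<in>A. \<Sum>c\<in>A. E a c) - (\<Sum>a\<in>A. \<Sum>c\<in>A. E a c * v a) - (\<Sum>a\<in>A. \<Sum>c\<in>A. E a c * v c)"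
      by (simp add: right_diff_distrib sum_subtractf)
    ultimately have sum_low: "N / 2 \<le> (\<Sum>a\<in>A. \<Sum>c\<in>A. E a c * (1 - v a - v c))" by linarith
    \<comment> \<open>The factor \<open>1 - v a - v c\<close> is 1 if both degrees are at least
      \<open>t\<close> and otherwise at most 0. It is thus a minorant of the indicator of the good
      pairs that is linear in \<open>v\<close>, so its sum over the joined pairs splits.\<close>
    have pt: "s * (t ^ 2 * (E a c * (1 - v a - v c))) \<le> dg a * dg c * real (rep A A (a - c))" for a c
    proof (cases "a - c \<in> popular s A")
      case False then show ?thesis using dg0 by (simp add: E_def)
    next
      case True
      have "t ^ 2 * (1 - v a - v c) \<le> dg a * dg c"
      proof (cases "t \<le> dg a \<and> t \<le> dg c")
        case True
        then have "t * t \<le> dg a * dg c" using t0 by (intro mult_mono dg0) auto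
        then show ?thesis using True by (simp add: v_def power2_eq_square)
      next
        case False
        then have "1 - v a - v c \<le> 0" by (auto simp: v_def)
        then have "t ^ 2 * (1 - v a - v c) \<le> 0" by (intro mult_nonneg_nonpos) simp_all
        also have "0 \<le> dg a * dg c" by (intro mult_nonneg_nonneg dg0)
        finally show ?thesis .
      qed
      then have "real s * (t ^ 2 * (1 - v a - v c)) \<le> real s * (dg a * dg c)"
        by (rule mult_left_mono) simp
      also have "\<dots> \<le> real (rep A A (a - c)) * (dg a * dg c)"
        using True by (intro mult_right_mono mult_nonneg_nonneg dg0) (simp add: popular_def)
      finally have "real s * (t ^ 2 * (1 - v a - v c)) \<le> real (rep A A (a - c)) * (dg a * dg c)" .
      then show ?thesis using True by (simp add: E_def mult.commute)
    qed
    have "real s * (t ^ 2 * (N / 2)) \<le> s * (t ^ 2 * (\<Sum>a\<in>A. \<Sum>c\<in>A. E a c * (1 - v a - v c)))"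
      by (intro mult_left_mono sum_low) auto
    also have "\<dots> = (\<Sum>a\<in>A. \<Sum>c\<in>A. s * (t ^ 2 * (E a c * (1 - v a - v c))))"
      by (simp add: sum_distrib_left)
    also have "\<dots> \<le> (\<Sum>a\<in>A. \<Sum>c\<in>A. dg a * dg c * real (rep A A (a - c)))"
      by (intro sum_mono pt)
    finally show ?thesis .
  qed
  have "s * (t ^ 2 * (N / 2)) \<le> n * cherries s A" using low up by linarith
  then show ?thesis
  proof (cases "n = 0")
    case True
    then have "A = {}" using assms by (simp add: n_def)
    then have "N = 0" by (simp add: N_eq)
    then show ?thesis using True by (simp add: N_def n_def)
  next
    case False
    then have "0 < n" by (simp add: n_def)
    then have N4: "N = 4 * n * t" by (simp add: t_def)
    have "real s * N ^ 3 = 32 * n ^ 2 * (s * (t ^ 2 * (N / 2)))"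
      unfolding N4 by (simp add: power2_eq_square power3_eq_cube)
    also have "\<dots> \<le> 32 * n ^ 2 * (n * cherries s A)"
      by (intro mult_left_mono \<open>s * (t ^ 2 * (N / 2)) \<le> n * cherries s A\<close>) simp
    also have "\<dots> = 32 * n ^ 3 * cherries s A" by (simp add: power2_eq_square power3_eq_cube)
    finally show ?thesis by (simp add: n_def N_def)
  qed
qed

text \<open>Substituting \<open>x = a - b\<close> and \<open>y = c - b\<close> turns the weight into
  \<open>rep A A (x - y)\<close>, multiplied by the number \<open>C x y\<close> of midpoints
  \<open>b\<close> compatible with both popular differences. Cauchy-Schwarz separates the two
  factors.\<close>

lemma cherries_square_le:
  assumes "finite A" and s: "0 < s"
  shows "cherries s A ^ 2 \<le> (\<Sum>w\<in>dif A A. real (rep A A w) ^ 3)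
     * (\<Sum>(x,y)\<in>popular s A \<times> popular s A. real (rep A A (x - y)) ^ 2)"
proof -
  define P where "P = popular s A"
  have fP: "finite P" unfolding P_def by (rule finite_popular[OF assms])
  define C where "C x y = (\<Sum>b\<in>A. of_bool (b + x \<in> A) * of_bool (b + y \<in> A) :: real)" for x y
  have reindex: "(\<Sum>a\<in>A. of_bool (a - b \<in> P) * g a) = (\<Sum>x\<in>P. of_bool (b + x \<in> A) * g (b + x))"
    for b and g :: "real \<Rightarrow> real"
  proof -
    have "(\<Sum>a\<in>A. of_bool (a - b \<in> P) * g a) = sum g {a\<in>A. a - b \<in> P}"
      using assms(1) by (simp add: of_bool_def if_distrib[of "\<lambda>x. x * _"] sum.If_cases Int_def)
    also have "\<dots> = sum (\<lambda>x. g (b + x)) {x\<in>P. b + x \<in> A}"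
      by (rule sum.reindex_bij_witness[of _ "\<lambda>x. b + x" "\<lambda>a. a - b"]) auto
    also have "\<dots> = (\<Sum>x\<in>P. of_bool (b + x \<in> A) * g (b + x))"
      using fP by (simp add: of_bool_def if_distrib[of "\<lambda>x. x * _"] sum.If_cases Int_def)
    finally show ?thesis .
  qed
  have "cherries s A = (\<Sum>b\<in>A. \<Sum>a\<in>A. of_bool (a - b \<in> P) * (\<Sum>c\<in>A. of_bool (c - b \<in> P) * real (rep A A (a - c))))"
    unfolding cherries_def P_def by (simp add: sum_distrib_left mult_ac)
  also have "\<dots> = (\<Sum>b\<in>A. \<Sum>x\<in>P. \<Sum>y\<in>P. of_bool (b + x \<in> A) * of_bool (b + y \<in> A) * real (rep A A (x - y)))"
  proof (rule sum.cong[OF refl])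
    fix b
    have "(\<Sum>a\<in>A. of_bool (a - b \<in> P) * (\<Sum>c\<in>A. of_bool (c - b \<in> P) * real (rep A A (a - c))))
      = (\<Sum>x\<in>P. of_bool (b + x \<in> A) * (\<Sum>c\<in>A. of_bool (c - b \<in> P) * real (rep A A (b + x - c))))"
      by (rule reindex)
    also have "\<dots> = (\<Sum>x\<in>P. of_bool (b + x \<in> A) * (\<Sum>y\<in>P. of_bool (b + y \<in> A) * real (rep A A (b + x - (b + y)))))"
      by (intro sum.cong refl arg_cong[of _ _ "(*) _"] reindex)
    finally show "(\<Sum>a\<in>A. of_bool (a - b \<in> P) * (\<Sum>c\<in>A. of_bool (c - b \<in> P) * real (rep A A (a - c))))
      = (\<Sum>x\<in>P. \<Sum>y\<in>P. of_bool (b + x \<in> A) * of_bool (b + y \<in> A) * real (rep A A (x - y)))"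
      by (simp add: sum_distrib_left mult.assoc)
  qed
  also have "\<dots> = (\<Sum>x\<in>P. \<Sum>b\<in>A. \<Sum>y\<in>P. of_bool (b + x \<in> A) * of_bool (b + y \<in> A) * real (rep A A (x - y)))"
    by (rule sum.swap)
  also have "\<dots> = (\<Sum>x\<in>P. \<Sum>y\<in>P. \<Sum>b\<in>A. of_bool (b + x \<in> A) * of_bool (b + y \<in> A) * real (rep A A (x - y)))"
    by (intro sum.cong refl sum.swap)
  also have "\<dots> = (\<Sum>(x,y)\<in>P\<times>P. C x y * real (rep A A (x - y)))"
    by (simp only: C_def sum_distrib_right sum.cartesian_product[symmetric])
  finally have "cherries s A ^ 2 = (\<Sum>i\<in>P\<times>P. (case i of (x,y) \<Rightarrow> C x y) * (case i of (x,y) \<Rightarrow> real (rep A A (x - y)))) ^ 2"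
    by (simp add: case_prod_unfold)
  also have "\<dots> \<le> (\<Sum>i\<in>P\<times>P. (case i of (x,y) \<Rightarrow> C x y) ^ 2) * (\<Sum>i\<in>P\<times>P. (case i of (x,y) \<Rightarrow> real (rep A A (x - y))) ^ 2)"
    by (rule Cauchy_Schwarz_ineq_sum)
  also have "\<dots> \<le> (\<Sum>w\<in>dif A A. real (rep A A w) ^ 3) * (\<Sum>i\<in>P\<times>P. (case i of (x,y) \<Rightarrow> real (rep A A (x - y))) ^ 2)"
  proof (rule mult_right_mono)
    \<comment> \<open>The sum of \<open>C x y ^ 2\<close> counts \<open>(x, y, b, b')\<close> with
      all four sums in \<open>A\<close>. Grouped by \<open>(b, b')\<close> it becomes the sum of
      \<open>D b b' ^ 2\<close>, and dropping the restriction to popular \<open>x\<close> leaves a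
      third moment.\<close>
    define D where "D b b' = (\<Sum>x\<in>P. of_bool (b + x \<in> A) * of_bool (b' + x \<in> A) :: real)" for b b'
    have D: "0 \<le> D b b'" "D b b' \<le> real (rep A A (b - b'))" if "b \<in> A" "b' \<in> A" for b b'
    proof -
      show "0 \<le> D b b'" unfolding D_def by (intro sum_nonneg) auto
      have "D b b' \<le> (\<Sum>u\<in>dif A A \<union> P. of_bool (u + b \<in> A) * of_bool (u + b' \<in> A))"
        unfolding D_def by (subst (1 2) add.commute, rule sum_mono2) (use fP assms in auto)
      also have "\<dots> = real (rep A A (b - b'))"
        by (rule rep_shift[symmetric]) (use fP assms that dif_memI in auto)
      finally show "D b b' \<le> real (rep A A (b - b'))" .
    qed
    have "(\<Sum>i\<in>P\<times>P. (case i of (x,y) \<Rightarrow> C x y) ^ 2) = (\<Sum>x\<in>P. \<Sum>y\<in>P. C x y ^ 2)"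
      by (simp add: sum.cartesian_product case_prod_unfold)
    also have "\<dots> = (\<Sum>x\<in>P. \<Sum>y\<in>P. \<Sum>b\<in>A. \<Sum>b'\<in>A.
        (of_bool (b + x \<in> A) * of_bool (b' + x \<in> A)) * (of_bool (b + y \<in> A) * of_bool (b' + y \<in> A)))"
      unfolding C_def power2_eq_square sum_product by (intro sum.cong refl) (simp only: mult_ac)
    also have "\<dots> = (\<Sum>x\<in>P. \<Sum>b\<in>A. \<Sum>y\<in>P. \<Sum>b'\<in>A.
        (of_bool (b + x \<in> A) * of_bool (b' + x \<in> A)) * (of_bool (b + y \<in> A) * of_bool (b' + y \<in> A)))"
      by (rule sum.cong[OF refl], rule sum.swap)
    also have "\<dots> = (\<Sum>x\<in>P. \<Sum>b\<in>A. \<Sum>b'\<in>A. \<Sum>y\<in>P.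
        (of_bool (b + x \<in> A) * of_bool (b' + x \<in> A)) * (of_bool (b + y \<in> A) * of_bool (b' + y \<in> A)))"
      by (rule sum.cong[OF refl], rule sum.cong[OF refl], rule sum.swap)
    also have "\<dots> = (\<Sum>x\<in>P. \<Sum>b\<in>A. \<Sum>b'\<in>A. of_bool (b + x \<in> A) * of_bool (b' + x \<in> A) * D b b')"
      by (simp add: D_def sum_distrib_left)
    also have "\<dots> = (\<Sum>b\<in>A. \<Sum>x\<in>P. \<Sum>b'\<in>A. of_bool (b + x \<in> A) * of_bool (b' + x \<in> A) * D b b')"
      by (rule sum.swap)
    also have "\<dots> = (\<Sum>b\<in>A. \<Sum>b'\<in>A. \<Sum>x\<in>P. of_bool (b + x \<in> A) * of_bool (b' + x \<in> A) * D b b')"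
      by (rule sum.cong[OF refl], rule sum.swap)
    also have "\<dots> = (\<Sum>b\<in>A. \<Sum>b'\<in>A. D b b' ^ 2)"
      by (simp add: D_def sum_distrib_right power2_eq_square)
    also have "\<dots> \<le> (\<Sum>b\<in>A. \<Sum>b'\<in>A. real (rep A A (b - b')) ^ 2)"
      by (intro sum_mono power_mono D)
    also have "\<dots> = (\<Sum>w\<in>dif A A. real (rep A A w) ^ 3)"
      by (subst sum_group_dif[OF assms(1), of "\<lambda>w. real (rep A A w) ^ 2"])
         (simp add: power2_eq_square power3_eq_cube mult.assoc)
    finally show "(\<Sum>i\<in>P\<times>P. (case i of (x,y) \<Rightarrow> C x y) ^ 2) \<le> (\<Sum>w\<in>dif A A. real (rep A A w) ^ 3)" .
  qed (intro sum_nonneg, simp)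
  finally show ?thesis by (simp add: P_def case_prod_unfold)
qed

lemma card_popular_pow_le:
  assumes "controlled C A" "0 \<le> C" "finite A" "0 < k"
  shows "real (card (popular k A)) * real k ^ 3 \<le> C * real (card A) ^ 3"
  using controlledD(1)[OF assms(1,3,3,4), of "popular k A"]
  by (simp add: popular_def power2_eq_square power3_eq_cube mult.assoc)

text \<open>A pair \<open>(x, y)\<close> of popular differences with
  \<open>k <= rep A A (x - y)\<close> can be read in two ways. Directly, it contributes
  \<open>k\<close> to the energy of \<open>A\<close> with the popular differences. As the pair
  \<open>(x, q)\<close> with \<open>q = x - y\<close>, it is a pair from \<open>popular s A\<close>
  and \<open>popular k A\<close> whose difference \<open>x - q = y\<close> again has
  \<open>s\<close> representations. The bounds \<open>e1\<close> and \<open>e2\<close> are these two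
  readings.\<close>

lemma popular_difference_square_sum:
  fixes C :: real
  assumes ctrl: "controlled C A" and C: "0 \<le> C" and fA: "finite A" and s: "0 < s"
  defines "n \<equiv> real (card A)" and "m \<equiv> real (card (popular s A))" and "h \<equiv> harm (card A)"
  shows "real s ^ 8 * (\<Sum>(x,y)\<in>popular s A \<times> popular s A. real (rep A A (x - y)) ^ 2) ^ 10
     \<le> 2 ^ 20 * C ^ 11 * n ^ 28 * m ^ 9 * h ^ 20"
proof -
  define P where "P = popular s A"
  have fP: "finite P" unfolding P_def by (rule finite_popular[OF fA s])
  have n0: "0 \<le> n" and m0: "0 \<le> m" and h0: "0 \<le> h" by (simp_all add: n_def m_def h_def harm_nonneg)
  define en where "en B = 2 * sqrt (C * n ^ 2 * real (card B) ^ 3) * h" for B :: "real set"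
  have en0: "0 \<le> en B" for B unfolding en_def using h0 C by simp
  have en2: "en B ^ 2 = 4 * (C * n ^ 2 * real (card B) ^ 3) * h ^ 2" for B
    unfolding en_def power_mult_distrib using C by simp
  have energy: "(\<Sum>u\<in>U. real (rep A B u) ^ 2) \<le> en B" if "finite B" "finite U" for B U
    unfolding en_def n_def h_def by (rule energy_le[OF ctrl C fA that])
  define e where "e k = real (card {i\<in>P\<times>P. k \<le> (case i of (x,y) \<Rightarrow> rep A A (x - y))})" for k
  have e0: "0 \<le> e k" for k by (simp add: e_def)
  have e1: "real k * e k \<le> en P" for k
  proof -
    have "real k * e k = (\<Sum>i\<in>{i\<in>P\<times>P. k \<le> (case i of (x,y) \<Rightarrow> rep A A (x - y))}. real k)"
      by (simp add: e_def)
    also have "\<dots> \<le> (\<Sum>i\<in>{i\<in>P\<times>P. k \<le> (case i of (x,y) \<Rightarrow> rep A A (x - y))}. (case i of (x,y) \<Rightarrow> real (rep A A (x - y))))"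
      by (intro sum_mono) auto
    also have "\<dots> \<le> (\<Sum>i\<in>P\<times>P. (case i of (x,y) \<Rightarrow> real (rep A A (x - y))))"
      by (intro sum_mono2) (use fP in auto)
    also have "\<dots> = (\<Sum>x\<in>P. \<Sum>y\<in>P. real (rep A A (x - y)))" by (simp add: sum.cartesian_product)
    also have "\<dots> = (\<Sum>u\<in>dif A P. real (rep A P u) ^ 2)"
      by (simp add: sum_rep_rep[OF fA fP fP] power2_eq_square)
    also have "\<dots> \<le> en P" by (rule energy) (use fA fP in auto)
    finally show ?thesis .
  qed
  have e2: "(real s * e k) ^ 2 \<le> en P * en (popular k A)" if k: "0 < k" for k
  proof -
    define Q where "Q = popular k A"
    have fQ: "finite Q" unfolding Q_def by (rule finite_popular[OF fA k])
    define T where "T = {i\<in>P\<times>Q. (case i of (x,q) \<Rightarrow> x - q \<in> P)}"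
    have "e k = real (card T)"
      unfolding e_def T_def
      by (rule arg_cong[where f = real], rule bij_betw_same_card[of "\<lambda>(x,y). (x, x - y)"],
          rule bij_betw_byWitness[where f' = "\<lambda>(x,q). (x, x - q)"])
         (auto simp: Q_def popular_def)
    then have "real s * e k = (\<Sum>i\<in>T. real s)" by simp
    also have "\<dots> \<le> (\<Sum>i\<in>T. (case i of (x,q) \<Rightarrow> real (rep A A (x - q))))"
      by (intro sum_mono) (auto simp: T_def P_def popular_def)
    also have "\<dots> \<le> (\<Sum>i\<in>P\<times>Q. (case i of (x,q) \<Rightarrow> real (rep A A (x - q))))"
      by (intro sum_mono2) (use fP fQ in \<open>auto simp: T_def\<close>)
    also have "\<dots> = (\<Sum>x\<in>P. \<Sum>q\<in>Q. real (rep A A (x - q)))" by (simp add: sum.cartesian_product)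
    also have "\<dots> = (\<Sum>u\<in>dif A P. real (rep A P u) * real (rep A Q u))"
      by (rule sum_rep_rep[OF fA fP fQ])
    finally have "(real s * e k) ^ 2 \<le> (\<Sum>u\<in>dif A P. real (rep A P u) * real (rep A Q u)) ^ 2"
      by (rule power_mono) (simp add: e0)
    also have "\<dots> \<le> (\<Sum>u\<in>dif A P. real (rep A P u) ^ 2) * (\<Sum>u\<in>dif A P. real (rep A Q u) ^ 2)"
      by (rule Cauchy_Schwarz_ineq_sum)
    also have "\<dots> \<le> en P * en Q"
      by (intro mult_mono energy en0 sum_nonneg) (use fA fP fQ in auto)
    finally show ?thesis by (simp add: Q_def)
  qed
  define R where "R = 1024 * C ^ 11 * n ^ 28 * m ^ 9 * h ^ 10 / real s ^ 8"
  have R0: "0 \<le> R" unfolding R_def using C n0 m0 h0 by simp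
  \<comment> \<open>Weighting \<open>e1\<close> and \<open>e2\<close> as 1 : 4 makes the bound for \<open>e k\<close> decay like \<open>k ^ (-2)\<close>, so that the
    layers of the second moment add up to a harmonic sum.\<close>
  have eR: "(real k ^ 2 * e k) ^ 10 \<le> R" if k: "0 < k" for k
  proof -
    have reassoc: "C ^ 3 * (n ^ 6 * (C ^ 8 * n ^ 22)) = (C ^ 3 * C ^ 8) * (n ^ 6 * n ^ 22)"
      by (simp only: mult_ac)
    define q where "q = real (card (popular k A))"
    have q: "q * real k ^ 3 \<le> C * n ^ 3" unfolding q_def n_def by (rule card_popular_pow_le[OF ctrl C fA k])
    have q9: "q ^ 3 * real k ^ 9 \<le> C ^ 3 * n ^ 9"
    proof -
      have "(q * real k ^ 3) ^ 3 \<le> (C * n ^ 3) ^ 3" by (rule power_mono[OF q]) (simp add: q_def)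
      then show ?thesis by (simp add: power_mult_distrib flip: power_mult)
    qed
    have "(real s * e k) ^ 8 = ((real s * e k) ^ 2) ^ 4" by (simp flip: power_mult)
    also have "\<dots> \<le> (en P * en (popular k A)) ^ 4" by (rule power_mono[OF e2[OF k]]) simp
    also have "\<dots> = (en P ^ 2) ^ 2 * (en (popular k A) ^ 2) ^ 2" by (simp add: power_mult_distrib flip: power_mult)
    finally have s8: "(real s * e k) ^ 8 \<le> (en P ^ 2) ^ 2 * (4 * (C * n ^ 2 * q ^ 3) * h ^ 2) ^ 2"
      unfolding en2[of "popular k A"] q_def .
    have "(real k * e k) ^ 2 \<le> en P ^ 2" by (rule power_mono[OF e1]) (simp add: e0)
    with s8 have "(real s * e k) ^ 8 * (real k * e k) ^ 2
        \<le> ((en P ^ 2) ^ 2 * (4 * (C * n ^ 2 * q ^ 3) * h ^ 2) ^ 2) * en P ^ 2"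
      by (rule mult_mono) (auto simp: en0)
    \<comment> \<open>The 18 powers of \<open>k\<close> are absorbed by \<open>q^6\<close> through
      \<open>q k^3 <= C n^3\<close>. Together with the two already present they are 20 powers of
      \<open>k\<close> for ten of \<open>e k\<close>.\<close>
    then have "((real s * e k) ^ 8 * (real k * e k) ^ 2) * real k ^ 18
        \<le> (((en P ^ 2) ^ 2 * (4 * (C * n ^ 2 * q ^ 3) * h ^ 2) ^ 2) * en P ^ 2) * real k ^ 18"
      by (rule mult_right_mono) simp
    also have "\<dots> = (en P ^ 2) ^ 3 * (4 * (C * n ^ 2) * h ^ 2) ^ 2 * (q ^ 3 * real k ^ 9) ^ 2"
      by (simp add: power_mult_distrib power2_eq_square power3_eq_cube flip: power_mult power_add)
    also have "\<dots> \<le> (en P ^ 2) ^ 3 * (4 * (C * n ^ 2) * h ^ 2) ^ 2 * (C ^ 3 * n ^ 9) ^ 2"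
      by (intro mult_left_mono power_mono q9) (auto simp: q_def)
    also have "\<dots> = 1024 * C ^ 11 * n ^ 28 * m ^ 9 * h ^ 10"
      unfolding en2 m_def[unfolded P_def[symmetric], symmetric] P_def[symmetric]
      by (simp add: power_mult_distrib flip: power_mult, simp add: algebra_simps flip: power_add)
         (use reassoc in simp)
    also have "((real s * e k) ^ 8 * (real k * e k) ^ 2) * real k ^ 18 = (real k ^ 2 * e k) ^ 10 * real s ^ 8"
      by (simp add: power_mult_distrib flip: power_mult) (simp add: algebra_simps flip: power_add)
    finally show ?thesis unfolding R_def using s by (simp add: pos_le_divide_eq)
  qed
  have eroot: "real k ^ 2 * e k \<le> root 10 R" if "0 < k" for k
  proof -
    have "root 10 ((real k ^ 2 * e k) ^ 10) \<le> root 10 R" using eR[OF that] by simp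
    then show ?thesis using e0 by (simp add: real_root_power_cancel)
  qed
  define Y where "Y = (\<Sum>(x,y)\<in>P \<times> P. real (rep A A (x - y)) ^ 2)"
  have Y0: "0 \<le> Y" unfolding Y_def by (intro sum_nonneg) auto
  have "Y = (\<Sum>i\<in>P\<times>P. real (case i of (x,y) \<Rightarrow> rep A A (x - y)) ^ 2)"
    unfolding Y_def by (intro sum.cong) auto
  also have "\<dots> \<le> (\<Sum>i\<in>P\<times>P. \<Sum>k=1..(case i of (x,y) \<Rightarrow> rep A A (x - y)). 2 * real k)"
    by (intro sum_mono square_le_layers)
  also have "\<dots> \<le> (2 * root 10 R) * h"
    unfolding h_def
  proof (rule layers_le_harm)
    fix k :: nat assume k: "0 < k"
    have "2 * real k * e k = 2 * (real k ^ 2 * e k) / real k" using k by (simp add: power2_eq_square)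
    also have "\<dots> \<le> 2 * root 10 R / real k" using eroot[OF k] by (intro divide_right_mono) auto
    finally show "2 * real k * real (card {x \<in> P \<times> P. k \<le> (case x of (x, y) \<Rightarrow> rep A A (x - y))})
        \<le> 2 * root 10 R / real k" by (simp add: e_def)
  qed (use fP fA rep_le_left in auto)
  finally have "Y ^ 10 \<le> ((2 * root 10 R) * h) ^ 10" by (rule power_mono[OF _ Y0])
  also have "\<dots> = 1024 * R * h ^ 10"
    using R0 by (simp add: power_mult_distrib)
  finally have "real s ^ 8 * Y ^ 10 \<le> real s ^ 8 * (1024 * R * h ^ 10)" by (rule mult_left_mono) simp
  also have "\<dots> = 2 ^ 20 * C ^ 11 * n ^ 28 * m ^ 9 * h ^ 20"
    unfolding R_def using s by (simp add: power_add[of h 10 10, simplified])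
  finally show ?thesis unfolding Y_def P_def .
qed

text \<open>The twentieth power of the lower bound for \<open>cherries\<close> brings in
  \<open>Y^10\<close>. Of the extra factor \<open>s^17\<close>, eight powers pay for the bound on
  \<open>Y\<close> and nine turn \<open>m^9\<close> into \<open>N^9\<close>, which cancels against
  \<open>N^60\<close>. This leaves \<open>N^51\<close>, \<open>s^(20 + 17)\<close> and
  \<open>n^(60 + 30 + 28)\<close>.\<close>

lemma popular_pairs_le:
  fixes C :: real
  assumes ctrl: "controlled C A" and C: "0 \<le> C" and fA: "finite A" and s: "0 < s"
  shows "real (popular_pairs s A) ^ 51 * real s ^ 37
     \<le> 2 ^ 120 * 3 ^ 10 * C ^ 21 * real (card A) ^ 118 * harm (card A) ^ 30"
proof -
  define n m h N where "n = real (card A)" and "m = real (card (popular s A))"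
    and "h = (harm (card A) :: real)" and "N = real (popular_pairs s A)"
  have n0: "0 \<le> n" and m0: "0 \<le> m" and h0: "0 \<le> h" and N0: "0 \<le> N"
    by (simp_all add: n_def m_def h_def N_def harm_nonneg)
  define Y where "Y = (\<Sum>(x,y)\<in>popular s A \<times> popular s A. real (rep A A (x - y)) ^ 2)"
  have Y: "real s ^ 8 * Y ^ 10 \<le> 2 ^ 20 * C ^ 11 * n ^ 28 * m ^ 9 * h ^ 20"
    unfolding Y_def n_def m_def h_def by (rule popular_difference_square_sum[OF ctrl C fA s])
  have Y0: "0 \<le> Y" unfolding Y_def by (intro sum_nonneg) auto
  define Z where "Z = cherries s A"
  have Z2: "Z ^ 2 \<le> (3 * C * n ^ 3 * h) * Y"
    unfolding Z_def n_def h_def Y_def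
    by (rule order_trans[OF cherries_square_le[OF fA s]])
       (intro mult_right_mono third_moment_le ctrl fA sum_nonneg, auto)
  have sN: "s * N ^ 3 \<le> 32 * n ^ 3 * Z"
    unfolding N_def n_def Z_def by (rule cherries_ge[OF fA s])
  have "(s * N ^ 3) ^ 20 \<le> (32 * n ^ 3 * Z) ^ 20" by (rule power_mono[OF sN]) (simp add: N0)
  also have "\<dots> = 32 ^ 20 * n ^ 60 * (Z ^ 2) ^ 10"
    by (simp add: power_mult_distrib flip: power_mult)
  also have "\<dots> \<le> 32 ^ 20 * n ^ 60 * ((3 * C * n ^ 3 * h) * Y) ^ 10"
    by (intro mult_left_mono power_mono Z2) (use n0 in auto)
  finally have "(s * N ^ 3) ^ 20 * real s ^ 17 \<le> (32 ^ 20 * n ^ 60 * ((3 * C * n ^ 3 * h) * Y) ^ 10) * real s ^ 17"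
    by (rule mult_right_mono) simp
  also have "\<dots> = (32 ^ 20 * n ^ 60 * (3 * C * n ^ 3 * h) ^ 10 * real s ^ 9) * (real s ^ 8 * Y ^ 10)"
    by (simp add: power_mult_distrib flip: power_mult power_add)
  also have "\<dots> \<le> (32 ^ 20 * n ^ 60 * (3 * C * n ^ 3 * h) ^ 10 * real s ^ 9) * (2 ^ 20 * C ^ 11 * n ^ 28 * m ^ 9 * h ^ 20)"
    by (rule mult_left_mono[OF Y]) (use n0 C h0 in simp)
  also have "\<dots> = (32 ^ 20 * n ^ 60 * (3 * C * n ^ 3 * h) ^ 10) * (2 ^ 20 * C ^ 11 * n ^ 28 * h ^ 20) * (s * m) ^ 9"
    by (simp add: power_mult_distrib)
  also have "\<dots> \<le> (32 ^ 20 * n ^ 60 * (3 * C * n ^ 3 * h) ^ 10) * (2 ^ 20 * C ^ 11 * n ^ 28 * h ^ 20) * N ^ 9"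
    unfolding N_def m_def
    by (intro mult_left_mono power_mono card_popular_le[OF fA s]) (use n0 C h0 in auto)
  also have "\<dots> = (2 ^ 120 * 3 ^ 10 * C ^ 21 * n ^ 118 * h ^ 30) * N ^ 9"
    by (simp add: power_mult_distrib flip: power_mult) (simp add: algebra_simps flip: power_add)
  also have "(s * N ^ 3) ^ 20 * real s ^ 17 = (N ^ 51 * real s ^ 37) * N ^ 9"
    by (simp add: power_mult_distrib flip: power_mult) (simp add: algebra_simps flip: power_add)
  finally have fin: "(N ^ 51 * real s ^ 37) * N ^ 9 \<le> (2 ^ 120 * 3 ^ 10 * C ^ 21 * n ^ 118 * h ^ 30) * N ^ 9" .
  show ?thesis
  proof (cases "N = 0")
    case True then show ?thesis using C by (simp add: N_def harm_nonneg)
  next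
    case False
    then have "0 < N ^ 9" using N0 by simp
    with fin have "N ^ 51 * real s ^ 37 \<le> 2 ^ 120 * 3 ^ 10 * C ^ 21 * n ^ 118 * h ^ 30"
      by (rule mult_right_le_imp_le)
    then show ?thesis by (simp add: N_def n_def h_def)
  qed
qed

section \<open>Parabolas and Sidon sets\<close>

text \<open>Equal sums of the first coordinates cancel the linear and constant terms, and the
  quadratic terms then differ by \<open>2 (u1 - u3) (u1 - u4)\<close>, so the odd prime
  \<open>p\<close> divides one of the two factors.\<close>

lemma parabola_sidon:
  fixes p :: nat and u1 u2 u3 u4 v1 v2 v3 v4 b c :: int
  assumes p: "prime p" "2 < p"
    and par: "[v1 = u1\<^sup>2 + b * u1 + c] (mod int p)" "[v2 = u2\<^sup>2 + b * u2 + c] (mod int p)"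
      "[v3 = u3\<^sup>2 + b * u3 + c] (mod int p)" "[v4 = u4\<^sup>2 + b * u4 + c] (mod int p)"
    and sums: "u1 + u2 = u3 + u4" "v1 + v2 = v3 + v4"
  shows "([u1 = u3] (mod int p) \<and> [v1 = v3] (mod int p) \<and> [u2 = u4] (mod int p) \<and> [v2 = v4] (mod int p)) \<or>
    ([u1 = u4] (mod int p) \<and> [v1 = v4] (mod int p) \<and> [u2 = u3] (mod int p) \<and> [v2 = v3] (mod int p))"
proof -
  have "[v1 + v2 = (u1\<^sup>2 + b * u1 + c) + (u2\<^sup>2 + b * u2 + c)] (mod int p)"
    by (rule cong_add[OF par(1,2)])
  moreover have "[v3 + v4 = (u3\<^sup>2 + b * u3 + c) + (u4\<^sup>2 + b * u4 + c)] (mod int p)"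
    by (rule cong_add[OF par(3,4)])
  ultimately have "[(u1\<^sup>2 + b * u1 + c) + (u2\<^sup>2 + b * u2 + c) = (u3\<^sup>2 + b * u3 + c) + (u4\<^sup>2 + b * u4 + c)] (mod int p)"
    using sums(2) by (metis cong_sym cong_trans)
  then have "int p dvd ((u1\<^sup>2 + b * u1 + c) + (u2\<^sup>2 + b * u2 + c)) - ((u3\<^sup>2 + b * u3 + c) + (u4\<^sup>2 + b * u4 + c))"
    by (simp add: cong_iff_dvd_diff)
  also have "((u1\<^sup>2 + b * u1 + c) + (u2\<^sup>2 + b * u2 + c)) - ((u3\<^sup>2 + b * u3 + c) + (u4\<^sup>2 + b * u4 + c))
      = 2 * ((u1 - u3) * (u1 - u4))"
  proof -
    have u2: "u2 = u3 + u4 - u1" using sums(1) by simp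
    show ?thesis unfolding u2 by (simp add: power2_eq_square algebra_simps)
  qed
  finally have "int p dvd 2 * ((u1 - u3) * (u1 - u4))" .
  moreover have pp: "prime (int p)" using p by simp
  moreover have "\<not> int p dvd 2" using p by (auto dest: zdvd_imp_le)
  ultimately have "int p dvd u1 - u3 \<or> int p dvd u1 - u4"
    by (metis prime_dvd_mult_iff)
  then consider "[u1 = u3] (mod int p)" | "[u1 = u4] (mod int p)" by (auto simp: cong_iff_dvd_diff)
  then show ?thesis
  proof cases
    case 1
    then have 2: "[u2 = u4] (mod int p)" using sums(1) by (simp add: cong_iff_dvd_diff) (metis add_diff_cancel_left' add_diff_eq diff_add_eq dvd_diff_commute minus_diff_eq)
    have "[v1 = v3] (mod int p)"
      using par(1,3) 1 by (meson cong_add cong_mult cong_pow cong_refl cong_sym cong_trans)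
    moreover have "[v2 = v4] (mod int p)"
      using par(2,4) 2 by (meson cong_add cong_mult cong_pow cong_refl cong_sym cong_trans)
    ultimately show ?thesis using 1 2 by blast
  next
    case 2
    then have 3: "[u2 = u3] (mod int p)" using sums(1) by (simp add: cong_iff_dvd_diff) (metis add_diff_cancel_left' add_diff_eq diff_add_eq dvd_diff_commute minus_diff_eq add.commute)
    have "[v1 = v4] (mod int p)"
      using par(1,4) 2 by (meson cong_add cong_mult cong_pow cong_refl cong_sym cong_trans)
    moreover have "[v2 = v3] (mod int p)"
      using par(2,3) 3 by (meson cong_add cong_mult cong_pow cong_refl cong_sym cong_trans)
    ultimately show ?thesis using 2 3 by blast
  qed
qed

text \<open>The dual view: the point is fixed and the parameters vary, since it is the parabola that
  is chosen at random.\<close>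

definition parabolas :: "nat \<Rightarrow> int \<Rightarrow> int \<Rightarrow> (int \<times> int) set" where
  "parabolas p u v = {(b,c). b \<in> {0..<int p} \<and> c \<in> {0..<int p} \<and> [v = u\<^sup>2 + b * u + c] (mod int p)}"

lemma finite_parabolas [simp]: "finite (parabolas p u v)"
  by (rule finite_subset[of _ "{0..<int p} \<times> {0..<int p}"]) (auto simp: parabolas_def)

lemma card_parabolas:
  assumes "0 < p"
  shows "card (parabolas p u v) = p"
proof -
  have "parabolas p u v = (\<lambda>b. (b, (v - u\<^sup>2 - b * u) mod int p)) ` {0..<int p}"
  proof (intro set_eqI iffI)
    fix i assume "i \<in> parabolas p u v"
    then obtain b c where i: "i = (b,c)" "b \<in> {0..<int p}" "c \<in> {0..<int p}" "[v = u\<^sup>2 + b * u + c] (mod int p)"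
      by (auto simp: parabolas_def)
    have "[v - u\<^sup>2 - b * u = c] (mod int p)" using i(4) by (simp add: cong_iff_dvd_diff algebra_simps)
    then have "(v - u\<^sup>2 - b * u) mod int p = c" using i(3) by (simp add: cong_def)
    then show "i \<in> (\<lambda>b. (b, (v - u\<^sup>2 - b * u) mod int p)) ` {0..<int p}" using i by auto
  next
    fix i assume "i \<in> (\<lambda>b. (b, (v - u\<^sup>2 - b * u) mod int p)) ` {0..<int p}"
    then obtain b where b: "i = (b, (v - u\<^sup>2 - b * u) mod int p)" "b \<in> {0..<int p}" by auto
    have "[(v - u\<^sup>2 - b * u) mod int p = v - u\<^sup>2 - b * u] (mod int p)" by (simp add: cong_def)
    then have "[u\<^sup>2 + b * u + (v - u\<^sup>2 - b * u) mod int p = u\<^sup>2 + b * u + (v - u\<^sup>2 - b * u)] (mod int p)"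
      by (intro cong_add cong_refl)
    then show "i \<in> parabolas p u v" using b assms by (simp add: parabolas_def cong_sym_eq)
  qed
  moreover have "inj_on (\<lambda>b. (b, (v - u\<^sup>2 - b * u) mod int p)) {0..<int p}" by (auto simp: inj_on_def)
  ultimately show ?thesis by (simp add: card_image)
qed

text \<open>Eliminating \<open>c\<close> leaves a linear equation for \<open>b\<close> with
  coefficient \<open>u - u'\<close>. If that coefficient vanishes modulo \<open>p\<close>, points
  with different second coordinates lie on no common parabola.\<close>

lemma card_parabolas_two_points:
  assumes p: "prime p" and ne: "\<not> ([u = u'] (mod int p) \<and> [v = v'] (mod int p))"
  shows "card (parabolas p u v \<inter> parabolas p u' v') \<le> 1"
proof -
  have "i = j" if i: "i \<in> parabolas p u v \<inter> parabolas p u' v'" and j: "j \<in> parabolas p u v \<inter> parabolas p u' v'" for i j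
  proof -
    obtain b c where bc: "i = (b,c)" "b \<in> {0..<int p}" "c \<in> {0..<int p}"
      "[v = u\<^sup>2 + b * u + c] (mod int p)" "[v' = u'\<^sup>2 + b * u' + c] (mod int p)"
      using i by (auto simp: parabolas_def)
    obtain b' c' where bc': "j = (b',c')" "b' \<in> {0..<int p}" "c' \<in> {0..<int p}"
      "[v = u\<^sup>2 + b' * u + c'] (mod int p)" "[v' = u'\<^sup>2 + b' * u' + c'] (mod int p)"
      using j by (auto simp: parabolas_def)
    have ne_u: "\<not> [u = u'] (mod int p)"
    proof
      assume u: "[u = u'] (mod int p)"
      then have "[u\<^sup>2 + b * u + c = u'\<^sup>2 + b * u' + c] (mod int p)"
        by (intro cong_add cong_mult cong_pow cong_refl)
      then have "[v = v'] (mod int p)" using bc(4,5) by (meson cong_sym cong_trans)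
      then show False using ne u by blast
    qed
    have d1: "int p dvd (u\<^sup>2 + b * u + c) - (u\<^sup>2 + b' * u + c')"
      using cong_trans[OF cong_sym[OF bc(4)] bc'(4)] by (simp only: cong_iff_dvd_diff)
    have d2: "int p dvd (u'\<^sup>2 + b * u' + c) - (u'\<^sup>2 + b' * u' + c')"
      using cong_trans[OF cong_sym[OF bc(5)] bc'(5)] by (simp only: cong_iff_dvd_diff)
    have "int p dvd ((u\<^sup>2 + b * u + c) - (u\<^sup>2 + b' * u + c')) - ((u'\<^sup>2 + b * u' + c) - (u'\<^sup>2 + b' * u' + c'))"
      by (rule dvd_diff[OF d1 d2])
    also have "\<dots> = (b - b') * (u - u')" by (simp add: algebra_simps)
    finally have "int p dvd b - b'"
      using p ne_u by (simp add: prime_dvd_mult_iff cong_iff_dvd_diff)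
    then have b: "b = b'" using bc(2) bc'(2)
      by (metis atLeastLessThan_iff cong_iff_dvd_diff cong_less_imp_eq_int)
    then have "int p dvd c - c'" using d1 by simp
    then have "c = c'" using bc(3) bc'(3)
      by (metis atLeastLessThan_iff cong_iff_dvd_diff cong_less_imp_eq_int)
    then show ?thesis using b bc(1) bc'(1) by simp
  qed
  then show ?thesis
    by (metis One_nat_def card.empty card_le_Suc0_iff_eq finite_Int finite_parabolas)
qed

section \<open>Deletion of bad configurations\<close>

definition same_cell :: "nat \<Rightarrow> (real \<Rightarrow> nat) \<Rightarrow> (real \<Rightarrow> int) \<Rightarrow> (real \<Rightarrow> int) \<Rightarrow> real \<Rightarrow> real \<Rightarrow> bool" where
  "same_cell p \<tau> u v x y \<longleftrightarrow> \<tau> x = \<tau> y \<and> [u x = u y] (mod int p) \<and> [v x = v y] (mod int p)"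

text \<open>A triple \<open>(a, b, c)\<close> stands for the additive quadruple \<open>a - c = b - d\<close>.\<close>
definition quads :: "real set \<Rightarrow> real set \<Rightarrow> (real \<times> real \<times> real) set" where
  "quads R A = {(a,b,c). a \<in> A \<and> b \<in> A \<and> c \<in> A \<and> b - a + c \<in> A \<and> a \<noteq> b \<and> a \<noteq> c \<and> a - c \<notin> R}"

text \<open>\<open>R\<close> will be \<open>popular p A\<close>, so close means here that the
  difference is popular.\<close>

definition close_pairs :: "real set \<Rightarrow> real set \<Rightarrow> (real \<times> real) set" where
  "close_pairs R A = {(a,c). a \<in> A \<and> c \<in> A \<and> a \<noteq> c \<and> a - c \<in> R}"

lemma finite_quads [simp]: "finite A \<Longrightarrow> finite (quads R A)"
  by (rule finite_subset[of _ "A \<times> A \<times> A"]) (auto simp: quads_def)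

lemma finite_close_pairs [simp]: "finite A \<Longrightarrow> finite (close_pairs R A)"
  by (rule finite_subset[of _ "A \<times> A"]) (auto simp: close_pairs_def)

lemma sum_card_swap:
  assumes "finite X" "finite Y"
  shows "(\<Sum>x\<in>X. card {y\<in>Y. P x y}) = (\<Sum>y\<in>Y. card {x\<in>X. P x y})"
proof -
  have "(\<Sum>x\<in>X. card {y\<in>Y. P x y}) = (\<Sum>x\<in>X. \<Sum>y\<in>Y. if P x y then 1 else 0)"
    using assms by (simp add: sum.If_cases Int_def)
  also have "\<dots> = (\<Sum>y\<in>Y. \<Sum>x\<in>X. if P x y then 1 else 0)" by (rule sum.swap)
  also have "\<dots> = (\<Sum>y\<in>Y. card {x\<in>X. P x y})"
    using assms by (simp add: sum.If_cases Int_def)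
  finally show ?thesis .
qed

text \<open>The deletion method over the \<open>4 p^2\<close> choices of a class and a parabola. An
  element is kept by \<open>p\<close> of them, and two elements in different cells are kept together
  by at most one. Hence a bad pair inside one cell costs \<open>p\<close>, a quadruple with
  \<open>a\<close> and \<open>c\<close> in one cell costs 1, and it costs up to \<open>p\<close>
  more if \<open>b\<close> lies in that cell too.\<close>

lemma sidon_from_cells:
  fixes A R :: "real set"
  assumes fA: "finite A" and p: "prime p" "2 < p"
    and \<tau>: "\<And>x. \<tau> x < 4"
    and add: "\<And>x1 x2 x3 x4. \<tau> x2 = \<tau> x1 \<Longrightarrow> \<tau> x3 = \<tau> x1 \<Longrightarrow> \<tau> x4 = \<tau> x1 \<Longrightarrow>
       x1 + x2 = x3 + x4 \<Longrightarrow> u x1 + u x2 = u x3 + u x4 \<and> v x1 + v x2 = v x3 + v x4"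
  defines "D1 \<equiv> {(a,c)\<in>close_pairs R A. same_cell p \<tau> u v a c}"
    and "D2 \<equiv> {(a,b,c)\<in>quads R A. same_cell p \<tau> u v a c}"
    and "D3 \<equiv> {(a,b,c)\<in>quads R A. same_cell p \<tau> u v a c \<and> same_cell p \<tau> u v a b}"
  shows "\<exists>B\<subseteq>A. sidon B \<and>
    real p * real (card A) \<le> 4 * real p ^ 2 * real (card B) + real p * real (card D1) + real (card D2) + real p * real (card D3)"
proof -
  define \<Omega> where "\<Omega> = {..<(4::nat)} \<times> {0..<int p} \<times> {0..<int p}"
  have f\<Omega>: "finite \<Omega>" and c\<Omega>: "card \<Omega> = 4 * p ^ 2"
    by (simp_all add: \<Omega>_def card_cartesian_product power2_eq_square)
  define sel where "sel w x \<longleftrightarrow> fst w = \<tau> x \<and> snd w \<in> parabolas p (u x) (v x)" for w :: "nat \<times> int \<times> int" and x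
  have selset: "{w\<in>\<Omega>. sel w x} = {\<tau> x} \<times> parabolas p (u x) (v x)" for x
    using \<tau> by (auto simp: \<Omega>_def sel_def parabolas_def)
  have p0: "0 < p" using p by simp
  have card_sel: "card {w\<in>\<Omega>. sel w x} = p" for x
    unfolding selset by (simp add: card_cartesian_product card_parabolas[OF p0])
  let ?s = "same_cell p \<tau> u v"
  define S where "S w = {x\<in>A. sel w x}" for w
  define B1 where "B1 w = {i\<in>D1. sel w (fst i)}" for w
  define B2 where "B2 w = {i\<in>D2. sel w (fst i) \<and> sel w (fst (snd i))}" for w
  have fD: "finite D1" "finite D2" "finite D3"
    using finite_close_pairs[OF fA] finite_quads[OF fA] unfolding D1_def D2_def D3_def
    by (auto intro: finite_subset[OF _ finite_close_pairs[OF fA]] finite_subset[OF _ finite_quads[OF fA]])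
  have sumS: "(\<Sum>w\<in>\<Omega>. card (S w)) = p * card A"
    unfolding S_def sum_card_swap[OF f\<Omega> fA] by (simp add: card_sel)
  have sumB1: "(\<Sum>w\<in>\<Omega>. card (B1 w)) = p * card D1"
    unfolding B1_def sum_card_swap[OF f\<Omega> fD(1)] by (simp add: card_sel)
  have sumB2: "(\<Sum>w\<in>\<Omega>. card (B2 w)) \<le> card D2 + p * card D3"
  proof -
    have "(\<Sum>w\<in>\<Omega>. card (B2 w)) = (\<Sum>i\<in>D2. card {w\<in>\<Omega>. sel w (fst i) \<and> sel w (fst (snd i))})"
      unfolding B2_def by (rule sum_card_swap[OF f\<Omega> fD(2)])
    \<comment> \<open>As \<open>a\<close> and \<open>c\<close> share a cell, what remains to be
      counted are the choices that keep both \<open>a\<close> and \<open>b\<close>.\<close>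
    also have "\<dots> \<le> (\<Sum>i\<in>D2. 1 + (if i \<in> D3 then p else 0))"
    proof (rule sum_mono)
      fix i assume i: "i \<in> D2"
      obtain a b c where abc: "i = (a,b,c)" by (cases i)
      show "card {w\<in>\<Omega>. sel w (fst i) \<and> sel w (fst (snd i))} \<le> 1 + (if i \<in> D3 then p else 0)"
      proof (cases "i \<in> D3")
        case True
        have "card {w\<in>\<Omega>. sel w a \<and> sel w b} \<le> card {w\<in>\<Omega>. sel w a}"
          by (rule card_mono) (use f\<Omega> in auto)
        then show ?thesis using True by (simp add: abc card_sel)
      next
        case False
        then have ns: "\<not> ?s a b" using i abc by (auto simp: D2_def D3_def)
        show ?thesis
        proof (cases "\<tau> a = \<tau> b")
          case True
          have "{w\<in>\<Omega>. sel w a \<and> sel w b} \<subseteq> {\<tau> a} \<times> (parabolas p (u a) (v a) \<inter> parabolas p (u b) (v b))"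
            by (auto simp: sel_def)
          then have "card {w\<in>\<Omega>. sel w a \<and> sel w b} \<le> card ({\<tau> a} \<times> (parabolas p (u a) (v a) \<inter> parabolas p (u b) (v b)))"
            by (intro card_mono) auto
          also have "\<dots> \<le> 1"
            using card_parabolas_two_points[OF p(1), of "u a" "u b" "v a" "v b"] ns True
            by (simp add: card_cartesian_product same_cell_def)
          finally show ?thesis by (simp add: abc)
        next
          case False
          then have "{w\<in>\<Omega>. sel w a \<and> sel w b} = {}" by (auto simp: sel_def)
          then have "card {w\<in>\<Omega>. sel w a \<and> sel w b} = 0" by (simp only: card.empty)
          then show ?thesis by (simp add: abc)
        qed
      qed
    qed
    also have "\<dots> = (\<Sum>i\<in>D2. 1) + (\<Sum>i\<in>D2. if i \<in> D3 then p else 0)" by (rule sum.distrib)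
    also have "\<dots> = card D2 + p * card (D2 \<inter> D3)"
      using fD by (simp add: sum.If_cases Int_def mult.commute)
    also have "D2 \<inter> D3 = D3" by (auto simp: D2_def D3_def)
    finally show ?thesis .
  qed
  define val where "val w = real (card (S w)) - real (card (B1 w)) - real (card (B2 w))" for w
  have total: "real p * real (card A) - real p * real (card D1) - (real (card D2) + real p * real (card D3)) \<le> (\<Sum>w\<in>\<Omega>. val w)"
  proof -
    have "(\<Sum>w\<in>\<Omega>. val w) = real (\<Sum>w\<in>\<Omega>. card (S w)) - real (\<Sum>w\<in>\<Omega>. card (B1 w)) - real (\<Sum>w\<in>\<Omega>. card (B2 w))"
      by (simp add: val_def sum_subtractf)
    moreover have "real (\<Sum>w\<in>\<Omega>. card (B2 w)) \<le> real (card D2 + p * card D3)"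
      using sumB2 by (rule of_nat_mono)
    ultimately show ?thesis unfolding sumS sumB1 by simp
  qed
  obtain w where w: "w \<in> \<Omega>" "(\<Sum>w\<in>\<Omega>. val w) \<le> 4 * real p ^ 2 * val w"
  proof -
    define M where "M = Max (val ` \<Omega>)"
    have ne: "\<Omega> \<noteq> {}" using c\<Omega> p0 by auto
    then have "M \<in> val ` \<Omega>" unfolding M_def using f\<Omega> by (intro Max_in) auto
    then obtain w where "w \<in> \<Omega>" "M = val w" by auto
    moreover have "(\<Sum>w\<in>\<Omega>. val w) \<le> real (card \<Omega>) * M"
      by (rule sum_bounded_above) (simp add: M_def f\<Omega>)
    ultimately show ?thesis using that by (simp add: c\<Omega>)
  qed
  \<comment> \<open>One element, the first, is removed from each bad configuration; the surplus
    \<open>val w\<close> bounds from below what is left.\<close>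
  define B where "B = S w - (fst ` B1 w \<union> fst ` B2 w)"
  have BA: "B \<subseteq> A" by (auto simp: B_def S_def)
  have fB: "finite (B1 w)" "finite (B2 w)" using fD by (auto simp: B1_def B2_def)
  have "card (S w) - card (fst ` B1 w \<union> fst ` B2 w) \<le> card B"
    unfolding B_def by (rule diff_card_le_card_Diff) (use fB in auto)
  moreover have "card (fst ` B1 w \<union> fst ` B2 w) \<le> card (B1 w) + card (B2 w)"
    by (meson add_mono card_Un_le card_image_le fB order_trans)
  ultimately have "val w \<le> real (card B)" unfolding val_def by linarith
  then have "4 * real p ^ 2 * val w \<le> 4 * real p ^ 2 * real (card B)" by (intro mult_left_mono) auto
  moreover have "sidon B"
    unfolding sidon_def
  proof (intro ballI impI)
    fix x1 x2 x3 x4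
    assume x: "x1 \<in> B" "x2 \<in> B" "x3 \<in> B" "x4 \<in> B" and eq: "x1 + x2 = x3 + x4"
    have selx: "sel w x1" "sel w x2" "sel w x3" "sel w x4" using x by (auto simp: B_def S_def)
    have key: "y1 = y3 \<or> y1 = y4" if y: "y1 \<in> B" "y2 \<in> B" "y3 \<in> B" "y4 \<in> B" "y1 + y2 = y3 + y4"
      and s: "?s y1 y3" for y1 y2 y3 y4
    proof (rule ccontr)
      assume ne: "\<not> (y1 = y3 \<or> y1 = y4)"
      have yA: "y1 \<in> A" "y2 \<in> A" "y3 \<in> A" "y4 \<in> A" using y BA by auto
      have sy: "sel w y1" "sel w y4" using y by (auto simp: B_def S_def)
      show False
      proof (cases "y1 - y3 \<in> R")
        case True
        then have "(y1, y3) \<in> B1 w" using yA ne s sy by (auto simp: B1_def D1_def close_pairs_def)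
        then have "y1 \<in> fst ` B1 w" by force
        then show False using y(1) by (simp add: B_def)
      next
        case False
        have "y4 - y1 + y3 = y2" using y(5) by simp
        then have "(y1, y4, y3) \<in> B2 w"
          using yA ne s sy False by (auto simp: B2_def D2_def quads_def)
        then have "y1 \<in> fst ` B2 w" by force
        then show False using y(1) by (simp add: B_def)
      qed
    qed
    have \<tau>eq: "\<tau> x2 = \<tau> x1" "\<tau> x3 = \<tau> x1" "\<tau> x4 = \<tau> x1" using selx by (auto simp: sel_def)
    obtain b c where bc: "snd w = (b,c)" by (cases "snd w")
    have par: "[v x = (u x)\<^sup>2 + b * u x + c] (mod int p)" if "sel w x" for x
      using that bc by (auto simp: sel_def parabolas_def)
    \<comment> \<open>Additivity on a class makes the rounded coordinates satisfy the same equation,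
      so the parabola puts \<open>x1\<close> into the cell of \<open>x3\<close> or of
      \<open>x4\<close>. By \<open>key\<close> sharing the cell forces an equality within
      \<open>B\<close>; the second case is the first with \<open>x3\<close> and \<open>x4\<close>
      exchanged.\<close>
    have "?s x1 x3 \<or> ?s x1 x4"
      using parabola_sidon[OF p par[OF selx(1)] par[OF selx(2)] par[OF selx(3)] par[OF selx(4)]]
        add[OF \<tau>eq eq] \<tau>eq unfolding same_cell_def by auto
    then have "x1 = x3 \<or> x1 = x4"
      using key[OF x eq] key[OF x(1,2,4,3)] eq by (auto simp: add.commute)
    then show "{x1, x2} = {x3, x4}" using eq by auto
  qed
  ultimately show ?thesis using BA total w(2) by (intro exI[of _ B] conjI) linarith+
qed

section \<open>Random dilations\<close>

text \<open>A small \<open>t\<close> brings all \<open>t * y\<close> into an interval where only 0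
  is a multiple of \<open>2 * pi\<close>, and each geometric sum is then bounded independently of
  \<open>N\<close>. The multiples \<open>j * t\<close> with \<open>j < N\<close> serve as a finite
  model of a random dilation.\<close>

lemma cis_sums_small:
  fixes Y :: "real set"
  assumes "finite Y" "0 \<notin> Y" "0 < \<delta>"
  shows "\<exists>(N::nat)>0. \<exists>t. \<forall>y\<in>Y. cmod (\<Sum>j<N. cis (real j * (t * y))) \<le> \<delta> * real N"
proof -
  define M where "M = 1 + (\<Sum>y\<in>Y. \<bar>y\<bar>)"
  have yM: "\<bar>y\<bar> < M" if "y \<in> Y" for y
    using member_le_sum[of y Y "\<lambda>y. \<bar>y\<bar>"] assms(1) that by (simp add: M_def)
  have M0: "0 < M" unfolding M_def by (intro add_pos_nonneg sum_nonneg) auto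
  define t where "t = 1 / M"
  have ty: "\<bar>t * y\<bar> < 1" "t * y \<noteq> 0" if "y \<in> Y" for y
    using yM[OF that] M0 that assms(2) by (auto simp: t_def abs_mult)
  define g where "g y = cmod (1 - cis (t * y))" for y
  have cis_ne: "cis (t * y) \<noteq> 1" if "y \<in> Y" for y
  proof
    assume "cis (t * y) = 1"
    then have "sin (t * y) = 0" by (simp add: complex_eq_iff)
    moreover have "- pi < t * y" "t * y < pi" using ty(1)[OF that] pi_gt3 by linarith+
    ultimately show False using ty(2)[OF that] sin_eq_0_pi by blast
  qed
  then have g0: "0 < g y" if "y \<in> Y" for y using that by (simp add: g_def)
  define N where "N = nat \<lceil>1 + (\<Sum>y\<in>Y. 2 / (\<delta> * g y))\<rceil>"
  have N1: "1 + (\<Sum>y\<in>Y. 2 / (\<delta> * g y)) \<le> real N" unfolding N_def by linarith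
  have pos: "0 \<le> 2 / (\<delta> * g y)" for y using assms(3) by (simp add: g_def)
  have "0 \<le> (\<Sum>y\<in>Y. 2 / (\<delta> * g y))" by (intro sum_nonneg pos)
  then have "0 < N" using N1 by linarith
  moreover have "cmod (\<Sum>j<N. cis (real j * (t * y))) \<le> \<delta> * real N" if "y \<in> Y" for y
  proof -
    have "2 / (\<delta> * g y) \<le> (\<Sum>y\<in>Y. 2 / (\<delta> * g y))"
      using that assms(1) pos by (intro member_le_sum) auto
    then have "2 / (\<delta> * g y) \<le> real N" using N1 by linarith
    then have "2 / g y \<le> \<delta> * real N" using g0[OF that] assms(3) by (simp add: field_simps)
    moreover have "(\<Sum>j<N. cis (real j * (t * y))) = (\<Sum>j<N. cis (t * y) ^ j)"
      by (simp add: Complex.DeMoivre)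
    moreover have "\<dots> = (1 - cis (t * y) ^ N) / (1 - cis (t * y))"
      using cis_ne[OF that] sum_gp_strict[of "cis (t * y)" N] by simp
    moreover have "cmod \<dots> \<le> 2 / g y"
    proof -
      have "cmod (1 - cis (t * y) ^ N) \<le> cmod 1 + cmod (cis (t * y) ^ N)" by (rule norm_triangle_ineq4)
      then have "cmod (1 - cis (t * y) ^ N) \<le> 2" by (simp add: norm_power)
      then show ?thesis using g0[OF that] unfolding norm_divide g_def by (intro divide_right_mono) auto
    qed
    ultimately show ?thesis by simp
  qed
  ultimately show ?thesis by blast
qed

text \<open>\<open>H\<close> times the usual Fejer kernel. It is nonnegative and has only
  frequencies below \<open>H\<close> in absolute value, so as a majorant of \<open>near\<close> it
  reduces averages to finitely many exponential sums.\<close>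

definition fejer :: "nat \<Rightarrow> real \<Rightarrow> real" where
  "fejer H x = cmod (\<Sum>j<H. cis (real j * x)) ^ 2"

text \<open>The radius is half the spacing \<open>2 * pi / p\<close> of \<open>p\<close> equal cells
  on the circle.\<close>

definition near :: "nat \<Rightarrow> real \<Rightarrow> bool" where
  "near p x \<longleftrightarrow> (\<exists>k::int. \<bar>x - 2 * pi * of_int k\<bar> < pi / real p)"

lemma fejer_nonneg [simp]: "0 \<le> fejer H x"
  by (simp add: fejer_def)

text \<open>For \<open>j < H <= p/3\<close> the angle \<open>j * x\<close> is within
  \<open>pi/3\<close> of a multiple of \<open>2 * pi\<close>, so every term of the exponential sum
  has real part at least 1/2.\<close>

lemma near_le_fejer:
  assumes "near p x" "3 * H \<le> p"
  shows "real H ^ 2 \<le> 4 * fejer H x"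
proof -
  obtain k :: int where k: "\<bar>x - 2 * pi * of_int k\<bar> < pi / real p" using assms(1) by (auto simp: near_def)
  define y where "y = x - 2 * pi * of_int k"
  have half: "1 / 2 \<le> Re (cis (real j * x))" if "j < H" for j
  proof -
    have "cos (real j * x) = cos (real j * y)"
    proof -
      have "real j * x = real j * y + 2 * pi * of_int (int j * k)" by (simp add: y_def algebra_simps)
      then show ?thesis by (intro cos_eq_periodic_intro[of _ _ "int j * k"]) (simp add: mult_ac)
    qed
    moreover have "\<bar>real j * y\<bar> \<le> pi / 3"
    proof -
      have p0: "0 < real p" using that assms(2) by auto
      have "\<bar>real j * y\<bar> = real j * \<bar>y\<bar>" by (simp add: abs_mult)
      also have "\<dots> \<le> (real p / 3) * (pi / real p)"
        using that assms(2) k by (intro mult_mono) (auto simp: y_def)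
      finally show ?thesis using p0 by simp
    qed
    moreover have "cos (pi / 3) \<le> cos \<bar>real j * y\<bar>"
      using calculation(2) by (intro cos_monotone_0_pi_le) auto
    ultimately show ?thesis by (simp add: cos_60)
  qed
  have "real H / 2 = (\<Sum>j<H. 1 / 2)" by simp
  also have "\<dots> \<le> (\<Sum>j<H. Re (cis (real j * x)))" by (intro sum_mono half) auto
  also have "\<dots> \<le> cmod (\<Sum>j<H. cis (real j * x))"
    using complex_Re_le_cmod[of "\<Sum>j<H. cis (real j * x)"] by simp
  finally have "(real H / 2) ^ 2 \<le> fejer H x" unfolding fejer_def by (rule power_mono) simp
  then show ?thesis by (simp add: power_divide)
qed

section \<open>Averages of the Fejer kernel over dilations\<close>

lemma fejer_expand:
  "complex_of_real (fejer H x) = (\<Sum>(j,k)\<in>{..<H}\<times>{..<H}. cis ((real j - real k) * x))"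
proof -
  have "complex_of_real (fejer H x) = (\<Sum>j<H. cis (real j * x)) * cnj (\<Sum>j<H. cis (real j * x))"
    unfolding fejer_def by (simp add: complex_norm_square flip: of_real_power)
  also have "\<dots> = (\<Sum>j<H. \<Sum>k<H. cis (real j * x) * cis (- (real k * x)))"
    by (simp add: cis_cnj sum_product)
  also have "\<dots> = (\<Sum>j<H. \<Sum>k<H. cis ((real j - real k) * x))"
    by (simp add: cis_mult algebra_simps)
  finally show ?thesis by (simp add: sum.cartesian_product)
qed

text \<open>Under a random dilation, \<open>z\<close> and \<open>w\<close> become correlated only through their small integer relations.\<close>
definition relations :: "nat \<Rightarrow> real \<Rightarrow> real \<Rightarrow> (int \<times> int) set" where
  "relations H z w = {(h,l). \<bar>h\<bar> < int H \<and> \<bar>l\<bar> < int H \<and> of_int h * z + of_int l * w = 0}"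

lemma finite_relations [simp]: "finite (relations H z w)"
  by (rule finite_subset[of _ "{- int H..int H} \<times> {- int H..int H}"]) (auto simp: relations_def)

lemma relations_nonempty: "0 < H \<Longrightarrow> 1 \<le> card (relations H z w)"
proof -
  assume "0 < H"
  then have "(0,0) \<in> relations H z w" by (simp add: relations_def)
  then show ?thesis by (metis One_nat_def Suc_leI card_gt_0_iff empty_iff finite_relations)
qed

text \<open>The combinations that equal 0 are the contribution of \<open>relations\<close>; they do
  not average out and are treated separately.\<close>

definition frequencies :: "nat \<Rightarrow> real \<Rightarrow> real \<Rightarrow> real set" where
  "frequencies H z w = (\<lambda>(h,l). of_int h * z + of_int l * w) ` ({- int H..int H} \<times> {- int H..int H}) - {0}"

lemma finite_frequencies [simp]: "finite (frequencies H z w)"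
  by (simp add: frequencies_def)

text \<open>The \<open>H\<close> diagonal terms contribute \<open>N\<close> each. The remaining
  ones, fewer than \<open>H^2\<close>, contribute at most \<open>N / H^2\<close> each, hence
  \<open>N\<close> in total.\<close>

lemma fejer_average1:
  assumes H: "0 < H" and z: "z \<noteq> 0"
    and small: "\<And>y. y \<in> frequencies H z w \<Longrightarrow> cmod (\<Sum>i<N. cis (real i * (t * y))) \<le> real N / real H ^ 2"
  shows "(\<Sum>i<N. fejer H (real i * t * z)) \<le> 2 * real N * real H"
proof -
  let ?J = "{..<H} \<times> {..<H}"
  let ?c = "\<lambda>(j,k). (\<Sum>i<N. cis ((real j - real k) * (real i * t * z)))"
  have "complex_of_real (\<Sum>i<N. fejer H (real i * t * z)) = (\<Sum>i<N. \<Sum>(j,k)\<in>?J. cis ((real j - real k) * (real i * t * z)))"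
    by (simp add: fejer_expand)
  also have "\<dots> = (\<Sum>q\<in>?J. ?c q)"
    by (subst sum.swap) (simp add: case_prod_unfold)
  finally have of_real_eq: "complex_of_real (\<Sum>i<N. fejer H (real i * t * z)) = (\<Sum>q\<in>?J. ?c q)" .
  have "\<bar>\<Sum>i<N. fejer H (real i * t * z)\<bar> = cmod (\<Sum>q\<in>?J. ?c q)"
    unfolding of_real_eq[symmetric] by (simp only: norm_of_real)
  also have "\<dots> \<le> (\<Sum>q\<in>?J. cmod (?c q))" by (rule norm_sum)
  also have "\<dots> \<le> (\<Sum>q\<in>?J. real N / real H ^ 2 + (if fst q = snd q then real N else 0))"
  proof (rule sum_mono)
    fix q assume q: "q \<in> ?J"
    obtain j k where jk: "q = (j,k)" by (cases q)
    show "cmod (?c q) \<le> real N / real H ^ 2 + (if fst q = snd q then real N else 0)"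
    proof (cases "j = k")
      case True then show ?thesis by (simp add: jk)
    next
      case False
      define y where "y = of_int (int j - int k) * z + of_int 0 * w"
      have "y \<in> frequencies H z w"
        unfolding frequencies_def y_def using q jk False z by (auto intro!: image_eqI[of _ _ "(int j - int k, 0)"])
      then have "cmod (\<Sum>i<N. cis (real i * (t * y))) \<le> real N / real H ^ 2" by (rule small)
      moreover have "?c q = (\<Sum>i<N. cis (real i * (t * y)))" unfolding jk prod.case
        by (intro sum.cong refl arg_cong[where f = cis]) (simp add: y_def algebra_simps)
      ultimately show ?thesis using False by (simp add: jk)
    qed
  qed
  also have "\<dots> = real N + real N * real H"
  proof -
    have "{q \<in> ?J. fst q = snd q} = (\<lambda>j. (j,j)) ` {..<H}" by auto
    then have "card {q \<in> ?J. fst q = snd q} = H" by (simp add: card_image inj_on_def)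
    then show ?thesis using H by (simp add: sum.distrib sum.If_cases Int_def power2_eq_square)
  qed
  also have "\<dots> \<le> 2 * real N * real H" using H mult_right_mono[of 1 "real H" "real N"] by (simp add: mult.commute)
  finally show ?thesis by linarith
qed

text \<open>Of the \<open>H^4\<close> terms only those with vanishing frequency survive, up to a
  total error of \<open>H^2 * N\<close>. Given \<open>j\<close> and \<open>l\<close>, the
  differences determine \<open>k\<close> and \<open>m\<close>, so a relation comes from at most
  \<open>H^2\<close> terms.\<close>

lemma fejer_average2:
  assumes H: "0 < H"
    and small: "\<And>y. y \<in> frequencies H z w \<Longrightarrow> cmod (\<Sum>i<N. cis (real i * (t * y))) \<le> real N / real H ^ 2"
  shows "(\<Sum>i<N. fejer H (real i * t * z) * fejer H (real i * t * w)) \<le> 2 * real N * real H ^ 2 * real (card (relations H z w))"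
proof -
  let ?J = "{..<H} \<times> {..<H}"
  let ?y = "\<lambda>((j,k),(l,m)). of_int (int j - int k) * z + of_int (int l - int m) * w"
  let ?c = "\<lambda>q. (\<Sum>i<N. cis (real i * (t * ?y q)))"
  let ?c' = "\<lambda>(q,r). (\<Sum>i<N. (case q of (j,k) \<Rightarrow> cis ((real j - real k) * (real i * t * z)))
          * (case r of (l,m) \<Rightarrow> cis ((real l - real m) * (real i * t * w))))"
  have "complex_of_real (\<Sum>i<N. fejer H (real i * t * z) * fejer H (real i * t * w))
      = (\<Sum>i<N. \<Sum>q\<in>?J. \<Sum>r\<in>?J. (case q of (j,k) \<Rightarrow> cis ((real j - real k) * (real i * t * z)))
          * (case r of (l,m) \<Rightarrow> cis ((real l - real m) * (real i * t * w))))"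
    by (simp only: of_real_sum of_real_mult fejer_expand sum_product)
  also have "\<dots> = (\<Sum>i<N. \<Sum>s\<in>?J\<times>?J. (case s of (q,r) \<Rightarrow> (case q of (j,k) \<Rightarrow> cis ((real j - real k) * (real i * t * z)))
          * (case r of (l,m) \<Rightarrow> cis ((real l - real m) * (real i * t * w)))))"
    by (simp only: sum.cartesian_product)
  also have "\<dots> = (\<Sum>s\<in>?J\<times>?J. ?c' s)"
    by (subst sum.swap) (simp add: case_prod_unfold)
  also have "\<dots> = (\<Sum>s\<in>?J\<times>?J. ?c s)"
  proof (rule sum.cong[OF refl])
    fix s :: "(nat \<times> nat) \<times> nat \<times> nat"
    obtain j k l m where s: "s = ((j,k),(l,m))" by (metis prod.exhaust)
    show "?c' s = ?c s"
      unfolding s prod.case cis_mult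
      by (intro sum.cong refl arg_cong[where f = cis]) (simp add: algebra_simps)
  qed
  finally have of_real_eq: "complex_of_real (\<Sum>i<N. fejer H (real i * t * z) * fejer H (real i * t * w)) = (\<Sum>s\<in>?J\<times>?J. ?c s)" .
  have "\<bar>\<Sum>i<N. fejer H (real i * t * z) * fejer H (real i * t * w)\<bar> = cmod (\<Sum>s\<in>?J\<times>?J. ?c s)"
    unfolding of_real_eq[symmetric] by (simp only: norm_of_real)
  also have "\<dots> \<le> (\<Sum>s\<in>?J\<times>?J. cmod (?c s))" by (rule norm_sum)
  also have "\<dots> \<le> (\<Sum>s\<in>?J\<times>?J. real N / real H ^ 2 + (if ?y s = 0 then real N else 0))"
  proof (rule sum_mono)
    fix s assume s: "s \<in> ?J \<times> ?J"
    show "cmod (?c s) \<le> real N / real H ^ 2 + (if ?y s = 0 then real N else 0)"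
    proof (cases "?y s = 0")
      case True
      then have "?c s = (\<Sum>i<N. cis (real i * (t * 0)))" by (simp only:)
      then have "cmod (?c s) = real N" by simp
      then show ?thesis using True by (simp only: if_True) (simp add: field_simps)
    next
      case False
      obtain j k l m where s': "s = ((j,k),(l,m))" by (metis prod.exhaust)
      have "?y s \<in> frequencies H z w"
        unfolding frequencies_def using s s' False
        by (auto intro!: image_eqI[of _ _ "(int j - int k, int l - int m)"])
      then have "cmod (?c s) \<le> real N / real H ^ 2" by (rule small)
      then show ?thesis using False by (simp only: if_False)
    qed
  qed
  also have "\<dots> = real H ^ 2 * real N + real N * real (card {s \<in> ?J \<times> ?J. ?y s = 0})"
  proof -
    have "(\<Sum>s\<in>?J\<times>?J. real N / real H ^ 2) = real H ^ 2 * real N"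
      using H by (simp add: power2_eq_square)
    moreover have "(\<Sum>s\<in>?J\<times>?J. (if ?y s = 0 then real N else 0)) = real N * real (card {s \<in> ?J \<times> ?J. ?y s = 0})"
      by (simp add: sum.If_cases Int_def)
    ultimately show ?thesis by (simp add: sum.distrib)
  qed
  also have "\<dots> \<le> real H ^ 2 * real N * real (card (relations H z w)) + real N * (real H ^ 2 * real (card (relations H z w)))"
  proof (intro add_mono mult_left_mono)
    show "real H ^ 2 * real N \<le> real H ^ 2 * real N * real (card (relations H z w))"
      using mult_left_mono[of 1 "real (card (relations H z w))" "real H ^ 2 * real N"] relations_nonempty[OF H, of z w]
      by simp
    have "card {s \<in> ?J \<times> ?J. ?y s = 0} \<le> card (({..<H} \<times> {..<H}) \<times> relations H z w)"
    proof (rule card_inj_on_le[of "\<lambda>((j,k),(l,m)). ((j,l),(int j - int k, int l - int m))"])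
      show "inj_on (\<lambda>((j,k),(l,m)). ((j,l),(int j - int k, int l - int m))) {s \<in> ?J \<times> ?J. ?y s = 0}"
        by (auto simp: inj_on_def)
      show "(\<lambda>((j,k),(l,m)). ((j,l),(int j - int k, int l - int m))) ` {s \<in> ?J \<times> ?J. ?y s = 0}
          \<subseteq> ({..<H} \<times> {..<H}) \<times> relations H z w"
        by (auto simp: relations_def)
    qed simp
    then have "real (card {s \<in> ?J \<times> ?J. ?y s = 0}) \<le> real (card (({..<H} \<times> {..<H}) \<times> relations H z w))"
      by (rule of_nat_mono)
    also have "\<dots> = real H ^ 2 * real (card (relations H z w))"
      by (simp add: card_cartesian_product power2_eq_square)
    finally show "real (card {s \<in> ?J \<times> ?J. ?y s = 0}) \<le> real H ^ 2 * real (card (relations H z w))" .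
  qed simp
  finally show ?thesis by (simp add: mult_ac)
qed

lemma near_average1:
  assumes H: "0 < H" "3 * H \<le> p" and z: "z \<noteq> 0"
    and small: "\<And>y. y \<in> frequencies H z w \<Longrightarrow> cmod (\<Sum>i<N. cis (real i * (t * y))) \<le> real N / real H ^ 2"
  shows "real (card {i\<in>{..<N}. near p (real i * t * z)}) * real H \<le> 8 * real N"
proof -
  have "real (card {i\<in>{..<N}. near p (real i * t * z)}) * real H ^ 2 = (\<Sum>i\<in>{i\<in>{..<N}. near p (real i * t * z)}. real H ^ 2)"
    by simp
  also have "\<dots> \<le> (\<Sum>i\<in>{i\<in>{..<N}. near p (real i * t * z)}. 4 * fejer H (real i * t * z))"
    by (intro sum_mono near_le_fejer) (use H in auto)
  also have "\<dots> \<le> (\<Sum>i<N. 4 * fejer H (real i * t * z))" by (intro sum_mono2) auto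
  also have "\<dots> = 4 * (\<Sum>i<N. fejer H (real i * t * z))" by (simp add: sum_distrib_left)
  also have "\<dots> \<le> 4 * (2 * real N * real H)" by (intro mult_left_mono fejer_average1[OF H(1) z small]) auto
  finally have "(real (card {i\<in>{..<N}. near p (real i * t * z)}) * real H) * real H \<le> (8 * real N) * real H"
    by (simp add: power2_eq_square mult_ac)
  then show ?thesis using H(1) by (simp only: mult_le_cancel_right_pos of_nat_0_less_iff)
qed

lemma near_average2:
  assumes H: "0 < H" "3 * H \<le> p"
    and small: "\<And>y. y \<in> frequencies H z w \<Longrightarrow> cmod (\<Sum>i<N. cis (real i * (t * y))) \<le> real N / real H ^ 2"
  shows "real (card {i\<in>{..<N}. near p (real i * t * z) \<and> near p (real i * t * w)}) * real H ^ 2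
    \<le> 32 * real N * real (card (relations H z w))"
proof -
  let ?I = "{i\<in>{..<N}. near p (real i * t * z) \<and> near p (real i * t * w)}"
  have "real (card ?I) * (real H ^ 2 * real H ^ 2) = (\<Sum>i\<in>?I. real H ^ 2 * real H ^ 2)" by simp
  also have "\<dots> \<le> (\<Sum>i\<in>?I. (4 * fejer H (real i * t * z)) * (4 * fejer H (real i * t * w)))"
    by (intro sum_mono mult_mono near_le_fejer) (use H in auto)
  also have "\<dots> \<le> (\<Sum>i<N. (4 * fejer H (real i * t * z)) * (4 * fejer H (real i * t * w)))"
    by (intro sum_mono2) auto
  also have "\<dots> = 16 * (\<Sum>i<N. fejer H (real i * t * z) * fejer H (real i * t * w))"
    by (simp add: sum_distrib_left mult_ac)
  also have "\<dots> \<le> 16 * (2 * real N * real H ^ 2 * real (card (relations H z w)))"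
    by (intro mult_left_mono fejer_average2[OF H(1) small]) auto
  finally have "(real (card ?I) * real H ^ 2) * real H ^ 2 \<le> (32 * real N * real (card (relations H z w))) * real H ^ 2"
    by (simp add: mult_ac)
  then show ?thesis using H(1) by (simp only: mult_le_cancel_right_pos of_nat_0_less_iff zero_less_power)
qed

section \<open>Degenerate quadruples\<close>

definition proportional :: "nat \<Rightarrow> ((int \<times> int) \<times> (int \<times> int)) set" where
  "proportional H = {((h,l),(h',l')). h \<noteq> 0 \<and> l \<noteq> 0 \<and> h' \<noteq> 0 \<and> l' \<noteq> 0 \<and>
     \<bar>h\<bar> < int H \<and> \<bar>l\<bar> < int H \<and> \<bar>h'\<bar> < int H \<and> \<bar>l'\<bar> < int H \<and> h * l' = h' * l}"

text \<open>Proportional pairs are multiples of a common coprime pair: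
  \<open>(h, h') = g (a, b)\<close> and \<open>(l, l') = e (a, b)\<close>, with \<open>g\<close> and
  \<open>e\<close> at most \<open>H / max a b\<close>. Since \<open>(max a b)^2 >= a b\<close>, the
  sum over \<open>a\<close> and \<open>b\<close> splits into two harmonic sums.\<close>

lemma card_proportional_nat:
  "real (card {((h,l),(h',l')). h \<in> {1..H} \<and> l \<in> {1..H} \<and> h' \<in> {1..H} \<and> l' \<in> {1..H} \<and> h * l' = h' * (l::nat)})
     \<le> real H ^ 2 * harm H ^ 2" (is "real (card ?M) \<le> _")
proof -
  let ?D = "\<lambda>(a,b). {1..H div max a b} \<times> {1..H div max a b}"
  let ?S = "SIGMA i:{1..H}\<times>{1..H}. ?D i"
  have "card ?M \<le> card ?S"
  proof (rule surj_card_le)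
    show "finite ?S" by (intro finite_SigmaI) auto
    show "?M \<subseteq> (\<lambda>((a,b),(g,e)). ((g * a, e * a), (g * b, e * b))) ` ?S"
    proof
      fix i assume "i \<in> ?M"
      then obtain h l h' l' where i: "i = ((h,l),(h',l'))" and r: "h \<in> {1..H}" "l \<in> {1..H}" "h' \<in> {1..H}" "l' \<in> {1..H}"
        and eq: "h * l' = h' * l" by auto
      define g where "g = gcd h h'"
      have g0: "0 < g" using r by (simp add: g_def)
      have "gcd h h' \<noteq> 0" using r by simp
      then obtain a b where ab: "h = a * gcd h h'" "h' = b * gcd h h'" and cop: "coprime a b"
        using gcd_coprime_exists[of h h'] by blast
      have a: "h = g * a" and b: "h' = g * b" using ab by (simp_all only: g_def mult.commute)
      have "a * l' = b * l" using eq a b g0 by (simp add: mult.assoc)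
      then have "a dvd b * l" by (metis dvd_triv_left)
      then have "a dvd l" using cop by (simp add: coprime_dvd_mult_right_iff)
      then obtain e where e: "l = e * a" by (metis dvd_def mult.commute)
      have a0: "0 < a" "0 < b" using a b r g0 by auto
      have e': "l' = e * b" using \<open>a * l' = b * l\<close> e a0 by simp
      have e0: "0 < e" using e r by auto
      have "a \<le> H"
      proof -
        have "a \<le> g * a" using g0 by simp
        also have "\<dots> \<le> H" using r a by simp
        finally show ?thesis .
      qed
      moreover have "b \<le> H"
      proof -
        have "b \<le> g * b" using g0 by simp
        also have "\<dots> \<le> H" using r b by simp
        finally show ?thesis .
      qed
      moreover have "g \<le> H div max a b"
        using a b r a0 by (simp add: less_eq_div_iff_mult_less_eq max_def)
      moreover have "e \<le> H div max a b"
        using e e' r a0 by (simp add: less_eq_div_iff_mult_less_eq max_def)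
      ultimately have "((a,b),(g,e)) \<in> ?S" using a0 g0 e0 by auto
      then show "i \<in> (\<lambda>((a,b),(g,e)). ((g * a, e * a), (g * b, e * b))) ` ?S"
        by (intro image_eqI[of _ _ "((a,b),(g,e))"]) (auto simp: i a b e e')
    qed
  qed
  also have "card ?S = (\<Sum>i\<in>{1..H}\<times>{1..H}. card (?D i))" by (rule card_SigmaI) auto
  finally have "real (card ?M) \<le> real (\<Sum>i\<in>{1..H}\<times>{1..H}. card (?D i))" by (rule of_nat_mono)
  also have "\<dots> \<le> (\<Sum>i\<in>{1..H}\<times>{1..H}. (real H / real (fst i)) * (real H / real (snd i)))"
    unfolding of_nat_sum
  proof (rule sum_mono)
    fix i assume "i \<in> {1..H} \<times> {1..H}"
    then obtain a b where i: "i = (a,b)" "1 \<le> a" "1 \<le> b" by auto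
    have "real (H div max a b) \<le> real H / real a" "real (H div max a b) \<le> real H / real b"
      using i by (auto intro!: order_trans[OF of_nat_div_le_of_nat] divide_left_mono)
    then have "real (H div max a b) * real (H div max a b) \<le> (real H / real a) * (real H / real b)"
      by (intro mult_mono) auto
    then show "real (card (?D i)) \<le> (real H / real (fst i)) * (real H / real (snd i))"
      by (simp add: i card_cartesian_product)
  qed
  also have "\<dots> = real H ^ 2 * harm H ^ 2"
  proof -
    have h: "(\<Sum>a=1..H. real H / real a) = real H * harm H"
      by (simp add: harm_def sum_distrib_left divide_inverse)
    have "(\<Sum>i\<in>{1..H}\<times>{1..H}. (real H / real (fst i)) * (real H / real (snd i)))
      = (\<Sum>a=1..H. real H / real a) * (\<Sum>b=1..H. real H / real b)"
      unfolding sum_product sum.cartesian_product by (simp add: case_prod_unfold)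
    then show ?thesis unfolding h by (simp add: power2_eq_square)
  qed
  finally show ?thesis .
qed

lemma finite_proportional [simp]: "finite (proportional H)"
  by (rule finite_subset[of _ "({-int H..int H} \<times> {-int H..int H}) \<times> ({-int H..int H} \<times> {-int H..int H})"])
     (auto simp: proportional_def)

lemma card_proportional: "real (card (proportional H)) \<le> 16 * (real H ^ 2 * harm H ^ 2)"
proof -
  let ?M = "{((h,l),(h',l')). h \<in> {1..H} \<and> l \<in> {1..H} \<and> h' \<in> {1..H} \<and> l' \<in> {1..H} \<and> h * l' = h' * (l::nat)}"
  let ?f = "\<lambda>((h,l),(h',l')). (((nat \<bar>h\<bar>, nat \<bar>l\<bar>), (nat \<bar>h'\<bar>, nat \<bar>l'\<bar>)), ((sgn h, sgn l), (sgn h', sgn l')))"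
  let ?G = "({-1,1::int} \<times> {-1,1::int}) \<times> ({-1,1::int} \<times> {-1,1::int})"
  have fM: "finite ?M"
    by (rule finite_subset[of _ "({1..H} \<times> {1..H}) \<times> ({1..H} \<times> {1..H})"]) auto
  have "card (proportional H) \<le> card (?M \<times> ?G)"
  proof (rule card_inj_on_le[of ?f])
    show "inj_on ?f (proportional H)"
    proof (rule inj_onI)
      fix x y assume eq: "?f x = ?f y"
      obtain h l h' l' where x: "x = ((h,l),(h',l'))" by (metis prod.exhaust)
      obtain k m k' m' where y: "y = ((k,m),(k',m'))" by (metis prod.exhaust)
      have s: "i = j" if "nat \<bar>i\<bar> = nat \<bar>j\<bar>" "sgn i = sgn j" for i j :: int
        using that by (auto simp: sgn_if split: if_splits)
      have "nat \<bar>h\<bar> = nat \<bar>k\<bar> \<and> sgn h = sgn k" "nat \<bar>l\<bar> = nat \<bar>m\<bar> \<and> sgn l = sgn m"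
        "nat \<bar>h'\<bar> = nat \<bar>k'\<bar> \<and> sgn h' = sgn k'" "nat \<bar>l'\<bar> = nat \<bar>m'\<bar> \<and> sgn l' = sgn m'"
        using eq unfolding x y by simp_all
      then have "h = k" "l = m" "h' = k'" "l' = m'"
        using s[of h k] s[of l m] s[of h' k'] s[of l' m'] by blast+
      then show "x = y" unfolding x y by simp
    qed
    show "?f ` proportional H \<subseteq> ?M \<times> ?G"
    proof (rule image_subsetI)
      fix x assume x': "x \<in> proportional H"
      obtain h l h' l' where x: "x = ((h,l),(h',l'))" by (metis prod.exhaust)
      have r: "h \<noteq> 0" "l \<noteq> 0" "h' \<noteq> 0" "l' \<noteq> 0" "\<bar>h\<bar> < int H" "\<bar>l\<bar> < int H" "\<bar>h'\<bar> < int H" "\<bar>l'\<bar> < int H"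
        and eq: "h * l' = h' * l" using x' by (auto simp: x proportional_def)
      have "nat \<bar>h * l'\<bar> = nat \<bar>h' * l\<bar>" using eq by simp
      then have "nat \<bar>h\<bar> * nat \<bar>l'\<bar> = nat \<bar>h'\<bar> * nat \<bar>l\<bar>" by (simp only: nat_abs_mult_distrib)
      moreover have "nat \<bar>i\<bar> \<in> {1..H}" if "i \<noteq> 0" "\<bar>i\<bar> < int H" for i using that by auto
      note this[OF r(1,5)] this[OF r(2,6)] this[OF r(3,7)] this[OF r(4,8)]
      moreover have "sgn i \<in> {-1,1}" if "i \<noteq> 0" for i :: int using that by (simp add: sgn_if)
      note this[OF r(1)] this[OF r(2)] this[OF r(3)] this[OF r(4)]
      ultimately show "?f x \<in> ?M \<times> ?G" unfolding x unfolding prod.case by (simp only: mem_Times_iff mem_Collect_eq prod.case fst_conv snd_conv)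
    qed
    show "finite (?M \<times> ?G)" using fM by simp
  qed
  also have "\<dots> = card ?M * 16" by (simp add: card_cartesian_product)
  finally have "real (card (proportional H)) \<le> real (card ?M * 16)" by (rule of_nat_mono)
  then show ?thesis using card_proportional_nat[of H] by simp
qed

text \<open>Read as \<open>b - \<alpha> a = \<beta> c\<close>, the equation counts representations
  by \<open>A\<close> and the dilate \<open>\<alpha> A\<close>, summed over the dilate
  \<open>\<beta> A\<close>.\<close>

lemma card_linear_triples:
  assumes ctrl: "controlled C A" and C: "0 \<le> C" and fA: "finite A" and "\<alpha> \<noteq> 0" "\<beta> \<noteq> 0"
  shows "real (card {(a,b,c). a \<in> A \<and> b \<in> A \<and> c \<in> A \<and> b = \<alpha> * a + \<beta> * c})
    \<le> root 3 (C * real (card A) ^ 5) * harm (card A)"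
proof -
  let ?T = "{(a,b,c). a \<in> A \<and> b \<in> A \<and> c \<in> A \<and> b = \<alpha> * a + \<beta> * c}"
  let ?B = "(*) \<alpha> ` A" and ?X = "(*) \<beta> ` A"
  have c: "card ?B = card A" "card ?X = card A" using assms(4,5) by (auto intro!: card_image simp: inj_on_def)
  have "card ?T \<le> card (SIGMA x:?X. {b\<in>?B. x + b \<in> A})"
    by (rule card_inj_on_le[of "\<lambda>(a,b,c). (\<beta> * c, \<alpha> * a)"])
       (use assms in \<open>auto simp: inj_on_def add.commute\<close>)
  also have "\<dots> = (\<Sum>x\<in>?X. rep A ?B x)" using fA by (simp add: rep_def)
  finally have "real (card ?T) \<le> real (\<Sum>x\<in>?X. rep A ?B x)" by (rule of_nat_mono)
  also have "\<dots> \<le> root 3 (C * real (card A) * real (card ?B) ^ 2 * real (card ?X) ^ 2) * harm (card A)"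
    unfolding of_nat_sum by (rule sum_rep_on_le[OF ctrl C fA]) (use fA in auto)
  also have "C * real (card A) * real (card ?B) ^ 2 * real (card ?X) ^ 2 = C * real (card A) ^ 5"
    unfolding c by (simp add: power2_eq_square numeral_eq_Suc)
  finally show ?thesis .
qed

text \<open>Solved for \<open>b\<close>, the relation is a linear equation in \<open>a\<close> and
  \<open>c\<close> with coefficients \<open>(l - h) / l\<close> and \<open>h / l\<close>, to which
  \<open>card_linear_triples\<close> applies unless the first one vanishes.\<close>

lemma card_quads_relation:
  fixes h l :: int
  assumes ctrl: "controlled C A" and C: "0 \<le> C" and fA: "finite A" and hl: "h \<noteq> 0" "l \<noteq> 0"
  shows "real (card {(a,b,c)\<in>quads R A. of_int h * (a - c) + of_int l * (b - a) = 0})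
    \<le> root 3 (C * real (card A) ^ 5) * harm (card A)"
proof -
  let ?Q = "{(a,b,c)\<in>quads R A. of_int h * (a - c) + of_int l * (b - a) = 0}"
  let ?T = "\<lambda>\<alpha> \<beta>. {(a,b,c). a \<in> A \<and> b \<in> A \<and> c \<in> A \<and> b = \<alpha> * a + \<beta> * c}"
  have fT: "finite (?T \<alpha> \<beta>)" for \<alpha> \<beta>
    by (rule finite_subset[of _ "A \<times> A \<times> A"]) (use fA in auto)
  \<comment> \<open>For \<open>l = h\<close> the relation only says \<open>b = c\<close>, and it is the fourth element \<open>2 * c - a\<close> of the quadruple
    that yields a linear equation.\<close>
  have "\<exists>\<alpha> \<beta>. \<alpha> \<noteq> 0 \<and> \<beta> \<noteq> 0 \<and> card ?Q \<le> card (?T \<alpha> \<beta>)"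
  proof (cases "l = h")
    case False
    define \<alpha> \<beta> :: real where "\<alpha> = (of_int l - of_int h) / of_int l" and "\<beta> = of_int h / of_int l"
    have "?Q \<subseteq> ?T \<alpha> \<beta>"
    proof
      fix i assume i: "i \<in> ?Q"
      obtain a b c where abc: "i = (a,b,c)" by (metis prod.exhaust)
      have mem: "a \<in> A" "b \<in> A" "c \<in> A" using i unfolding abc by (simp_all add: quads_def)
      have "of_int h * (a - c) + of_int l * (b - a) = 0" using i unfolding abc by simp
      then have e: "(of_int l - of_int h) * a + of_int h * c = of_int l * b" by (simp add: algebra_simps)
      have "\<alpha> * a + \<beta> * c = ((of_int l - of_int h) * a + of_int h * c) / of_int l"
        by (simp add: \<alpha>_def \<beta>_def add_divide_distrib)
      also have "\<dots> = b" unfolding e using hl by simp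
      finally show "i \<in> ?T \<alpha> \<beta>" using mem abc by simp
    qed
    then have "card ?Q \<le> card (?T \<alpha> \<beta>)" by (rule card_mono[OF fT])
    then show ?thesis using False hl by (intro exI[of _ \<alpha>] exI[of _ \<beta>]) (auto simp: \<alpha>_def \<beta>_def)
  next
    case True
    have bc: "b = c" if "(a,b,c) \<in> ?Q" for a b c
    proof -
      have "of_int l * (a - c) + of_int l * (b - a) = 0" using that True by simp
      then have "of_int l * (b - c) = 0" by (simp only: flip: distrib_left) simp
      then show ?thesis using hl by simp
    qed
    have "card ?Q \<le> card (?T (-1) 2)"
    proof (rule card_inj_on_le[of "\<lambda>(a,b,c). (a, b - a + c, c)"])
      show "inj_on (\<lambda>(a,b,c). (a, b - a + c, c)) ?Q" by (auto simp: inj_on_def)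
      show "(\<lambda>(a,b,c). (a, b - a + c, c)) ` ?Q \<subseteq> ?T (-1) 2"
      proof (rule image_subsetI)
        fix i assume i: "i \<in> ?Q"
        obtain a b c where abc: "i = (a,b,c)" by (metis prod.exhaust)
        then have "b = c" using bc i by blast
        moreover have "a \<in> A" "c \<in> A" "b - a + c \<in> A" using i unfolding abc by (simp_all add: quads_def)
        ultimately show "(\<lambda>(a,b,c). (a, b - a + c, c)) i \<in> ?T (-1) 2" by (simp add: abc)
      qed
    qed (rule fT)
    then show ?thesis by (intro exI[of _ "-1"] exI[of _ 2]) auto
  qed
  then obtain \<alpha> \<beta> where "\<alpha> \<noteq> 0" "\<beta> \<noteq> 0" "card ?Q \<le> card (?T \<alpha> \<beta>)" by blast
  then show ?thesis
    using card_linear_triples[OF ctrl C fA, of \<alpha> \<beta>] by linarith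
qed

text \<open>The second moment appears because two independent dilations square the probability that
  both differences are near. The trivial relation yields the main term, by
  \<open>(1 + r)^2 <= 2 + 2 r^2\<close>; the rest is a sum over
  \<open>proportional H\<close>.\<close>

lemma sum_relations_quads:
  assumes ctrl: "controlled C A" and C: "0 \<le> C" and fA: "finite A"
  shows "(\<Sum>(a,b,c)\<in>quads R A. real (card (relations H (a - c) (b - a))) ^ 2)
    \<le> 2 * real (card (quads R A)) + 32 * real H ^ 2 * harm H ^ 2 * (root 3 (C * real (card A) ^ 5) * harm (card A))"
proof -
  define Q where "Q = quads R A"
  define T where "T = root 3 (C * real (card A) ^ 5) * harm (card A)"
  have fQ: "finite Q" by (simp add: Q_def fA)
  define hit where "hit r i = (case r of ((h,l),(h',l')) \<Rightarrow> case i of (a,b,c) \<Rightarrow> of_int h * (a - c) + of_int l * (b - a) = (0::real))"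
    for r :: "(int \<times> int) \<times> (int \<times> int)" and i
  \<comment> \<open>The square counts pairs of relations, and two relations between the same nonzero reals are
    proportional.\<close>
  have "(\<Sum>(a,b,c)\<in>Q. real (card (relations H (a - c) (b - a))) ^ 2) \<le> (\<Sum>i\<in>Q. 2 + 2 * real (card {r\<in>proportional H. hit r i}))"
  proof (rule sum_mono)
    fix i assume i: "i \<in> Q"
    obtain a b c where abc: "i = (a,b,c)" by (metis prod.exhaust)
    have ne: "a - c \<noteq> 0" "b - a \<noteq> 0" using i abc by (auto simp: Q_def quads_def)
    let ?r = "relations H (a - c) (b - a)"
    define r' where "r' = ?r - {(0,0)}"
    have nz: "h \<noteq> 0" "l \<noteq> 0" if "(h,l) \<in> r'" for h l
      using that ne by (auto simp: r'_def relations_def)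
    have "r' \<times> r' \<subseteq> {r\<in>proportional H. hit r i}"
    proof clarify
      fix h l h' l' assume r: "(h,l) \<in> r'" "(h',l') \<in> r'"
      have e: "of_int h * (a - c) + of_int l * (b - a) = 0" "of_int h' * (a - c) + of_int l' * (b - a) = 0"
        using r by (auto simp: r'_def relations_def)
      have "of_int (h * l' - h' * l) * (a - c) = of_int l' * (of_int h * (a - c) + of_int l * (b - a)) - of_int l * (of_int h' * (a - c) + of_int l' * (b - a))"
        by (simp add: algebra_simps)
      then have "of_int (h * l' - h' * l) * (a - c) = 0" unfolding e by simp
      then have "of_int (h * l' - h' * l) = (0::real)" using ne by simp
      then have "h * l' = h' * l" by (metis eq_iff_diff_eq_0 of_int_eq_0_iff)
      then show "((h,l),(h',l')) \<in> proportional H \<and> hit ((h,l),(h',l')) i"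
        using r nz[OF r(1)] nz[OF r(2)] e by (auto simp: proportional_def hit_def abc r'_def relations_def)
    qed
    then have "card (r' \<times> r') \<le> card {r\<in>proportional H. hit r i}" by (intro card_mono) auto
    then have "card r' ^ 2 \<le> card {r\<in>proportional H. hit r i}" by (simp add: card_cartesian_product power2_eq_square)
    then have "real (card r' ^ 2) \<le> real (card {r\<in>proportional H. hit r i})" by (rule of_nat_mono)
    then have c': "real (card r') ^ 2 \<le> real (card {r\<in>proportional H. hit r i})" by simp
    have "card ?r \<le> card (insert (0,0) r')" unfolding r'_def by (rule card_mono) auto
    also have "\<dots> \<le> card r' + 1" using card_insert_le_m1[of "card r' + 1" r' "(0,0)"] by simp
    finally have "real (card ?r) \<le> real (card r') + 1" by linarith
    then have "real (card ?r) ^ 2 \<le> (real (card r') + 1) ^ 2" by (intro power_mono) auto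
    also have "\<dots> \<le> 2 + 2 * real (card r') ^ 2"
      using zero_le_power2[of "real (card r') - 1"] by (simp add: power2_eq_square algebra_simps)
    also have "\<dots> \<le> 2 + 2 * real (card {r\<in>proportional H. hit r i})" by (intro add_left_mono mult_left_mono c') simp
    finally show "(case i of (a,b,c) \<Rightarrow> real (card (relations H (a - c) (b - a))) ^ 2) \<le> 2 + 2 * real (card {r\<in>proportional H. hit r i})"
      by (simp only: abc prod.case)
  qed
  also have "\<dots> = 2 * real (card Q) + 2 * real (\<Sum>i\<in>Q. card {r\<in>proportional H. hit r i})"
    by (simp add: sum.distrib sum_distrib_left)
  also have "(\<Sum>i\<in>Q. card {r\<in>proportional H. hit r i}) = (\<Sum>r\<in>proportional H. card {i\<in>Q. hit r i})"
    by (rule sum_card_swap) (use fQ in auto)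
  also have "real \<dots> \<le> real (card (proportional H)) * T"
    unfolding of_nat_sum
  proof (rule sum_bounded_above)
    fix r assume r: "r \<in> proportional H"
    obtain h l h' l' where hl: "r = ((h,l),(h',l'))" by (metis prod.exhaust)
    have "h \<noteq> 0" "l \<noteq> 0" using r by (auto simp: hl proportional_def)
    then have "real (card {(a,b,c)\<in>quads R A. of_int h * (a - c) + of_int l * (b - a) = 0}) \<le> T"
      unfolding T_def by (rule card_quads_relation[OF ctrl C fA])
    moreover have "{i\<in>Q. hit r i} = {(a,b,c)\<in>quads R A. of_int h * (a - c) + of_int l * (b - a) = 0}"
      by (auto simp: hit_def hl Q_def)
    ultimately show "real (card {i\<in>Q. hit r i}) \<le> T" by simp
  qed
  also have "real (card (proportional H)) * T \<le> (16 * (real H ^ 2 * harm H ^ 2)) * T"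
    by (rule mult_right_mono[OF card_proportional]) (use C in \<open>simp add: T_def harm_nonneg\<close>)
  finally show ?thesis by (simp add: Q_def T_def)
qed

section \<open>Sidon subsets from a suitable prime\<close>

text \<open>Rounding is additive on reals with equal \<open>half_bit\<close>: after adding a half to those whose fractional
  part is at least a half, all fractional parts are below a half.\<close>
definition half_bit :: "real \<Rightarrow> nat" where
  "half_bit y = (if frac y < 1/2 then 0 else 1)"

definition half_cell :: "real \<Rightarrow> int" where
  "half_cell y = \<lfloor>y + real (half_bit y) / 2\<rfloor>"

lemma half_bit_le: "half_bit y \<le> 1"
  by (simp add: half_bit_def)

lemma half_cell_bounds:
  "0 \<le> y + real (half_bit y) / 2 - of_int (half_cell y)" "y + real (half_bit y) / 2 - of_int (half_cell y) < 1/2"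
proof -
  have "0 \<le> y + real (half_bit y) / 2 - of_int (half_cell y) \<and> y + real (half_bit y) / 2 - of_int (half_cell y) < 1/2"
  proof (cases "frac y < 1/2")
    case True
    then have "half_cell y = \<lfloor>y\<rfloor>" "half_bit y = 0" by (simp_all add: half_cell_def half_bit_def)
    then show ?thesis using True by (simp add: frac_def)
  next
    case False
    then have b: "half_bit y = 1" by (simp add: half_bit_def)
    have "\<lfloor>y + 1/2\<rfloor> = \<lfloor>y\<rfloor> + 1"
      by (rule floor_unique) (use False frac_lt_1[of y] in \<open>simp_all add: frac_def\<close>)
    then have "half_cell y = \<lfloor>y\<rfloor> + 1" by (simp add: half_cell_def b)
    then show ?thesis using False frac_lt_1[of y] by (simp add: b frac_def)
  qed
  then show "0 \<le> y + real (half_bit y) / 2 - of_int (half_cell y)" "y + real (half_bit y) / 2 - of_int (half_cell y) < 1/2"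
    by auto
qed

text \<open>The equal half bits cancel and each rounding error lies in [0, 1/2), so the two sides
  differ by an integer of absolute value below 1.\<close>

lemma half_cell_add:
  assumes "half_bit y2 = half_bit y1" "half_bit y3 = half_bit y1" "half_bit y4 = half_bit y1" "y1 + y2 = y3 + y4"
  shows "half_cell y1 + half_cell y2 = half_cell y3 + half_cell y4"
proof -
  define d where "d = half_cell y1 + half_cell y2 - half_cell y3 - half_cell y4"
  have "\<bar>of_int d\<bar> < (1::real)"
    using half_cell_bounds[of y1] half_cell_bounds[of y2] half_cell_bounds[of y3] half_cell_bounds[of y4] assms
    unfolding d_def by (simp add: abs_less_iff)
  then have "\<bar>d\<bar> < 1" by linarith
  then show ?thesis by (simp add: d_def)
qed

text \<open>Equal half bits keep the two rounding errors less than 1/2 apart, and one unit on the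
  scale of length \<open>p\<close> is an angle of \<open>2 * pi / p\<close>.\<close>

lemma half_cell_cong_near:
  assumes p: "0 < p" and "half_bit (real p * x / (2 * pi)) = half_bit (real p * x' / (2 * pi))"
    and "[half_cell (real p * x / (2 * pi)) = half_cell (real p * x' / (2 * pi))] (mod int p)"
  shows "near p (x - x')"
proof -
  define y y' where "y = real p * x / (2 * pi)" and "y' = real p * x' / (2 * pi)"
  obtain k where k: "half_cell y - half_cell y' = int p * k"
    using assms(3) by (auto simp: cong_iff_dvd_diff y_def y'_def elim: dvdE)
  have "of_int (half_cell y) - of_int (half_cell y') = real p * of_int k"
    using k by (metis of_int_diff of_int_mult of_int_of_nat_eq)
  moreover have "half_bit y = half_bit y'" using assms(2) by (simp add: y_def y'_def)
  ultimately have "y - y' - real p * of_int k < 1/2" "- (y - y' - real p * of_int k) < 1/2"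
    using half_cell_bounds[of y] half_cell_bounds[of y'] by linarith+
  then have "\<bar>y - y' - real p * of_int k\<bar> < 1/2" by (simp only: abs_less_iff)
  then have lt: "\<bar>y - y' - real p * of_int k\<bar> * (2 * pi / real p) < 1/2 * (2 * pi / real p)"
    using p by (intro mult_strict_right_mono) auto
  have eq1: "\<bar>y - y' - real p * of_int k\<bar> * (2 * pi / real p) = \<bar>(y - y' - real p * of_int k) * (2 * pi / real p)\<bar>"
    using p by (simp add: abs_mult)
  have eq2: "(y - y' - real p * of_int k) * (2 * pi / real p) = x - x' - 2 * pi * of_int k"
    using p by (simp add: y_def y'_def field_simps)
  have "\<bar>x - x' - 2 * pi * of_int k\<bar> < pi / real p"
    using lt unfolding eq1 eq2 by simp
  then show ?thesis unfolding near_def by blast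
qed

lemma card_square_pairs:
  assumes "finite I"
  shows "card {(i,j). i \<in> I \<and> j \<in> I \<and> P i \<and> P j} = card {i\<in>I. P i} ^ 2"
proof -
  have "{(i,j). i \<in> I \<and> j \<in> I \<and> P i \<and> P j} = {i\<in>I. P i} \<times> {i\<in>I. P i}" by auto
  then show ?thesis by (simp add: card_cartesian_product power2_eq_square)
qed

text \<open>Averaging over dilations by \<open>i * t\<close> and \<open>j * t\<close> with
  independent \<open>i, j < N\<close>, so the proportions of \<open>near_average1\<close> and
  \<open>near_average2\<close> are squared: \<open>64 = 8^2\<close> and \<open>1024 = 32^2\<close>.
  The three counts are weighted as in \<open>sidon_from_cells\<close>, divided by
  \<open>p\<close>.\<close>

lemma exists_good_frequencies:
  assumes fA: "finite A" and H: "0 < H" "3 * H \<le> p" and p0: "0 < p"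
  defines "near2 \<equiv> \<lambda>\<theta>1 \<theta>2 z. near p (\<theta>1 * z) \<and> near p (\<theta>2 * z)"
  shows "\<exists>\<theta>1 \<theta>2.
    real (card {(a,c)\<in>close_pairs R A. near2 \<theta>1 \<theta>2 (a - c)})
    + real (card {(a,b,c)\<in>quads R A. near2 \<theta>1 \<theta>2 (a - c)}) / real p
    + real (card {(a,b,c)\<in>quads R A. near2 \<theta>1 \<theta>2 (a - c) \<and> near2 \<theta>1 \<theta>2 (b - a)})
    \<le> 64 * real (card (close_pairs R A)) / real H ^ 2 + 64 * real (card (quads R A)) / (real H ^ 2 * real p)
      + 1024 / real H ^ 4 * (\<Sum>(a,b,c)\<in>quads R A. real (card (relations H (a - c) (b - a))) ^ 2)"
proof -
  \<comment> \<open>All frequencies of all pairs of differences are collected so that one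
    \<open>t\<close> and one \<open>N\<close> serve every quadruple.\<close>
  define FR where "FR = (\<Union>z\<in>dif A A. \<Union>w\<in>dif A A. frequencies H z w)"
  have "finite FR" unfolding FR_def using fA by (intro finite_UN_I) auto
  moreover have "0 \<notin> FR" by (auto simp: FR_def frequencies_def)
  ultimately obtain N :: nat and t where N0: "0 < N"
    and small: "\<And>y. y \<in> FR \<Longrightarrow> cmod (\<Sum>i<N. cis (real i * (t * y))) \<le> 1 / real H ^ 2 * real N"
    using cis_sums_small[of FR "1 / real H ^ 2"] H by auto
  have small': "cmod (\<Sum>i<N. cis (real i * (t * y))) \<le> real N / real H ^ 2"
    if "y \<in> frequencies H z w" "z \<in> dif A A" "w \<in> dif A A" for y z w
    using small[of y] that by (auto simp: FR_def)
  define I where "I = {..<N}"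
  have fI: "finite I" by (simp add: I_def)
  define nr where "nr i z = near p (real i * t * z)" for i z
  define X where "X = close_pairs R A"
  define Q where "Q = quads R A"
  have fX: "finite X" and fQ: "finite Q" using fA by (auto simp: X_def Q_def)
  have memdif: "a - c \<in> dif A A" if "a \<in> A" "c \<in> A" for a c using that by (intro dif_memI[of _ c]) auto
  have one: "real (card {i\<in>I. nr i z}) ^ 2 \<le> 64 * real N ^ 2 / real H ^ 2" if "z \<noteq> 0" "z \<in> dif A A" for z
  proof -
    have "real (card {i\<in>I. nr i z}) * real H \<le> 8 * real N"
      unfolding I_def nr_def by (rule near_average1[OF H that(1) small'[OF _ that(2,2)]])
    then have "real (card {i\<in>I. nr i z}) \<le> 8 * real N / real H" using H by (simp add: pos_le_divide_eq)
    then have "real (card {i\<in>I. nr i z}) ^ 2 \<le> (8 * real N / real H) ^ 2" by (intro power_mono) auto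
    then show ?thesis by (simp add: power_divide power_mult_distrib)
  qed
  have two: "real (card {i\<in>I. nr i z \<and> nr i w}) ^ 2 \<le> 1024 * real N ^ 2 / real H ^ 4 * real (card (relations H z w)) ^ 2"
    if "z \<in> dif A A" "w \<in> dif A A" for z w
  proof -
    have "real (card {i\<in>I. nr i z \<and> nr i w}) * real H ^ 2 \<le> 32 * real N * real (card (relations H z w))"
      unfolding I_def nr_def by (rule near_average2[OF H small'[OF _ that]])
    then have "real (card {i\<in>I. nr i z \<and> nr i w}) \<le> 32 * real N * real (card (relations H z w)) / real H ^ 2"
      using H by (simp add: pos_le_divide_eq)
    then have "real (card {i\<in>I. nr i z \<and> nr i w}) ^ 2 \<le> (32 * real N * real (card (relations H z w)) / real H ^ 2) ^ 2"
      by (intro power_mono) auto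
    also have "\<dots> = 1024 * real N ^ 2 / real H ^ 4 * real (card (relations H z w)) ^ 2"
      by (simp add: power_divide power_mult_distrib flip: power_mult)
    finally show ?thesis .
  qed
  define K where "K = I \<times> I"
  have fK: "finite K" and cK: "card K = N ^ 2"
    by (simp_all add: K_def I_def card_cartesian_product power2_eq_square)
  define near_pair where "near_pair k z \<longleftrightarrow> nr (fst k) z \<and> nr (snd k) z" for k z
  have count: "card {k\<in>K. near_pair k z} = card {i\<in>I. nr i z} ^ 2" for z
    using card_square_pairs[OF fI, of "\<lambda>i. nr i z"]
    by (simp add: K_def near_pair_def case_prod_unfold mem_Times_iff conj_ac)
  have count2: "card {k\<in>K. near_pair k z \<and> near_pair k w} = card {i\<in>I. nr i z \<and> nr i w} ^ 2" for z w
    using card_square_pairs[OF fI, of "\<lambda>i. nr i z \<and> nr i w"]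
    by (simp add: K_def near_pair_def case_prod_unfold mem_Times_iff conj_ac)
  define c1 where "c1 k = card {x\<in>X. near_pair k (fst x - snd x)}" for k
  define c2 where "c2 k = card {x\<in>Q. near_pair k (fst x - snd (snd x))}" for k
  define c3 where "c3 k = card {x\<in>Q. near_pair k (fst x - snd (snd x)) \<and> near_pair k (fst (snd x) - fst x)}" for k
  have s1: "real (\<Sum>k\<in>K. c1 k) \<le> real (card X) * (64 * real N ^ 2 / real H ^ 2)"
    unfolding c1_def sum_card_swap[OF fK fX] count of_nat_sum of_nat_power
    by (rule sum_bounded_above, rule one) (auto simp: X_def close_pairs_def memdif)
  have s2: "real (\<Sum>k\<in>K. c2 k) \<le> real (card Q) * (64 * real N ^ 2 / real H ^ 2)"
    unfolding c2_def sum_card_swap[OF fK fQ] count of_nat_sum of_nat_power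
    by (rule sum_bounded_above, rule one) (auto simp: Q_def quads_def memdif)
  define S where "S = (\<Sum>(a,b,c)\<in>Q. real (card (relations H (a - c) (b - a))) ^ 2)"
  have s3: "real (\<Sum>k\<in>K. c3 k) \<le> 1024 * real N ^ 2 / real H ^ 4 * S"
    unfolding c3_def sum_card_swap[OF fK fQ] count2 of_nat_sum of_nat_power S_def sum_distrib_left
  proof (rule sum_mono)
    fix x assume x: "x \<in> Q"
    obtain a b c where abc: "x = (a,b,c)" by (metis prod.exhaust)
    have "a - c \<in> dif A A" "b - a \<in> dif A A" using x memdif by (auto simp: abc Q_def quads_def)
    from two[OF this] show "real (card {i \<in> I. nr i (fst x - snd (snd x)) \<and> nr i (fst (snd x) - fst x)}) ^ 2
        \<le> 1024 * real N ^ 2 / real H ^ 4 * (case x of (a,b,c) \<Rightarrow> real (card (relations H (a - c) (b - a))) ^ 2)"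
      by (simp add: abc)
  qed
  define cost where "cost k = real (c1 k) + real (c2 k) / real p + real (c3 k)" for k
  define bound where "bound = 64 * real (card X) / real H ^ 2 + 64 * real (card Q) / (real H ^ 2 * real p) + 1024 / real H ^ 4 * S"
  have "(\<Sum>k\<in>K. cost k) = real (\<Sum>k\<in>K. c1 k) + real (\<Sum>k\<in>K. c2 k) / real p + real (\<Sum>k\<in>K. c3 k)"
    by (simp add: cost_def sum.distrib sum_divide_distrib)
  also have "\<dots> \<le> real (card X) * (64 * real N ^ 2 / real H ^ 2) + real (card Q) * (64 * real N ^ 2 / real H ^ 2) / real p
      + 1024 * real N ^ 2 / real H ^ 4 * S"
    by (intro add_mono s1 s2 s3 divide_right_mono) auto
  also have "\<dots> = real (card K) * bound"
    unfolding bound_def cK using H p0 by (simp add: field_simps)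
  finally have sum_le: "(\<Sum>k\<in>K. cost k) \<le> real (card K) * bound" .
  have "\<exists>k\<in>K. cost k \<le> bound"
  proof (rule ccontr)
    assume "\<not> ?thesis"
    then have "(\<Sum>k\<in>K. bound) < (\<Sum>k\<in>K. cost k)"
      using fK cK N0 by (intro sum_strict_mono) auto
    then show False using sum_le by simp
  qed
  then obtain k where "cost k \<le> bound" by blast
  moreover have "{(a,c)\<in>close_pairs R A. near2 (real (fst k) * t) (real (snd k) * t) (a - c)} = {x\<in>X. near_pair k (fst x - snd x)}"
    by (auto simp: X_def near2_def near_pair_def nr_def)
  moreover have "{(a,b,c)\<in>quads R A. near2 (real (fst k) * t) (real (snd k) * t) (a - c)} = {x\<in>Q. near_pair k (fst x - snd (snd x))}"
    by (auto simp: Q_def near2_def near_pair_def nr_def)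
  moreover have "{(a,b,c)\<in>quads R A. near2 (real (fst k) * t) (real (snd k) * t) (a - c) \<and> near2 (real (fst k) * t) (real (snd k) * t) (b - a)}
      = {x\<in>Q. near_pair k (fst x - snd (snd x)) \<and> near_pair k (fst (snd x) - fst x)}"
    by (auto simp: Q_def near2_def near_pair_def nr_def)
  ultimately show ?thesis
    by (intro exI[of _ "real (fst k) * t"] exI[of _ "real (snd k) * t"])
       (simp add: cost_def bound_def c1_def c2_def c3_def X_def Q_def S_def)
qed

lemma sidon_subset_of_prime:
  assumes ctrl: "controlled C A" and C: "0 \<le> C" and fA: "finite A" and p: "prime p" "2 < p"
    and bound: "2304 * real (card (close_pairs R A)) / real p ^ 2 + 2304 * real (card (quads R A)) / real p ^ 3
      + 1327104 / real p ^ 4 * (2 * real (card (quads R A))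
          + 32 * real p ^ 2 * harm p ^ 2 * (root 3 (C * real (card A) ^ 5) * harm (card A))) \<le> real (card A) / 2"
  shows "\<exists>B\<subseteq>A. sidon B \<and> real (card A) \<le> 8 * real p * real (card B)"
proof -
  define H where "H = p div 3"
  have H: "0 < H" "3 * H \<le> p" "p \<le> 6 * H" "H \<le> p" using p(2) unfolding H_def by presburger+
  have p0: "0 < p" using p by simp
  let ?n = "real (card A)"
  define X Q where "X = real (card (close_pairs R A))" and "Q = real (card (quads R A))"
  define S where "S = (\<Sum>(a,b,c)\<in>quads R A. real (card (relations H (a - c) (b - a))) ^ 2)"
  define T where "T = root 3 (C * ?n ^ 5) * harm (card A)"
  have T0: "0 \<le> T" using C by (simp add: T_def harm_nonneg)
  have S: "S \<le> 2 * Q + 32 * real p ^ 2 * harm p ^ 2 * T"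
  proof -
    have "S \<le> 2 * Q + 32 * real H ^ 2 * harm H ^ 2 * T"
      unfolding S_def Q_def T_def by (rule sum_relations_quads[OF ctrl C fA])
    also have "\<dots> \<le> 2 * Q + 32 * real p ^ 2 * harm p ^ 2 * T"
      using H(4) T0 by (intro add_left_mono mult_right_mono mult_mono power_mono harm_mono) (auto simp: harm_nonneg)
    finally show ?thesis .
  qed
  have S0: "0 \<le> S" unfolding S_def by (intro sum_nonneg) auto
  have inv2: "1 / real H ^ 2 \<le> 36 / real p ^ 2"
  proof -
    have "real p ^ 2 \<le> (6 * real H) ^ 2" using H(3) by (intro power_mono) auto
    then show ?thesis using H(1) p0 by (simp add: field_simps)
  qed
  have inv4: "1 / real H ^ 4 \<le> 1296 / real p ^ 4"
  proof -
    have "real p ^ 4 \<le> (6 * real H) ^ 4" using H(3) by (intro power_mono) auto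
    then show ?thesis using H(1) p0 by (simp add: field_simps)
  qed
  let ?near2 = "\<lambda>\<theta>1 \<theta>2 z. near p (\<theta>1 * z) \<and> near p (\<theta>2 * z)"
  obtain \<theta>1 \<theta>2 where \<theta>: "real (card {(a,c)\<in>close_pairs R A. ?near2 \<theta>1 \<theta>2 (a - c)})
    + real (card {(a,b,c)\<in>quads R A. ?near2 \<theta>1 \<theta>2 (a - c)}) / real p
    + real (card {(a,b,c)\<in>quads R A. ?near2 \<theta>1 \<theta>2 (a - c) \<and> ?near2 \<theta>1 \<theta>2 (b - a)})
    \<le> 64 * X / real H ^ 2 + 64 * Q / (real H ^ 2 * real p) + 1024 / real H ^ 4 * S"
    using exists_good_frequencies[OF fA H(1,2) p0, of R] unfolding X_def Q_def S_def by blast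
  also have "\<dots> = 64 * X * (1 / real H ^ 2) + 64 * Q / real p * (1 / real H ^ 2) + 1024 * S * (1 / real H ^ 4)"
    by simp
  also have "\<dots> \<le> 64 * X * (36 / real p ^ 2) + 64 * Q / real p * (36 / real p ^ 2) + 1024 * S * (1296 / real p ^ 4)"
    by (intro add_mono mult_left_mono inv2 inv4) (auto simp: X_def Q_def S0)
  also have "\<dots> \<le> 64 * X * (36 / real p ^ 2) + 64 * Q / real p * (36 / real p ^ 2)
      + 1024 * (2 * Q + 32 * real p ^ 2 * harm p ^ 2 * T) * (1296 / real p ^ 4)"
    by (intro add_mono mult_right_mono mult_left_mono S) auto
  also have "\<dots> = 2304 * X / real p ^ 2 + 2304 * Q / real p ^ 3 + 1327104 / real p ^ 4 * (2 * Q + 32 * real p ^ 2 * harm p ^ 2 * T)"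
    by (simp add: power2_eq_square power3_eq_cube)
  also have "\<dots> \<le> ?n / 2" using bound unfolding X_def Q_def T_def .
  finally have cost: "real (card {(a,c)\<in>close_pairs R A. ?near2 \<theta>1 \<theta>2 (a - c)})
    + real (card {(a,b,c)\<in>quads R A. ?near2 \<theta>1 \<theta>2 (a - c)}) / real p
    + real (card {(a,b,c)\<in>quads R A. ?near2 \<theta>1 \<theta>2 (a - c) \<and> ?near2 \<theta>1 \<theta>2 (b - a)}) \<le> ?n / 2" .
  \<comment> \<open>The circle is rescaled to length \<open>p\<close>: cells become unit intervals,
    and going round the circle becomes congruence modulo \<open>p\<close>.\<close>
  define Y where "Y \<theta> x = real p * (\<theta> * x) / (2 * pi)" for \<theta> x
  define u v where "u x = half_cell (Y \<theta>1 x)" and "v x = half_cell (Y \<theta>2 x)" for x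
  define \<tau> where "\<tau> x = half_bit (Y \<theta>1 x) + 2 * half_bit (Y \<theta>2 x)" for x
  have \<tau>4: "\<tau> x < 4" for x using half_bit_le[of "Y \<theta>1 x"] half_bit_le[of "Y \<theta>2 x"] by (simp add: \<tau>_def)
  have \<tau>eq: "half_bit (Y \<theta>1 x) = half_bit (Y \<theta>1 y) \<and> half_bit (Y \<theta>2 x) = half_bit (Y \<theta>2 y)" if "\<tau> x = \<tau> y" for x y
    using that half_bit_le[of "Y \<theta>1 x"] half_bit_le[of "Y \<theta>2 x"] half_bit_le[of "Y \<theta>1 y"] half_bit_le[of "Y \<theta>2 y"]
    unfolding \<tau>_def by presburger
  have Yadd: "Y \<theta> x1 + Y \<theta> x2 = Y \<theta> x3 + Y \<theta> x4" if "x1 + x2 = x3 + x4" for \<theta> x1 x2 x3 x4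
  proof -
    have "Y \<theta> x1 + Y \<theta> x2 = real p * (\<theta> * (x1 + x2)) / (2 * pi)" by (simp add: Y_def algebra_simps add_divide_distrib)
    also have "\<dots> = Y \<theta> x3 + Y \<theta> x4" unfolding that by (simp add: Y_def algebra_simps add_divide_distrib)
    finally show ?thesis .
  qed
  have add: "u x1 + u x2 = u x3 + u x4 \<and> v x1 + v x2 = v x3 + v x4"
    if "\<tau> x2 = \<tau> x1" "\<tau> x3 = \<tau> x1" "\<tau> x4 = \<tau> x1" "x1 + x2 = x3 + x4" for x1 x2 x3 x4
    unfolding u_def v_def using \<tau>eq[OF that(1)] \<tau>eq[OF that(2)] \<tau>eq[OF that(3)]
    by (intro conjI half_cell_add Yadd that(4)) auto
  have near: "?near2 \<theta>1 \<theta>2 (x - y)" if "same_cell p \<tau> u v x y" for x y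
  proof -
    have c: "\<tau> x = \<tau> y" "[u x = u y] (mod int p)" "[v x = v y] (mod int p)" using that by (auto simp: same_cell_def)
    have "near p (\<theta>1 * x - \<theta>1 * y)" "near p (\<theta>2 * x - \<theta>2 * y)"
      using \<tau>eq[OF c(1)] c(2,3) by (auto intro!: half_cell_cong_near p0 simp: u_def v_def Y_def)
    then show ?thesis by (simp add: right_diff_distrib)
  qed
  have near': "?near2 \<theta>1 \<theta>2 (y - x)" if "same_cell p \<tau> u v x y" for x y
    using near[of y x] that by (simp add: same_cell_def cong_sym_eq)
  have "\<exists>B\<subseteq>A. sidon B \<and> real p * ?n \<le> 4 * real p ^ 2 * real (card B)
      + real p * real (card {(a,c)\<in>close_pairs R A. same_cell p \<tau> u v a c})
      + real (card {(a,b,c)\<in>quads R A. same_cell p \<tau> u v a c})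
      + real p * real (card {(a,b,c)\<in>quads R A. same_cell p \<tau> u v a c \<and> same_cell p \<tau> u v a b})"
    by (rule sidon_from_cells[OF fA p \<tau>4 add])
  then obtain B where B: "B \<subseteq> A" "sidon B"
    and total: "real p * ?n \<le> 4 * real p ^ 2 * real (card B)
      + real p * real (card {(a,c)\<in>close_pairs R A. same_cell p \<tau> u v a c})
      + real (card {(a,b,c)\<in>quads R A. same_cell p \<tau> u v a c})
      + real p * real (card {(a,b,c)\<in>quads R A. same_cell p \<tau> u v a c \<and> same_cell p \<tau> u v a b})"
    by (elim exE conjE)
  have le1: "card {(a,c)\<in>close_pairs R A. same_cell p \<tau> u v a c} \<le> card {(a,c)\<in>close_pairs R A. ?near2 \<theta>1 \<theta>2 (a - c)}"
    by (intro card_mono finite_subset[OF _ finite_close_pairs[OF fA, of R]]) (use near in auto)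
  have le2: "card {(a,b,c)\<in>quads R A. same_cell p \<tau> u v a c} \<le> card {(a,b,c)\<in>quads R A. ?near2 \<theta>1 \<theta>2 (a - c)}"
    by (intro card_mono finite_subset[OF _ finite_quads[OF fA, of R]]) (use near in auto)
  have le3: "card {(a,b,c)\<in>quads R A. same_cell p \<tau> u v a c \<and> same_cell p \<tau> u v a b}
      \<le> card {(a,b,c)\<in>quads R A. ?near2 \<theta>1 \<theta>2 (a - c) \<and> ?near2 \<theta>1 \<theta>2 (b - a)}"
    by (intro card_mono finite_subset[OF _ finite_quads[OF fA, of R]]) (use near near' in auto)
  let ?c1 = "real (card {(a,c)\<in>close_pairs R A. ?near2 \<theta>1 \<theta>2 (a - c)})"
  let ?c2 = "real (card {(a,b,c)\<in>quads R A. ?near2 \<theta>1 \<theta>2 (a - c)})"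
  let ?c3 = "real (card {(a,b,c)\<in>quads R A. ?near2 \<theta>1 \<theta>2 (a - c) \<and> ?near2 \<theta>1 \<theta>2 (b - a)})"
  have "real p * ?n \<le> 4 * real p ^ 2 * real (card B) + real p * ?c1 + ?c2 + real p * ?c3"
    by (rule order_trans[OF total]) (intro add_mono mult_left_mono of_nat_mono le1 le2 le3 order_refl, auto)
  also have "\<dots> = 4 * real p ^ 2 * real (card B) + real p * (?c1 + ?c2 / real p + ?c3)"
    using p0 by (simp add: distrib_left)
  also have "\<dots> \<le> 4 * real p ^ 2 * real (card B) + real p * (?n / 2)"
    by (intro add_left_mono mult_left_mono cost) auto
  finally have "real p * (?n / 2) \<le> real p * (4 * real p * real (card B))"
    by (simp add: power2_eq_square mult_ac)
  then have "?n / 2 \<le> 4 * real p * real (card B)" using p0 by simp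
  then show ?thesis using B by (intro exI[of _ B]) auto
qed

section \<open>Primes in short windows\<close>

text \<open>The induction runs along the recurrence
  \<open>1/((n+1) C(n,k+1)) = 1/(n C(n-1,k)) - 1/((n+1) C(n,k))\<close> of Leibniz' harmonic triangle.\<close>
lemma Suc_mult_choose_dvd:
  assumes "\<And>j. j \<in> {1..Suc n} \<Longrightarrow> j dvd D" "k \<le> n"
  shows "Suc n * (n choose k) dvd D"
  using assms
proof (induction k arbitrary: n)
  case 0
  then show ?case by simp
next
  case (Suc k)
  then obtain m where n: "n = Suc m" by (cases n) auto
  have "Suc m * (m choose k) dvd D" by (rule Suc.IH) (use Suc.prems n in auto)
  moreover have "Suc n * (n choose k) dvd D" by (rule Suc.IH) (use Suc.prems n in auto)
  ultimately obtain x y where x: "D = Suc m * (m choose k) * x" and y: "D = Suc n * (n choose k) * y"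
    unfolding dvd_def by blast
  define X Y Z where "X = (m choose k)" and "Y = (n choose k)" and "Z = (n choose Suc k)"
  have km: "k \<le> m" using Suc.prems n by simp
  have Z: "Suc k * Z = n * X" unfolding Z_def X_def n using Suc_times_binomial_eq[of m k] by (simp only: mult.commute)
  have Y: "(n - k) * Y = n * X"
    unfolding X_def Y_def n using binomial_absorb_comp[of "Suc m" k] by simp
  have "int D = int (Suc n * Z) * (int x - int y)"
  proof -
    have X0: "0 < X" "0 < n" using km n by (simp_all add: X_def)
    have "Suc m * X * x = Suc n * Y * y" using x y by (simp only: X_def Y_def)
    then have xy: "n * x * X = Suc n * Y * y" unfolding n by (simp only: mult_ac)
    have e1: "(n - k) * (n * x * X) = Suc n * (n * X) * y"
    proof -
      have "(n - k) * (n * x * X) = Suc n * ((n - k) * Y) * y" unfolding xy by (simp only: mult_ac)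
      then show ?thesis unfolding Y .
    qed
    then have "(n * X) * ((n - k) * x) = (n * X) * (Suc n * y)" by (simp only: mult_ac)
    then have e2: "(n - k) * x = Suc n * y" using X0 by (simp only: mult_cancel1) simp
    have "int (Suc k) * (int (Suc n * Z) * (int x - int y)) = int (Suc n) * int (Suc k * Z) * (int x - int y)"
      by (simp add: algebra_simps)
    also have "\<dots> = int n * int X * (int (Suc n) * int x - int (Suc n) * int y)"
      unfolding Z by (simp add: algebra_simps)
    also have "int (Suc n) * int y = int ((n - k) * x)" unfolding e2 by (simp only: of_nat_mult)
    also have "int n * int X * (int (Suc n) * int x - int ((n - k) * x)) = int (Suc k) * (int n * int X * int x)"
    proof -
      have nk: "int ((n - k) * x) = (int n - int k) * int x" using km n by (simp only: of_nat_mult) (simp add: of_nat_diff)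
      show ?thesis unfolding nk by (simp add: algebra_simps)
    qed
    also have "int n * int X * int x = int D" unfolding x X_def n by (simp only: of_nat_mult)
    finally show ?thesis by (simp only: mult_cancel_left) simp
  qed
  then have "int (Suc n * Z) dvd int D" by (rule dvdI)
  then show ?case unfolding Z_def by (simp only: of_nat_dvd_iff)
qed

text \<open>A Chebyshev-type argument with \<open>D\<close> the least common multiple of 1 to
  \<open>2 m + 1\<close>. Each prime contributes a power of at most \<open>2 m + 1\<close>, so
  without primes above \<open>y\<close> one has \<open>D <= (2 m + 1)^y\<close>. But
  \<open>D\<close> is divisible by \<open>(2 m + 1) (2 m choose m)\<close>, and the central
  coefficient is at least \<open>2^m\<close> as a sum of squares of the row
  \<open>m\<close>.\<close>

lemma exists_prime_between:
  fixes y m :: nat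
  assumes "2 \<le> y" "(2 * m + 1) ^ y < 2 ^ m"
  shows "\<exists>p. prime p \<and> y < p \<and> p \<le> 2 * m + 1"
proof (rule ccontr)
  assume no: "\<not> ?thesis"
  define M where "M = 2 * m + 1"
  define e where "e p = (GREATEST k. p ^ k \<le> M)" for p :: nat
  define Pr where "Pr = {p. prime p \<and> p \<le> M}"
  have fPr: "finite Pr" unfolding Pr_def by (rule finite_subset[of _ "{..M}"]) auto
  have bdd: "k \<le> M" if "prime p" "p ^ k \<le> M" for p k
  proof -
    have "k < p ^ k" using that prime_gt_1_nat[of p] by (intro power_gt_expt) auto
    then show ?thesis using that by simp
  qed
  have e_le: "p ^ e p \<le> M" if "prime p" for p
    unfolding e_def by (rule GreatestI_nat[of "\<lambda>k. p ^ k \<le> M" 0 M]) (use bdd that in \<open>auto simp: M_def\<close>)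
  have le_e: "k \<le> e p" if "prime p" "p ^ k \<le> M" for p k
    unfolding e_def by (rule Greatest_le_nat[of "\<lambda>k. p ^ k \<le> M" k M]) (use bdd that in auto)
  define D where "D = (\<Prod>p\<in>Pr. p ^ e p)"
  have D0: "0 < D" unfolding D_def Pr_def by (intro prod_pos) (auto simp: prime_gt_0_nat)
  have dvdD: "j dvd D" if j: "j \<in> {1..M}" for j
  proof (rule multiplicity_le_imp_dvd)
    show "j \<noteq> 0" using j by simp
    fix p :: nat assume p: "prime p"
    show "multiplicity p j \<le> multiplicity p D"
    proof (cases "multiplicity p j = 0")
      case False
      have pj: "p ^ multiplicity p j \<le> M"
        using j by (meson atLeastAtMost_iff dvd_imp_le less_le_trans multiplicity_dvd order_trans zero_less_one)
      have "p ^ 1 \<le> p ^ multiplicity p j" using False p prime_ge_1_nat by (intro power_increasing) auto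
      then have "p \<in> Pr" using pj p by (simp add: Pr_def)
      then have "p ^ e p dvd D" unfolding D_def using fPr by (intro dvd_prodI) auto
      then have "p ^ multiplicity p j dvd D"
        using le_e[OF p pj] by (meson dvd_trans le_imp_power_dvd)
      then show ?thesis using D0 p by (intro multiplicity_geI) auto
    qed simp
  qed
  have "D \<le> (\<Prod>p\<in>Pr. M)" unfolding D_def using e_le by (intro prod_mono) (auto simp: Pr_def)
  also have "\<dots> = M ^ card Pr" by simp
  also have "\<dots> \<le> M ^ y"
  proof (rule power_increasing)
    have "Pr \<subseteq> {1..y}"
    proof
      fix p assume "p \<in> Pr"
      then have "prime p" "\<not> y < p" using no by (auto simp: Pr_def M_def)
      then show "p \<in> {1..y}" using prime_ge_1_nat[of p] by simp
    qed
    then show "card Pr \<le> y" using card_mono[of "{1..y}" Pr] by simp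
  qed (simp add: M_def)
  also have "\<dots> < 2 ^ m" using assms(2) by (simp add: M_def)
  also have "\<dots> \<le> (2 * m) choose m"
  proof (cases "m = 0")
    case False
    have "(2 * m) choose m = (\<Sum>k\<le>m. (m choose k)\<^sup>2)" by (simp add: choose_square_sum)
    moreover have "(\<Sum>k\<le>m. (m choose k)) \<le> (\<Sum>k\<le>m. (m choose k)\<^sup>2)" by (intro sum_mono) (simp add: power2_eq_square Suc_le_eq)
    ultimately show ?thesis by (simp add: choose_row_sum)
  qed simp
  also have "\<dots> \<le> Suc (2 * m) * ((2 * m) choose m)" by simp
  also have "\<dots> \<le> D"
    by (rule dvd_imp_le[OF Suc_mult_choose_dvd D0]) (use dvdD in \<open>auto simp: M_def\<close>)
  finally show False by simp
qed

section \<open>The exponent\<close>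

lemma harm_le_ln: "0 < n \<Longrightarrow> harm n \<le> 1 + ln (real n)"
  using decseqD[OF decseq_harm_diff_ln, of 0 "n - 1"] by (simp add: harm_def)

lemma power_powr: "0 < x \<Longrightarrow> (x ^ k) powr a = x powr (real k * a)" for x :: real
  by (simp only: powr_realpow[symmetric] powr_powr)

lemma finite_convex_set: "convex_set A \<Longrightarrow> finite A"
  by (auto simp: convex_set_def)

lemma card_close_pairs_le: "finite A \<Longrightarrow> card (close_pairs (popular p A) A) \<le> popular_pairs p A"
  unfolding popular_pairs_def
  by (rule card_mono[OF finite_subset[of _ "A \<times> A"]]) (auto simp: close_pairs_def)

text \<open>For fixed \<open>a\<close> and \<open>c\<close> the quadruples correspond to
  representations of the difference \<open>a - c\<close>, which is not popular, so only levels below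
  \<open>p\<close> occur. Each layer consists of pairs counted by
  \<open>popular_pairs\<close>.\<close>

lemma card_quads_le:
  assumes fA: "finite A"
  shows "real (card (quads (popular p A) A)) \<le> (\<Sum>k=1..p. real (popular_pairs k A))"
proof -
  define Pr where "Pr = {(a,c). a \<in> A \<and> c \<in> A \<and> a - c \<notin> popular p A}"
  define r where "r i = rep A A (fst i - snd i)" for i
  have fPr: "finite Pr" unfolding Pr_def by (rule finite_subset[of _ "A \<times> A"]) (use fA in auto)
  \<comment> \<open>With \<open>z = a - c\<close>, the fourth element is \<open>b - z\<close>.
    Writing \<open>b\<close> as \<open>z + (b - z)\<close> puts the condition into the form of
    \<open>rep\<close>.\<close>
  have "card (quads (popular p A) A) \<le> card (SIGMA i:Pr. {b\<in>A. (fst i - snd i) + (b - (fst i - snd i)) \<in> A \<and> b - (fst i - snd i) \<in> A})"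
    by (rule card_inj_on_le[of "\<lambda>(a,b,c). ((a,c),b)"])
       (use fPr fA in \<open>auto simp: inj_on_def quads_def Pr_def algebra_simps\<close>)
  also have "\<dots> = (\<Sum>i\<in>Pr. card {b\<in>A. (fst i - snd i) + (b - (fst i - snd i)) \<in> A \<and> b - (fst i - snd i) \<in> A})"
    using fPr fA by simp
  also have "\<dots> \<le> (\<Sum>i\<in>Pr. r i)"
  proof (rule sum_mono)
    fix i
    show "card {b\<in>A. (fst i - snd i) + (b - (fst i - snd i)) \<in> A \<and> b - (fst i - snd i) \<in> A} \<le> r i"
      unfolding r_def rep_def
      by (rule card_inj_on_le[of "\<lambda>b. b - (fst i - snd i)"]) (use fA in \<open>auto simp: inj_on_def\<close>)
  qed
  finally have "real (card (quads (popular p A) A)) \<le> real (\<Sum>i\<in>Pr. r i)" by (rule of_nat_mono)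
  also have "\<dots> = (\<Sum>i\<in>Pr. \<Sum>k=1..r i. 1)" by simp
  also have "\<dots> = (\<Sum>k=1..p. 1 * real (card {i\<in>Pr. k \<le> r i}))"
    by (rule layer_sum[OF fPr]) (auto simp: Pr_def r_def popular_def)
  also have "\<dots> \<le> (\<Sum>k=1..p. real (popular_pairs k A))"
  proof (rule sum_mono)
    fix k
    have "card {i\<in>Pr. k \<le> r i} \<le> popular_pairs k A"
      unfolding popular_pairs_def
      by (rule card_mono[OF finite_subset[of _ "A \<times> A"]]) (use fA in \<open>auto simp: Pr_def r_def popular_def\<close>)
    then show "1 * real (card {i\<in>Pr. k \<le> r i}) \<le> real (popular_pairs k A)" by simp
  qed
  finally show ?thesis .
qed

text \<open>The three costs of \<open>sidon_subset_of_prime\<close> as powers of \<open>p\<close>.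
  Pairs and quadruples both give \<open>p powr (- (139/51))\<close>, with
  \<open>2658816 = 2304 + 2304 + 2 * 1327104\<close>; the proportional relations give the last term,
  with \<open>42467328 = 32 * 1327104\<close>.\<close>

lemma sidon_subset_of_controlled:
  assumes ctrl: "controlled C A" and C: "0 < C" and fA: "finite A" and p: "prime p" "2 < p" "p \<le> card A"
  defines "n \<equiv> real (card A)" and "L \<equiv> 1 + ln (real (card A))"
  assumes bound: "2658816 * ((2 ^ 120 * 3 ^ 10 * C ^ 21) powr (1/51) * n powr (118/51) * L powr (30/51)) * L * real p powr (- (139/51))
    + 42467328 * (root 3 C * n powr (5/3)) * L ^ 3 * real p powr (-2) \<le> n / 2"
  shows "\<exists>B\<subseteq>A. sidon B \<and> n \<le> 8 * real p * real (card B)"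
proof -
  have p0: "0 < real p" "1 \<le> real p" using p by auto
  have n1: "1 \<le> n" using p unfolding n_def by simp
  define h where "h = (harm (card A) :: real)"
  have hL: "h \<le> L" unfolding h_def L_def by (rule harm_le_ln) (use p in simp)
  have h0: "0 \<le> h" by (simp add: h_def harm_nonneg)
  have L1: "1 \<le> L" using n1 by (simp add: L_def n_def)
  have harm_p: "(harm p :: real) \<le> L" using harm_mono[OF p(3), where 'a = real] hL unfolding h_def by linarith
  define G where "G = (2 ^ 120 * 3 ^ 10 * C ^ 21) powr (1/51) * n powr (118/51) * L powr (30/51)"
  have G0: "0 \<le> G" by (simp add: G_def)
  have N: "real (popular_pairs k A) \<le> G * real k powr (- (37/51))" if k: "0 < k" for k
  proof -
    let ?N = "real (popular_pairs k A)"
    have "?N ^ 51 * real k ^ 37 \<le> 2 ^ 120 * 3 ^ 10 * C ^ 21 * n ^ 118 * h ^ 30"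
      unfolding n_def h_def by (rule popular_pairs_le[OF ctrl _ fA k]) (use C in simp)
    also have "\<dots> \<le> 2 ^ 120 * 3 ^ 10 * C ^ 21 * n ^ 118 * L ^ 30"
      using C n1 by (intro mult_left_mono power_mono hL h0) auto
    finally have "(?N ^ 51 * real k ^ 37) powr (1/51) \<le> (2 ^ 120 * 3 ^ 10 * C ^ 21 * n ^ 118 * L ^ 30) powr (1/51)"
      by (intro powr_mono2) auto
    also have "\<dots> = (2 ^ 120 * 3 ^ 10 * C ^ 21) powr (1/51) * (n ^ 118) powr (1/51) * (L ^ 30) powr (1/51)"
      by (simp only: powr_mult)
    also have "(n ^ 118) powr (1/51) = n powr (118/51)"
      using n1 power_powr[of n 118 "1/51"] by simp
    also have "(L ^ 30) powr (1/51) = L powr (30/51)"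
      using L1 power_powr[of L 30 "1/51"] by simp
    also have "(?N ^ 51 * real k ^ 37) powr (1/51) = ?N * real k powr (37/51)"
    proof -
      have "(?N ^ 51) powr (1/51) = ?N"
      proof (cases "popular_pairs k A = 0")
        case False
        then show ?thesis using power_powr[of ?N 51 "1/51"] by simp
      qed simp
      moreover have "(real k ^ 37) powr (1/51) = real k powr (37/51)"
        using k power_powr[of "real k" 37 "1/51"] by simp
      ultimately show ?thesis by (simp add: powr_mult)
    qed
    finally have "?N * real k powr (37/51) \<le> G" by (simp add: G_def)
    then have "(?N * real k powr (37/51)) * real k powr (- (37/51)) \<le> G * real k powr (- (37/51))"
      by (rule mult_right_mono) simp
    moreover have "real k powr (37/51) * real k powr (- (37/51)) = 1"
      using k by (simp flip: powr_add)
    ultimately show ?thesis by (simp only: mult.assoc mult_1_right)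
  qed
  have X: "real (card (close_pairs (popular p A) A)) \<le> G * real p powr (- (37/51))"
    using card_close_pairs_le[OF fA, of p] N[of p] p by simp
  have Q: "real (card (quads (popular p A) A)) \<le> G * real p powr (14/51) * L"
  proof -
    have "real (card (quads (popular p A) A)) \<le> (\<Sum>k=1..p. real (popular_pairs k A))"
      by (rule card_quads_le[OF fA])
    also have "\<dots> \<le> (\<Sum>k=1..p. G * real p powr (14/51) * inverse (real k))"
    proof (rule sum_mono)
      fix k assume k: "k \<in> {1..p}"
      \<comment> \<open>Splitting off \<open>1 / k\<close> and enlarging
        \<open>k powr (14/51)\<close> to \<open>p powr (14/51)\<close> turns the sum of powers into
        a harmonic sum, at the cost of a logarithm.\<close>
      have "real k powr (- (37/51)) = real k powr (14/51) * inverse (real k)"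
      proof -
        have "real k powr (- (37/51)) = real k powr (14/51 + - 1)" by simp
        also have "\<dots> = real k powr (14/51) * real k powr - 1" by (rule powr_add)
        finally show ?thesis using k by (simp add: powr_minus)
      qed
      also have "\<dots> \<le> real p powr (14/51) * inverse (real k)"
        using k by (intro mult_right_mono powr_mono2) auto
      finally have "G * real k powr (- (37/51)) \<le> G * (real p powr (14/51) * inverse (real k))"
        by (rule mult_left_mono[OF _ G0])
      then show "real (popular_pairs k A) \<le> G * real p powr (14/51) * inverse (real k)"
        using N[of k] k by (simp add: mult.assoc)
    qed
    also have "\<dots> = G * real p powr (14/51) * harm p" by (simp add: harm_def sum_distrib_left)
    also have "\<dots> \<le> G * real p powr (14/51) * L" by (intro mult_left_mono harm_p) (simp add: G0)
    finally show ?thesis .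
  qed
  have root: "root 3 (C * n ^ 5) = root 3 C * n powr (5/3)"
  proof -
    have "root 3 (n ^ 5) = (n ^ 5) powr (1/3)" using n1 by (simp add: root_powr_inverse)
    also have "\<dots> = n powr (5/3)" using n1 power_powr[of n 5 "1/3"] by simp
    finally show ?thesis by (simp add: real_root_mult)
  qed
  define W where "W = root 3 C * n powr (5/3)"
  have W0: "0 \<le> W" using C by (simp add: W_def)
  have pw: "real p powr (- (37/51)) / real p ^ 2 = real p powr (- (139/51))"
    "real p powr (14/51) / real p ^ 3 = real p powr (- (139/51))"
    "1 / real p ^ 2 = real p powr (- 2)"
  proof -
    have e: "1 / real p ^ k = real p powr (- real k)" for k
      using p0 by (simp add: powr_minus powr_realpow divide_inverse)
    have "real p powr a / real p ^ k = real p powr (a + - real k)" for a k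
      unfolding powr_add using e[of k] by (simp add: divide_inverse)
    from this[of "- (37/51)" 2] this[of "14/51" 3] e[of 2]
    show "real p powr (- (37/51)) / real p ^ 2 = real p powr (- (139/51))"
      "real p powr (14/51) / real p ^ 3 = real p powr (- (139/51))"
      "1 / real p ^ 2 = real p powr (- 2)" by simp_all
  qed
  define V where "V = G * L * real p powr (- (139/51))"
  let ?X = "real (card (close_pairs (popular p A) A))" and ?Q = "real (card (quads (popular p A) A))"
  have tX: "?X / real p ^ 2 \<le> V"
  proof -
    have "?X / real p ^ 2 \<le> G * real p powr (- (37/51)) / real p ^ 2" by (intro divide_right_mono X) auto
    also have "\<dots> = G * real p powr (- (139/51))" using pw(1) by (metis times_divide_eq_right)
    also have "\<dots> \<le> V" unfolding V_def using L1 G0 mult_left_mono[OF L1 G0] by (intro mult_right_mono) auto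
    finally show ?thesis .
  qed
  have tQ: "?Q / real p ^ 3 \<le> V"
  proof -
    have "?Q / real p ^ 3 \<le> (G * real p powr (14/51) * L) / real p ^ 3" by (intro divide_right_mono Q) auto
    also have "\<dots> = G * L * (real p powr (14/51) / real p ^ 3)" by simp
    also have "\<dots> = V" unfolding pw V_def ..
    finally show ?thesis .
  qed
  have tQ4: "?Q / real p ^ 4 \<le> V"
  proof -
    have "real p ^ 3 \<le> real p ^ 4" using p0 by (intro power_increasing) auto
    then have "?Q / real p ^ 4 \<le> ?Q / real p ^ 3" using p0 by (intro divide_left_mono) auto
    then show ?thesis using tQ by linarith
  qed
  have tT: "32 * real p ^ 2 * harm p ^ 2 * (root 3 (C * n ^ 5) * h) / real p ^ 4 \<le> 32 * (W * L ^ 3 * real p powr (-2))"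
  proof -
    have "harm p ^ 2 * h \<le> L ^ 2 * L"
      using harm_p hL h0 L1 by (intro mult_mono power_mono) (auto simp: harm_nonneg)
    then have "harm p ^ 2 * h \<le> L ^ 3" by (simp add: power2_eq_square power3_eq_cube)
    then have "32 * W * (1 / real p ^ 2) * (harm p ^ 2 * h) \<le> 32 * W * (1 / real p ^ 2) * L ^ 3"
      using W0 by (intro mult_left_mono) auto
    moreover have "32 * real p ^ 2 * harm p ^ 2 * (root 3 (C * n ^ 5) * h) / real p ^ 4 = 32 * W * (1 / real p ^ 2) * (harm p ^ 2 * h)"
      unfolding root W_def[symmetric] using p0 by (simp add: power2_eq_square numeral_eq_Suc)
    ultimately show ?thesis unfolding pw by (simp add: mult_ac)
  qed
  have "2304 * ?X / real p ^ 2 + 2304 * ?Q / real p ^ 3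
      + 1327104 / real p ^ 4 * (2 * ?Q + 32 * real p ^ 2 * harm p ^ 2 * (root 3 (C * n ^ 5) * h))
    = 2304 * (?X / real p ^ 2) + 2304 * (?Q / real p ^ 3) + 2654208 * (?Q / real p ^ 4)
      + 1327104 * (32 * real p ^ 2 * harm p ^ 2 * (root 3 (C * n ^ 5) * h) / real p ^ 4)"
    by (simp add: distrib_left add_divide_distrib)
  also have "\<dots> \<le> 2304 * V + 2304 * V + 2654208 * V + 1327104 * (32 * (W * L ^ 3 * real p powr (-2)))"
    by (intro add_mono mult_left_mono tX tQ tQ4 tT) auto
  also have "\<dots> = 2658816 * G * L * real p powr (- (139/51)) + 42467328 * W * L ^ 3 * real p powr (-2)"
    by (simp add: V_def)
  also have "\<dots> \<le> n / 2" using bound unfolding G_def W_def .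
  finally show ?thesis
    unfolding n_def h_def by (rule sidon_subset_of_prime[OF ctrl less_imp_le[OF C] fA p(1,2)])
qed

section \<open>Choice of the prime and conclusion\<close>

lemma max_sidon_ge:
  assumes "finite A" "B \<subseteq> A" "sidon B"
  shows "card B \<le> max_sidon A"
proof -
  have "finite {card B |B. B \<subseteq> A \<and> sidon B}"
    by (rule finite_subset[of _ "card ` Pow A"]) (use assms in auto)
  then show ?thesis unfolding max_sidon_def by (rule Max_ge) (use assms in blast)
qed

text \<open>The lower exponent 17/35 lies slightly above the threshold 67/139, and the upper one is
  \<open>73/150 = 1 - (1/2 + 1/75)\<close>, so that \<open>n / p\<close> has the desired size. As
  the exponents differ, the upper end exceeds the lower one times a logarithm, which is all that
  \<open>exists_prime_between\<close> needs.\<close>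

lemma eventually_prime_in_window:
  "eventually (\<lambda>n::nat. \<exists>p. prime p \<and> 2 < p \<and> real n powr (17/35) \<le> real p \<and> real p \<le> real n powr (73/150)) at_top"
proof -
  have "eventually (\<lambda>x::real. (x powr (17/35) + 1) * ln x < (x powr (73/150) / 2 - 2) * ln 2) at_top"
    by real_asymp
  moreover have "eventually (\<lambda>x::real. 2 \<le> x powr (17/35)) at_top" by real_asymp
  moreover have "eventually (\<lambda>x::real. 1 < x) at_top" by real_asymp
  ultimately have ev: "eventually (\<lambda>x::real. (x powr (17/35) + 1) * ln x < (x powr (73/150) / 2 - 2) * ln 2
      \<and> 2 \<le> x powr (17/35) \<and> 1 < x) at_top"
    by eventually_elim auto
  have "eventually (\<lambda>n::nat. (real n powr (17/35) + 1) * ln (real n) < (real n powr (73/150) / 2 - 2) * ln 2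
      \<and> 2 \<le> real n powr (17/35) \<and> 1 < real n) at_top"
    using filterlim_real_sequentially ev by (rule eventually_compose_filterlim[rotated])
  then show ?thesis
  proof eventually_elim
    case (elim n)
    define x where "x = real n"
    define y where "y = nat \<lceil>x powr (17/35)\<rceil>"
    define m where "m = nat \<lfloor>(x powr (73/150) - 1) / 2\<rfloor>"
    have x: "1 < x" "2 \<le> x powr (17/35)"
      "(x powr (17/35) + 1) * ln x < (x powr (73/150) / 2 - 2) * ln 2" using elim by (auto simp: x_def)
    have y: "x powr (17/35) \<le> real y" "real y \<le> x powr (17/35) + 1"
      using x(2) unfolding y_def by linarith+
    have "0 < (x powr (73/150) / 2 - 2) * ln 2"
      by (rule le_less_trans[OF _ x(3)]) (use x in auto)
    then have big: "4 < x powr (73/150)" by (simp add: zero_less_mult_iff)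
    have m: "2 * real m + 1 \<le> x powr (73/150)" "x powr (73/150) / 2 - 2 \<le> real m"
    proof -
      define q where "q = (x powr (73/150) - 1) / 2"
      have "0 \<le> \<lfloor>q\<rfloor>" using big by (simp add: q_def)
      then have "real m = of_int \<lfloor>q\<rfloor>" unfolding m_def q_def by simp
      then have "real m \<le> q" "q - 1 \<le> real m" by linarith+
      then show "2 * real m + 1 \<le> x powr (73/150)" "x powr (73/150) / 2 - 2 \<le> real m"
        by (simp_all add: q_def field_simps)
    qed
    have mx: "2 * real m + 1 \<le> x"
      using m(1) powr_mono[of "73/150" 1 x] x(1) by simp
    have "real y * ln (2 * real m + 1) \<le> (x powr (17/35) + 1) * ln x"
      using y mx x by (intro mult_mono) auto
    also note x(3)
    also have "(x powr (73/150) / 2 - 2) * ln 2 \<le> real m * ln 2" using m(2) by (intro mult_right_mono) auto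
    finally have "ln (real ((2 * m + 1) ^ y)) < ln (real (2 ^ m))"
      by (simp add: ln_realpow add.commute)
    then have "(2 * m + 1) ^ y < 2 ^ m"
      by (subst (asm) ln_less_cancel_iff) (simp_all only: of_nat_less_iff, simp_all)
    moreover have "2 \<le> y" using y(1) x(2) by linarith
    ultimately obtain p where p: "prime p" "y < p" "p \<le> 2 * m + 1" using exists_prime_between by blast
    have "real p \<le> x powr (73/150)" using p(3) m(1) by linarith
    moreover have "x powr (17/35) \<le> real p" using p(2) y(1) by linarith
    ultimately show ?case using p \<open>2 \<le> y\<close> by (intro exI[of _ p]) (auto simp: x_def)
  qed
qed

lemma eventually_sidon_subset:
  "eventually (\<lambda>n::nat. \<forall>A. convex_set A \<longrightarrow> card A = n \<longrightarrow>
     real n powr (77/150) \<le> 8 * real (max_sidon A)) at_top"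
proof -
  define K :: real where "K = 2658816 * (2 ^ 120 * 3 ^ 10 * 512 ^ 21) powr (1/51)"
  define K' :: real where "K' = 42467328 * root 3 512"
  have K: "0 < K" and K': "0 < K'" by (simp_all add: K_def K'_def)
  \<comment> \<open>At \<open>p = x powr (17/35)\<close> the factors in \<open>p\<close> become
    \<open>x powr (- (139/105))\<close> and \<open>x powr (- (34/35))\<close>. The total exponents
    of \<open>x\<close> are 118/51 - 139/105 = 589/595 and 5/3 - 34/35 = 73/105, both below 1, which
    leaves room for the logarithms.\<close>
  have "eventually (\<lambda>x::real. K * x powr (118/51) * (1 + ln x) powr (30/51) * (1 + ln x) * x powr (- (139/105))
      + K' * x powr (5/3) * (1 + ln x) ^ 3 * x powr (- (34/35)) \<le> x / 2) at_top"
    using K K' by real_asymp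
  then have "eventually (\<lambda>n::nat. K * real n powr (118/51) * (1 + ln (real n)) powr (30/51) * (1 + ln (real n)) * real n powr (- (139/105))
      + K' * real n powr (5/3) * (1 + ln (real n)) ^ 3 * real n powr (- (34/35)) \<le> real n / 2) at_top"
    using filterlim_real_sequentially by (rule eventually_compose_filterlim)
  then show ?thesis
    using eventually_prime_in_window eventually_gt_at_top[of 0]
  proof eventually_elim
    case (elim n)
    obtain p where p: "prime p" "2 < p" "real n powr (17/35) \<le> real p" "real p \<le> real n powr (73/150)"
      using elim(2) by blast
    have n1: "1 \<le> real n" using elim(3) by simp
    have pn: "p \<le> n"
      using p(4) powr_mono[of "73/150" 1 "real n"] n1 by simp
    have L0: "0 \<le> 1 + ln (real n)" using n1 by simp
    have neg: "real p powr (- a) \<le> real n powr (- (17/35 * a))" if "0 \<le> a" for a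
    proof -
      have "real p powr (- a) \<le> (real n powr (17/35)) powr (- a)"
        using p(3) that n1 by (intro powr_mono2') auto
      then show ?thesis by (simp add: powr_powr)
    qed
    show ?case
    proof (intro allI impI)
      fix A assume A: "convex_set A" "card A = n"
      have fA: "finite A" by (rule finite_convex_set[OF A(1)])
      have "K * real n powr (118/51) * (1 + ln (real n)) powr (30/51) * (1 + ln (real n)) * real p powr (- (139/51))
          + K' * real n powr (5/3) * (1 + ln (real n)) ^ 3 * real p powr (- 2)
        \<le> K * real n powr (118/51) * (1 + ln (real n)) powr (30/51) * (1 + ln (real n)) * real n powr (- (139/105))
          + K' * real n powr (5/3) * (1 + ln (real n)) ^ 3 * real n powr (- (34/35))"
        using neg[of "139/51"] neg[of 2] K K' L0 by (intro add_mono mult_left_mono) auto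
      also have "\<dots> \<le> real n / 2" by (rule elim(1))
      finally have "2658816 * ((2 ^ 120 * 3 ^ 10 * 512 ^ 21) powr (1/51) * real (card A) powr (118/51) * (1 + ln (real (card A))) powr (30/51))
            * (1 + ln (real (card A))) * real p powr (- (139/51))
          + 42467328 * (root 3 512 * real (card A) powr (5/3)) * (1 + ln (real (card A))) ^ 3 * real p powr (- 2) \<le> real (card A) / 2"
        unfolding K_def K'_def A(2) by (simp only: mult.assoc)
      then obtain B where B: "B \<subseteq> A" "sidon B" "real (card A) \<le> 8 * real p * real (card B)"
        using sidon_subset_of_controlled[OF convex_set_controlled[OF A(1)] _ fA p(1,2)] pn A(2) by auto
      have "real n \<le> 8 * real p * real (card B)" using B(3) A(2) by simp
      also have "\<dots> \<le> 8 * real n powr (73/150) * real (max_sidon A)"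
        using p(4) max_sidon_ge[OF fA B(1,2)] by (intro mult_mono) auto
      finally have "real n * real n powr (- (73/150)) \<le> (8 * real n powr (73/150) * real (max_sidon A)) * real n powr (- (73/150))"
        by (rule mult_right_mono) simp
      also have "\<dots> = 8 * real (max_sidon A) * (real n powr (73/150) * real n powr (- (73/150)))" by (simp only: mult_ac)
      also have "real n powr (73/150) * real n powr (- (73/150)) = 1" using n1 by (simp flip: powr_add)
      also have "real n * real n powr (- (73/150)) = real n powr (77/150)"
        using n1 powr_add[of "real n" 1 "- (73/150)"] by simp
      finally show "real n powr (77/150) \<le> 8 * real (max_sidon A)" by simp
    qed
  qed
qed

theorem theorem1p4:
  shows "\<forall>\<epsilon>::real. \<epsilon> > 0 \<longrightarrow>
    (\<exists>c::real. c > 0 \<and>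
      (\<forall>A::real set. convex_set A \<longrightarrow>
        real (max_sidon A) \<ge> c * real (card A) powr (1/2 + 1/75 - \<epsilon>)))"
proof (intro allI impI)
  fix \<epsilon> :: real assume \<epsilon>: "\<epsilon> > 0"
  obtain n0 :: nat where n0: "\<And>n A. n0 \<le> n \<Longrightarrow> convex_set A \<Longrightarrow> card A = n \<Longrightarrow>
      real n powr (77/150) \<le> 8 * real (max_sidon A)"
    using eventually_sidon_subset by (auto simp: eventually_at_top_linorder)
  \<comment> \<open>Small enough both for the factor 8 of the asymptotic bound and for the sets
    below \<open>n0\<close>, where a single element is a Sidon set and the power of
    \<open>card A\<close> is less than \<open>n0 + 1\<close>.\<close>
  define c :: real where "c = 1 / (8 * (real n0 + 1))"
  have c: "0 < c" "c \<le> 1/8" by (simp_all add: c_def field_simps)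
  have "c * real (card A) powr (1/2 + 1/75 - \<epsilon>) \<le> real (max_sidon A)" if A: "convex_set A" for A
  proof -
    have fA: "finite A" by (rule finite_convex_set[OF A])
    consider "card A = 0" | "0 < card A" "card A < n0" | "0 < card A" "n0 \<le> card A" by linarith
    then show ?thesis
    proof cases
      \<comment> \<open>For the empty set the power is \<open>0 powr _\<close>, which is 0 whatever
        the exponent.\<close>
      case 1 then show ?thesis by simp
    next
      case 2
      then obtain a where "a \<in> A" by fastforce
      then have "card {a} \<le> max_sidon A" by (intro max_sidon_ge fA) (auto simp: sidon_def)
      moreover have "real (card A) powr (1/2 + 1/75 - \<epsilon>) \<le> real (card A) powr 1"
        using 2 \<epsilon> by (intro powr_mono) auto
      then have "real (card A) powr (1/2 + 1/75 - \<epsilon>) \<le> real n0 + 1" using 2 by simp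
      then have "c * real (card A) powr (1/2 + 1/75 - \<epsilon>) \<le> c * (real n0 + 1)"
        using c by (intro mult_left_mono) auto
      moreover have "c * (real n0 + 1) \<le> 1" by (simp add: c_def)
      ultimately show ?thesis by simp
    next
      case 3
      have "real (card A) powr (1/2 + 1/75 - \<epsilon>) \<le> real (card A) powr (77/150)"
        using 3 \<epsilon> by (intro powr_mono) auto
      also have "\<dots> \<le> 8 * real (max_sidon A)" using n0[OF 3(2) A] by simp
      finally have "c * real (card A) powr (1/2 + 1/75 - \<epsilon>) \<le> (1/8) * (8 * real (max_sidon A))"
        using c by (intro mult_mono) auto
      then show ?thesis by simp
    qed
  qed
  then show "\<exists>c>0. \<forall>A. convex_set A \<longrightarrow> c * real (card A) powr (1/2 + 1/75 - \<epsilon>) \<le> real (max_sidon A)"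
    using c(1) by blast
qed

end
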